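(* There exist positive universal constants $c_1,c_2,c_3,C_4,C_5,C_6$ such that the following holds. Let $d\geqslant 2$ and fix $0<\epsilon<c_1 d^{-102}$. Let $x_*\in\mathbb{R}^k\setminus\{0\}$, let $\eta\in\mathbb{R}^m$ satisfy $\|\eta\|\leqslant c_2\frac{\|x_*\|}{2^{d/2}d^{48}}$, and let $b_*=|AG(x_* )|+\eta$. Suppose each $W_i$ ($i\in[d]$) satisfies the WDC with constant $\epsilon$ and $A$ satisfies the RRCP with respect to $G$ with constant $\epsilon$. Then the iterates $\{x_t\}_{t\geqslant 0}$ generated by the DPR subgradient method with step size $0<\alpha\leqslant c_3\frac{2^d}{d^2}$ obey: (1) there exists $N\in\mathbb{N}$ with $N\leqslant C_4\frac{f(x_0)\,2^{2d}}{d^6\alpha\epsilon\|x_*\|^2}$ such that $\|x_N-x_*\|\leqslant C_5 d^{12}\sqrt{\epsilon}\|x_*\|+C_6 d^9 2^{d/2}\|\eta\|$; (2) for all $t\geqslant N$, $\|x_{t+1}-x_*\|\leqslant \tau^{t+1-N}\|x_N-x_*\|+\vartheta\frac{2^{d/2}}{d^2}\|\eta\|$ and $\|G(x_{t+1})-G(x_* )\|\leqslant \frac{1.2}{2^{d/2}}\tau^{t+1-N}\|x_N-x_*\|+\frac{1.2}{d^2}\vartheta\|\eta\|$, where $\tau:=1-\frac{7}{8}\frac{\alpha}{2^d}\in(0,1)$ and $\vartheta:=\frac{2c_3}{1-\tau}$.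
   Context: Network: integers $k=n_0<n_1<\dots<n_d=n$, matrices $W_i\in\mathbb{R}^{n_i\times n_{i-1}}$, and $G:\mathbb{R}^k\to\mathbb{R}^n$, $G(x)=\mathrm{relu}(W_d\cdots\mathrm{relu}(W_2\,\mathrm{relu}(W_1x))\cdots)$, $\mathrm{relu}(t)=\max(t,0)$ entrywise. For $W\in\mathbb{R}^{p\times k}$ and $x\in\mathbb{R}^k$, $W_{+,x}:=\mathrm{diag}(Wx>0)W$, where $\mathrm{diag}(v>0)$ is diagonal with $i$-th entry $1$ if $v_i>0$ and $0$ otherwise. For nonzero $x,y$, $\theta_{x,y}=\angle(x,y)\in[0,\pi]$, $\hat x=x/\|x\|$, and $M_{\hat x\leftrightarrow\hat y}$ is the symmetric matrix sending $\hat x\mapsto\hat y$, $\hat y\mapsto\hat x$, and $z\mapsto 0$ for $z\in\mathrm{span}(x,y)^\perp$ (equal to $\hat x\hat x^\top$ if $\theta_{x,y}=0$ and $-\hat x\hat x^\top$ if $\theta_{x,y}=\pi$). Norms are Euclidean for vectors and spectral for matrices. WDC: $W\in\mathbb{R}^{p\times k}$ satisfies the Weight Distribution Condition with constant $\epsilon$ if for all nonzero $x,y\in\mathbb{R}^k$, $\|W_{+,x}^\top W_{+,y}-Q_{x,y}\|\leqslant\epsilon$, where $Q_{x,y}=\frac{\pi-\theta_{x,y}}{2\pi}I_k+\frac{\sin\theta_{x,y}}{2\pi}M_{\hat x\leftrightarrow\hat y}$. For $A\in\mathbb{R}^{m\times n}$ and $z\in\mathbb{R}^n$, $A_z:=\mathrm{diag}(\mathrm{sgn}(Az))A$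 with $\mathrm{sgn}(0)=0$. For $z,w\in\mathbb{R}^n$, $\Phi_{z,w}:=\frac{\pi-2\theta_{z,w}}{\pi}I_n+\frac{2\sin\theta_{z,w}}{\pi}M_{\hat z\leftrightarrow\hat w}$ if $z,w\neq0$, and $\Phi_{z,w}=0$ otherwise. RRCP: $A$ satisfies the Range Restricted Concentration Property with respect to $G$ with constant $\epsilon$ if for all $x,y,x_1,x_2,x_3,x_4\in\mathbb{R}^k$: $|\langle(A_{G(x)}^\top A_{G(y)}-\Phi_{G(x),G(y)})(G(x_1)-G(x_2)),G(x_3)-G(x_4)\rangle|\leqslant L\epsilon\|G(x_1)-G(x_2)\|\|G(x_3)-G(x_4)\|$, with $L=33$. Objective: $f(x)=\frac12\||AG(x)|-b_*\|^2$ ($|\cdot|$ entrywise). $\partial f(x)$ denotes the Clarke generalized subdifferential: $\partial f(x)=\{v:\langle v,u\rangle\leqslant f^o(x;u)\ \forall u\}$, $f^o(x;u)=\limsup_{y\to x,t\downarrow0}(f(y+tu)-f(y))/t$. DPR subgradient method: choose arbitrary $x_0\in\mathbb{R}^k\setminus\{0\}$; for $t=0,1,2,\dots$: set $\bar x_t=-x_t$ if $f(-x_t)<f(x_t)$ and $\bar x_t=x_t$ otherwise; pick any $v_{\bar x_t}\in\partial f(\bar x_t)$; set $x_{t+1}=\bar x_t-\alpha v_{\bar x_t}$. *)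

theory Defs
  imports Complex_Main "Jordan_Normal_Form.Matrix" "HOL-Library.Extended_Real"
begin

definition vnorm :: "real vec \<Rightarrow> real" where
  "vnorm v = sqrt (v \<bullet> v)"

definition opnorm :: "real mat \<Rightarrow> real" where
  "opnorm M = Sup {vnorm (M *\<^sub>v v) | v. v \<in> carrier_vec (dim_col M) \<and> vnorm v \<le> 1}"

definition vangle :: "real vec \<Rightarrow> real vec \<Rightarrow> real" where
  "vangle x y = arccos ((x \<bullet> y) / (vnorm x * vnorm y))"

definition unitv :: "real vec \<Rightarrow> real vec" where
  "unitv x = (1 / vnorm x) \<cdot>\<^sub>v x"

definition diagm :: "real vec \<Rightarrow> real mat" where
  "diagm v = mat (dim_vec v) (dim_vec v) (\<lambda>(i,j). if i = j then v $ i else 0)"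

definition relu :: "real vec \<Rightarrow> real vec" where
  "relu v = map_vec (\<lambda>t. max t 0) v"

definition vabs :: "real vec \<Rightarrow> real vec" where
  "vabs v = map_vec abs v"

definition swapm :: "real vec \<Rightarrow> real vec \<Rightarrow> real mat" where
  "swapm x y = (THE M. M \<in> carrier_mat (dim_vec x) (dim_vec x) \<and> M\<^sup>T = M \<and>
      M *\<^sub>v unitv x = unitv y \<and> M *\<^sub>v unitv y = unitv x \<and>
      (\<forall>z \<in> carrier_vec (dim_vec x). z \<bullet> x = 0 \<and> z \<bullet> y = 0 \<longrightarrow> M *\<^sub>v z = 0\<^sub>v (dim_vec x)))"

definition Wplus :: "real mat \<Rightarrow> real vec \<Rightarrow> real mat" where
  "Wplus W x = diagm (map_vec (\<lambda>t. if t > 0 then 1 else 0) (W *\<^sub>v x)) * W"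

definition Qmat :: "real vec \<Rightarrow> real vec \<Rightarrow> real mat" where
  "Qmat x y = ((pi - vangle x y) / (2 * pi)) \<cdot>\<^sub>m 1\<^sub>m (dim_vec x)
     + (sin (vangle x y) / (2 * pi)) \<cdot>\<^sub>m swapm x y"

definition WDC :: "real mat \<Rightarrow> real \<Rightarrow> bool" where
  "WDC W \<epsilon> \<longleftrightarrow> (\<forall>x \<in> carrier_vec (dim_col W). \<forall>y \<in> carrier_vec (dim_col W).
      x \<noteq> 0\<^sub>v (dim_col W) \<longrightarrow> y \<noteq> 0\<^sub>v (dim_col W) \<longrightarrow>
      opnorm ((Wplus W x)\<^sup>T * Wplus W y - Qmat x y) \<le> \<epsilon>)"

definition Gnet :: "real mat list \<Rightarrow> real vec \<Rightarrow> real vec" where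
  "Gnet Ws x = foldl (\<lambda>v W. relu (W *\<^sub>v v)) x Ws"

definition Asgn :: "real mat \<Rightarrow> real vec \<Rightarrow> real mat" where
  "Asgn A z = diagm (map_vec sgn (A *\<^sub>v z)) * A"

definition Phi :: "real vec \<Rightarrow> real vec \<Rightarrow> real mat" where
  "Phi z w = (if z \<noteq> 0\<^sub>v (dim_vec z) \<and> w \<noteq> 0\<^sub>v (dim_vec w) then
      ((pi - 2 * vangle z w) / pi) \<cdot>\<^sub>m 1\<^sub>m (dim_vec z) + (2 * sin (vangle z w) / pi) \<cdot>\<^sub>m swapm z w
    else 0\<^sub>m (dim_vec z) (dim_vec z))"

text \<open>RRCP of A w.r.t. G = Gnet Ws on R^k, with L = 33.\<close>
definition RRCP :: "real mat \<Rightarrow> real mat list \<Rightarrow> nat \<Rightarrow> real \<Rightarrow> bool" where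
  "RRCP A Ws k \<epsilon> \<longleftrightarrow> (\<forall>x \<in> carrier_vec k. \<forall>y \<in> carrier_vec k. \<forall>x1 \<in> carrier_vec k.
     \<forall>x2 \<in> carrier_vec k. \<forall>x3 \<in> carrier_vec k. \<forall>x4 \<in> carrier_vec k.
     \<bar>((((Asgn A (Gnet Ws x))\<^sup>T * Asgn A (Gnet Ws y) - Phi (Gnet Ws x) (Gnet Ws y))
          *\<^sub>v (Gnet Ws x1 - Gnet Ws x2)) \<bullet> (Gnet Ws x3 - Gnet Ws x4))\<bar>
     \<le> 33 * \<epsilon> * vnorm (Gnet Ws x1 - Gnet Ws x2) * vnorm (Gnet Ws x3 - Gnet Ws x4))"

definition fobj :: "real mat \<Rightarrow> real mat list \<Rightarrow> real vec \<Rightarrow> real vec \<Rightarrow> real" where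
  "fobj A Ws b x = (1/2) * (vnorm (vabs (A *\<^sub>v Gnet Ws x) - b))\<^sup>2"

definition clarke_dd :: "nat \<Rightarrow> (real vec \<Rightarrow> real) \<Rightarrow> real vec \<Rightarrow> real vec \<Rightarrow> ereal" where
  "clarke_dd k f x u = (INF \<delta> \<in> {0<..}. SUP p \<in> {(y, t). y \<in> carrier_vec k \<and> vnorm (y - x) < \<delta> \<and> 0 < t \<and> t < \<delta>}.
      ereal ((f (fst p + snd p \<cdot>\<^sub>v u) - f (fst p)) / snd p))"

definition clarke_subdiff :: "nat \<Rightarrow> (real vec \<Rightarrow> real) \<Rightarrow> real vec \<Rightarrow> real vec set" where
  "clarke_subdiff k f x = {v \<in> carrier_vec k. \<forall>u \<in> carrier_vec k. ereal (v \<bullet> u) \<le> clarke_dd k f x u}"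

definition DPR_run :: "nat \<Rightarrow> (real vec \<Rightarrow> real) \<Rightarrow> real \<Rightarrow> (nat \<Rightarrow> real vec) \<Rightarrow> bool" where
  "DPR_run k f \<alpha> xs \<longleftrightarrow> xs 0 \<in> carrier_vec k \<and> xs 0 \<noteq> 0\<^sub>v k \<and>
     (\<forall>t. let xb = (if f (- xs t) < f (xs t) then - xs t else xs t) in
        \<exists>v \<in> clarke_subdiff k f xb. xs (Suc t) = xb - \<alpha> \<cdot>\<^sub>v v)"

end

theory Submission
  imports Defs "HOL-Analysis.Inner_Product"
begin

text \<open>
After scaling the output of every layer by \<open>sqrt 2\<close>, both concentration conditions say that each layer
acts almost isometrically on differences of outputs and maps an angle with cosine \<open>s\<close> to one with
cosine about \<open>\<kappa> s\<close>, where \<open>\<kappa>\<close> is the arc-cosine kernel (\<open>2 \<kappa> s - s\<close> for the layer of absolute values).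
Composing \<open>d + 1\<close> layers yields a convex profile \<open>\<psi>\<close>, and near every nonzero point the objective is
linearised, up to a small relative error, by the gradient of the surrogate
\<open>\<bar>x\<bar>\<^sup>2 / 2 - \<bar>w\<bar> \<bar>x\<bar> \<psi> (cos (x, w))\<close>, with \<open>w\<close> the target. Hence Clarke subgradients stay close to this gradient.

The surrogate is a quadratic minus a convex function, so a subgradient step decreases the objective by
an amount proportional to the squared gradient. The gradient is small only near \<open>w\<close> and near a negative
multiple of \<open>w\<close>; as \<open>\<psi> s - \<psi> (- s)\<close> is bounded below by \<open>s / (10 d^9)\<close>, the sign flip rules out the latter.
Within distance of order \<open>\<bar>w\<bar> / d\<^sup>2\<close> of \<open>w\<close> the subgradient is \<open>x - w\<close> up to a fraction of \<open>\<bar>x - w\<bar>\<close>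
and the noise, and the iteration contracts.
\<close>

section \<open>The arc-cosine kernel\<close>

text \<open>The surrogate gradient matches the objective with an error of order
  \<open>E * (norm x + norm w)\<close>, which does not vanish at the target, so it can only bring
  the iterates close to it. Contraction needs an error proportional to the distance to the target,
  and that comes from pushing both y - z and w - z through the layers with the pattern frozen at the
  same point z. Moving a pattern by a relative distance \<delta> changes the action of a layer by a
  fraction of order sqrt \<delta>, and these fractions add up over the layers; hence the contraction
  region has relative radius of order 1 / d^2. The kernel of the layer of absolute values is not
  monotone, but the earlier layers make its arguments nonnegative, and there it increases; this
  keeps the profile convex. The exponent 9 is 3/4 * 12: the orbit satisfies sqrt (1 - s) \<le> 12 /
  (i + 11), and a slope falls short of 1 by at most 3/4 of that root. It returns in the gradient
  threshold, whose exponent is 11 = 9 + 2.\<close>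

definition arc_kernel :: "real \<Rightarrow> real" where
  "arc_kernel s = ((pi - arccos s) * s + sqrt (1 - s\<^sup>2)) / pi"

text \<open>The derivative of \<open>arc_kernel\<close> inside (-1, 1). The closed formula also has
  values at the endpoints, so tangent inequalities can be used there.\<close>

definition arc_slope :: "real \<Rightarrow> real" where
  "arc_slope s = 1 - arccos s / pi"

lemma arc_kernel_cos:
  assumes "0 \<le> a" "a \<le> pi"
  shows "arc_kernel (cos a) = ((pi - a) * cos a + sin a) / pi"
proof -
  have "sqrt (1 - (cos a)\<^sup>2) = sin a"
    unfolding sin_squared_eq[symmetric] using assms by (simp add: sin_ge_zero)
  then show ?thesis using assms by (simp add: arc_kernel_def arccos_cos)
qed

lemma obtain_cos:
  assumes "\<bar>s\<bar> \<le> (1::real)"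
  obtains a where "0 \<le> a" "a \<le> pi" "s = cos a" "arccos s = a"
proof (rule that[of "arccos s"])
  show "0 \<le> arccos s" "arccos s \<le> pi" "s = cos (arccos s)"
    using assms by (auto simp: arccos_lbound arccos_ubound cos_arccos_abs)
qed auto

text \<open>Concavity of the sine on [0, pi]: the graph lies below its tangent at a.\<close>

lemma sin_diff_le_cos:
  assumes "0 \<le> a" "a \<le> pi" "0 \<le> b" "b \<le> pi"
  shows "sin b - sin a \<le> (b - a) * cos a"
proof (cases "a = b")
  case False
  then consider "a < b" | "b < a" by linarith
  then show ?thesis
  proof cases
    case 1
    obtain z where z: "a < z" "z < b" "sin b - sin a = (b - a) * cos z"
      using MVT2[OF 1, of sin cos] by (auto intro: derivative_intros)
    have "cos z \<le> cos a" using z assms by (intro cos_monotone_0_pi_le) auto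
    then show ?thesis using z 1 by (simp add: mult_left_mono)
  next
    case 2
    obtain z where z: "b < z" "z < a" "sin a - sin b = (a - b) * cos z"
      using MVT2[OF 2, of sin cos] by (auto intro: derivative_intros)
    have "cos a \<le> cos z" using z assms by (intro cos_monotone_0_pi_le) auto
    then have "(a - b) * cos a \<le> sin a - sin b" using z 2 by (simp add: mult_left_mono)
    then show ?thesis by (simp add: algebra_simps)
  qed
qed simp

text \<open>Convexity of the kernel. In the variables s = cos a, t = cos b the defect is ((b - a)
  cos a - (sin b - sin a)) / pi, so it reduces to concavity of the sine and no derivative at the
  endpoints is needed.\<close>

lemma arc_kernel_tangent:
  assumes "\<bar>s\<bar> \<le> 1" "\<bar>t\<bar> \<le> 1"
  shows "arc_kernel t + arc_slope t * (s - t) \<le> arc_kernel s"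
proof -
  obtain a where a: "0 \<le> a" "a \<le> pi" "s = cos a" "arccos s = a" using obtain_cos assms(1) .
  obtain b where b: "0 \<le> b" "b \<le> pi" "t = cos b" "arccos t = b" using obtain_cos assms(2) .
  have "arc_kernel s - arc_kernel t - arc_slope t * (s - t)
      = ((b - a) * cos a - (sin b - sin a)) / pi"
    using a b by (simp add: arc_kernel_cos arc_slope_def arccos_cos field_simps)
  also have "\<dots> \<ge> 0" using sin_diff_le_cos[OF a(1,2) b(1,2)] by simp
  finally show ?thesis by simp
qed

lemma arc_slope_bounds: "\<bar>s\<bar> \<le> 1 \<Longrightarrow> 0 \<le> arc_slope s \<and> arc_slope s \<le> 1"
  using arccos_lbound[of s] arccos_ubound[of s]
  by (auto simp: arc_slope_def abs_le_iff)

lemma arc_slope_mono: "\<bar>s\<bar> \<le> 1 \<Longrightarrow> \<bar>t\<bar> \<le> 1 \<Longrightarrow> s \<le> t \<Longrightarrow> arc_slope s \<le> arc_slope t"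
  by (simp add: arc_slope_def arccos_le_arccos divide_right_mono)

lemma arc_kernel_values [simp]:
  "arc_kernel 1 = 1" "arc_kernel (-1) = 0" "arc_kernel 0 = 1 / pi" "arc_slope 1 = 1" "arc_slope 0 = 1 / 2"
  by (simp_all add: arc_kernel_def arc_slope_def)

lemma arc_kernel_mono_lipschitz:
  assumes "\<bar>s\<bar> \<le> 1" "\<bar>t\<bar> \<le> 1" "s \<le> t"
  shows "arc_kernel s \<le> arc_kernel t" "arc_kernel t - arc_kernel s \<le> t - s"
proof -
  have "0 \<le> arc_slope s * (t - s)" using arc_slope_bounds assms by simp
  then show "arc_kernel s \<le> arc_kernel t" using arc_kernel_tangent[OF assms(2,1)] by linarith
  have "arc_slope t * (t - s) \<le> 1 * (t - s)"
    using arc_slope_bounds assms by (intro mult_right_mono) auto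
  moreover have "arc_slope t * (s - t) = - (arc_slope t * (t - s))" by (simp add: algebra_simps)
  moreover have "arc_kernel t + arc_slope t * (s - t) \<le> arc_kernel s"
    using arc_kernel_tangent[OF assms(1,2)] .
  ultimately show "arc_kernel t - arc_kernel s \<le> t - s" by (simp only: mult_1_left)
qed

lemma arc_kernel_bounds:
  assumes "\<bar>s\<bar> \<le> 1" shows "0 \<le> arc_kernel s" "s \<le> arc_kernel s" "arc_kernel s \<le> 1"
  using arc_kernel_mono_lipschitz(1)[of "-1" s] arc_kernel_mono_lipschitz(1)[of s 1]
    arc_kernel_tangent[of s 1] assms by auto

text \<open>Follows from arccos (-s) = pi - arccos s and mirrors max t 0 - max (-t) 0 = t. It starts
  the induction behind the sign flip, where s and -s have to be told apart.\<close>

lemma arc_kernel_odd_part: "\<bar>s\<bar> \<le> 1 \<Longrightarrow> arc_kernel s - arc_kernel (- s) = s"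
  by (simp add: arc_kernel_def arccos_minus_abs field_simps)

text \<open>The tangent at s extrapolated to 0. It is twice the coefficient of the swap matrix in
  \<open>Qmat\<close>, just as \<open>arc_slope\<close> is twice the coefficient of the
  identity.\<close>

lemma arc_kernel_residual: "arc_kernel s - s * arc_slope s = sqrt (1 - s\<^sup>2) / pi"
  by (simp add: arc_kernel_def arc_slope_def field_simps)

section \<open>Trigonometric estimates for one layer\<close>

text \<open>Jordan's inequality: since the cosine decreases, the mean slope of the sine on [0, x] is
  at least that on [x, pi / 2].\<close>

lemma sin_ge_two_div_pi:
  assumes "0 \<le> x" "x \<le> pi / 2"
  shows "2 / pi * x \<le> sin x"
proof (cases "x = 0")
  case False
  have x: "0 < x" using False assms by simp
  show ?thesis
  proof (cases "x = pi/2")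
    case False
    then have x2: "x < pi/2" using assms by simp
    obtain z where z: "0 < z" "z < x" "sin x - sin 0 = (x - 0) * cos z"
      using MVT2[OF x, of sin cos] by (auto intro: derivative_intros)
    obtain y where y: "x < y" "y < pi/2" "sin (pi/2) - sin x = (pi/2 - x) * cos y"
      using MVT2[OF x2, of sin cos] by (auto intro: derivative_intros)
    have "cos y \<le> cos z" using y z by (intro cos_monotone_0_pi_le) auto
    then have "(pi/2 - x) * (x * cos y) \<le> (pi/2 - x) * (x * cos z)"
      using x x2 by (intro mult_left_mono) auto
    also have "x * cos z = sin x" using z by simp
    also have "(pi/2 - x) * (x * cos y) = x * ((pi/2 - x) * cos y)" by simp
    also have "(pi/2 - x) * cos y = 1 - sin x" using y by simp
    finally have "x \<le> pi / 2 * sin x" by (simp add: algebra_simps)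
    then have "2 / pi * x \<le> 2 / pi * (pi / 2 * sin x)" by (intro mult_left_mono) auto
    then show ?thesis by simp
  next
    case True
    then show ?thesis by (simp only: sin_pi_half) simp
  qed
qed simp

text \<open>Both sides vanish at 0, and the difference has derivative y (sin y - 2 y / pi),
  nonnegative by Jordan's inequality.\<close>

lemma sin_minus_cos_ge:
  assumes "0 \<le> x" "x \<le> pi / 2"
  shows "2 / (3 * pi) * x ^ 3 \<le> sin x - x * cos x"
proof -
  define f where "f = (\<lambda>x::real. sin x - x * cos x - 2 / (3 * pi) * x ^ 3)"
  have "f 0 \<le> f x"
  proof (rule DERIV_nonneg_imp_nondecreasing[OF assms(1)])
    fix y assume y: "0 \<le> y" "y \<le> x"
    have "(f has_real_derivative y * (sin y - 2 / pi * y)) (at y)"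
      unfolding f_def by (auto intro!: derivative_eq_intros simp: field_simps power2_eq_square)
    moreover have "0 \<le> y * (sin y - 2 / pi * y)"
      using sin_ge_two_div_pi[of y] y assms by (intro mult_nonneg_nonneg) auto
    ultimately show "\<exists>y'. (f has_real_derivative y') (at y) \<and> 0 \<le> y'" by blast
  qed
  then show ?thesis by (simp add: f_def)
qed

lemma one_minus_cos: "1 - cos x = 2 * (sin (x / 2))\<^sup>2" for x :: real
  using cos_double_sin[of "x/2"] by simp

text \<open>In the angle a the kernel exceeds s by (sin a - a cos a) / pi, which is cubic in a and
  hence in w = sqrt (1 - s). So w^2 drops by at least w^3 / 6, and w by at least w^2 / 12.\<close>

lemma arc_kernel_decay:
  assumes "0 \<le> s" "s \<le> 1"
  shows "sqrt (1 - arc_kernel s) \<le> sqrt (1 - s) - (sqrt (1 - s))\<^sup>2 / 12"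
proof -
  have "\<bar>s\<bar> \<le> 1" using assms by simp
  then obtain a where a: "0 \<le> a" "a \<le> pi" "s = cos a" "arccos s = a" by (rule obtain_cos)
  have a2: "a \<le> pi/2" using arccos_le_pi2[of s] a assms by simp
  define w where "w = sqrt (1 - s)"
  have w: "0 \<le> w" "w\<^sup>2 = 1 - s" "w \<le> 1" using assms by (auto simp: w_def)
  have "(sin (a/2))\<^sup>2 \<le> (a/2)\<^sup>2"
    using a a2 sin_ge_zero[of "a/2"] sin_x_le_x[of "a/2"] by (intro power_mono) auto
  then have w2: "w\<^sup>2 \<le> a\<^sup>2 / 2" using w a one_minus_cos[of a] by (simp add: power_divide)
  \<comment> \<open>7/5 is a rational number below sqrt 2.\<close>
  have "(w * (7/5))\<^sup>2 \<le> a\<^sup>2"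
  proof -
    have "(w * (7/5))\<^sup>2 = 49/25 * w\<^sup>2" by (simp add: power_mult_distrib power_divide)
    then show ?thesis using w2 zero_le_power2[of w] by linarith
  qed
  then have wa: "w * (7/5) \<le> a" using a(1) by (rule power2_le_imp_le)
  \<comment> \<open>Machin's formula pi / 4 = 4 arctan (1/5) - arctan (1/239) together with arctan
    (1/5) \<le> 1/5 gives pi \<le> 16/5.\<close>
  obtain z where "arctan (1/5) - arctan 0 = (1/5 - 0) * inverse (1 + z\<^sup>2)"
    using MVT2[of 0 "1/5" arctan "\<lambda>x. inverse (1 + x\<^sup>2)"] DERIV_arctan by auto
  moreover have "inverse (1 + z\<^sup>2) \<le> 1" by (simp add: inverse_le_1_iff)
  ultimately have "arctan (1/5) \<le> 1/5" "0 \<le> arctan (1/239)" by auto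
  then have "pi \<le> 16/5" using machin by linarith
  then have "pi\<^sup>2 \<le> (16/5)\<^sup>2" by (intro power_mono) auto
  then have p2: "pi\<^sup>2 \<le> 10.24" by (simp add: power_divide)
  have "(w * (7/5))^3 \<le> a^3" using wa w by (intro power_mono) auto
  then have w3: "w^3 * 2.744 \<le> a^3" by (simp add: power_mult_distrib power_divide)
  have "arc_kernel s = ((pi - a) * cos a + sin a) / pi" using a by (simp add: arc_kernel_cos)
  also have "\<dots> = s + (sin a - a * cos a) / pi" using a by (simp add: field_simps)
  finally have "1 - arc_kernel s = w\<^sup>2 - (sin a - a * cos a) / pi" using w by simp
  also have "\<dots> \<le> w\<^sup>2 - (2 / (3*pi) * a^3) / pi"
    using divide_right_mono[OF sin_minus_cos_ge[OF a(1) a2], of pi] by simp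
  also have "(2 / (3*pi) * a^3) / pi = a^3 * 2 / (3 * pi\<^sup>2)" by (simp add: power2_eq_square)
  also have "w\<^sup>2 - a^3 * 2 / (3 * pi\<^sup>2) \<le> w\<^sup>2 - w^3/6"
  proof -
    have "w^3 * pi\<^sup>2 \<le> w^3 * 10.24" using p2 w by (intro mult_left_mono) auto
    also have "w^3 * 10.24 \<le> 4 * (w^3 * 2.744)" using w by simp
    also have "\<dots> \<le> 4 * a^3" using w3 by (rule mult_left_mono) simp
    finally have "w^3 * pi\<^sup>2 \<le> 4 * a^3" .
    then show ?thesis by (simp add: field_simps)
  qed
  also have "\<dots> \<le> (w - w\<^sup>2/12)\<^sup>2"
    using w by (simp add: field_simps power2_eq_square power3_eq_cube)
  finally have "sqrt (1 - arc_kernel s) \<le> \<bar>w - w\<^sup>2/12\<bar>" using real_sqrt_le_mono by fastforce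
  moreover have "w - w\<^sup>2/12 \<ge> 0" using w mult_left_mono[of w 1 w] by (simp add: power2_eq_square)
  ultimately show ?thesis by (simp add: w_def)
qed

text \<open>Jordan's inequality at a / 2 gives a / pi \<le> sin (a / 2) = sqrt ((1 - s) / 2), and
  3/4 exceeds 1 / sqrt 2.\<close>

lemma arc_slope_lower:
  assumes "0 \<le> s" "s \<le> 1"
  shows "1 - 3/4 * sqrt (1 - s) \<le> arc_slope s"
proof -
  have "\<bar>s\<bar> \<le> 1" using assms by simp
  then obtain a where a: "0 \<le> a" "a \<le> pi" "s = cos a" "arccos s = a" by (rule obtain_cos)
  have a2: "a \<le> pi/2" using arccos_le_pi2[of s] a assms by simp
  have "a / pi = 2 / pi * (a / 2)" by simp
  also have "\<dots> \<le> sin (a/2)" using a a2 by (intro sin_ge_two_div_pi) auto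
  finally have "(a / pi)\<^sup>2 \<le> (sin (a/2))\<^sup>2" using a by (intro power_mono) auto
  also have "\<dots> = (1 - s) / 2" using one_minus_cos[of a] a by simp
  also have "\<dots> \<le> (3/4 * sqrt (1 - s))\<^sup>2" using assms by (simp add: power_mult_distrib power_divide)
  finally have "a / pi \<le> 3/4 * sqrt (1 - s)" by (rule power2_le_imp_le) (use assms in simp)
  then show ?thesis using a by (simp add: arc_slope_def)
qed

section \<open>Hoelder continuity of order one half\<close>

text \<open>The difference of the cosines is 2 sin ((a + b) / 2) sin e with e = (a - b) / 2. As (a +
  b) / 2 lies in [e, pi - e], its sine is at least sin e, and Jordan's inequality bounds e. The
  order one half reflects the vertical tangents of arccos at 1 and -1.\<close>

lemma arccos_hoelder:
  assumes "\<bar>s\<bar> \<le> 1" "\<bar>t\<bar> \<le> 1"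
  shows "\<bar>arccos s - arccos t\<bar> \<le> pi * sqrt (\<bar>s - t\<bar> / 2)"
proof -
  have *: "a - b \<le> pi * sqrt ((cos b - cos a) / 2)" if ab: "0 \<le> b" "b \<le> a" "a \<le> pi" for a b :: real
  proof -
    define e where "e = (a - b) / 2"
    have e: "0 \<le> e" "e \<le> pi/2" "e \<le> (a+b)/2" "(a+b)/2 \<le> pi - e" using ab by (auto simp: e_def field_simps)
    have "sin e \<le> sin ((a+b)/2)"
    proof (cases "(a+b)/2 \<le> pi/2")
      case True then show ?thesis using e by (intro sin_monotone_2pi_le) auto
    next
      case False
      moreover have "e \<le> pi - (a+b)/2" using e(4) by linarith
      ultimately have "sin e \<le> sin (pi - (a+b)/2)" using e(1) pi_gt_zero by (intro sin_monotone_2pi_le) linarith+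
      then show ?thesis by simp
    qed
    moreover have "0 \<le> sin e" using e by (intro sin_ge_zero) auto
    ultimately have "sin e * sin e \<le> sin ((a+b)/2) * sin e" by (intro mult_right_mono) auto
    moreover have "cos b - cos a = 2 * (sin ((a+b)/2) * sin e)"
      using cos_diff_cos[of b a] by (simp add: e_def add.commute)
    moreover have "(2/pi * e)\<^sup>2 \<le> (sin e)\<^sup>2" using sin_ge_two_div_pi[of e] e by (intro power_mono) auto
    moreover have "2/pi * e = (a - b) / pi" by (simp add: e_def field_simps)
    ultimately have "((a - b) / pi)\<^sup>2 \<le> (cos b - cos a) / 2"
      by (simp only: power2_eq_square)
    then have "(a - b) / pi \<le> sqrt ((cos b - cos a) / 2)" by (rule real_le_rsqrt)
    then show ?thesis by (simp add: field_simps)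
  qed
  obtain a where a: "0 \<le> a" "a \<le> pi" "s = cos a" "arccos s = a" using obtain_cos assms(1) .
  obtain b where b: "0 \<le> b" "b \<le> pi" "t = cos b" "arccos t = b" using obtain_cos assms(2) .
  show ?thesis
  proof (cases "b \<le> a")
    case True
    have "cos a \<le> cos b" using True a b by (intro cos_monotone_0_pi_le) auto
    then show ?thesis using *[OF b(1) True a(2)] True a b by (simp add: abs_minus_commute)
  next
    case False
    then have "cos b \<le> cos a" using a b by (intro cos_monotone_0_pi_le) auto
    then show ?thesis using *[of a b] False a b by simp
  qed
qed

lemma arc_slope_hoelder:
  assumes "\<bar>s\<bar> \<le> 1" "\<bar>t\<bar> \<le> 1"
  shows "\<bar>arc_slope s - arc_slope t\<bar> \<le> sqrt \<bar>s - t\<bar>"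
proof -
  have "\<bar>arc_slope s - arc_slope t\<bar> = \<bar>arccos s - arccos t\<bar> / pi"
    by (simp add: arc_slope_def abs_minus_commute flip: diff_divide_distrib)
  also have "\<dots> \<le> sqrt (\<bar>s - t\<bar> / 2)" using arccos_hoelder[OF assms] by (simp add: field_simps)
  also have "\<dots> \<le> sqrt \<bar>s - t\<bar>" by (intro real_sqrt_le_mono) simp
  finally show ?thesis .
qed

lemma sqrt_diff_le: "0 \<le> x \<Longrightarrow> 0 \<le> y \<Longrightarrow> \<bar>sqrt x - sqrt y\<bar> \<le> sqrt \<bar>x - y\<bar>"
proof -
  have *: "sqrt x - sqrt y \<le> sqrt (x - y)" if "0 \<le> y" "y \<le> x" for x y :: real
    using sqrt_add_le_add_sqrt[of y "x - y"] that by simp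
  assume "0 \<le> x" "0 \<le> y" then show ?thesis using *[of x y] *[of y x]
    by (cases "x \<le> y") (auto simp: abs_minus_commute)
qed

lemma arc_residual_hoelder:
  assumes "\<bar>s\<bar> \<le> 1" "\<bar>t\<bar> \<le> 1"
  shows "\<bar>sqrt (1 - s\<^sup>2) - sqrt (1 - t\<^sup>2)\<bar> \<le> 3/2 * sqrt \<bar>s - t\<bar>"
proof -
  have "\<bar>sqrt (1 - s\<^sup>2) - sqrt (1 - t\<^sup>2)\<bar> \<le> sqrt \<bar>(1 - s\<^sup>2) - (1 - t\<^sup>2)\<bar>"
    using assms by (intro sqrt_diff_le) (auto simp: abs_square_le_1)
  also have "(1 - s\<^sup>2) - (1 - t\<^sup>2) = (t - s) * (s + t)" by (simp add: power2_eq_square algebra_simps)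
  also have "\<bar>(t - s) * (s + t)\<bar> \<le> \<bar>s - t\<bar> * 2"
    using assms by (simp add: abs_mult) (intro mult_mono, auto)
  also have "sqrt (\<bar>s - t\<bar> * 2) = sqrt 2 * sqrt \<bar>s - t\<bar>" by (simp add: real_sqrt_mult)
  also have "\<dots> \<le> 3/2 * sqrt \<bar>s - t\<bar>"
    by (intro mult_right_mono real_le_lsqrt) (auto simp: power_divide)
  finally show ?thesis by simp
qed

text \<open>The last layer takes absolute values instead of positive parts; as
  \<open>\<bar>t\<bar> = 2 max t 0 - t\<close>, its kernel is \<open>2 arc_kernel s - s\<close>.\<close>

definition layer_kernel :: "nat \<Rightarrow> nat \<Rightarrow> real \<Rightarrow> real" where
  "layer_kernel d i s = (if i < d then arc_kernel s else 2 * arc_kernel s - s)"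

definition layer_slope :: "nat \<Rightarrow> nat \<Rightarrow> real \<Rightarrow> real" where
  "layer_slope d i s = (if i < d then arc_slope s else 2 * arc_slope s - 1)"

text \<open>For the last layer the upper bound needs the chord inequality 2
  \<open>arc_kernel\<close> s \<le> 1 + s: the tangent at s, compared with the kernel at 1 and at
  -1, is weighted with 1 + s and 1 - s.\<close>

lemma layer_kernel_range:
  assumes "\<bar>s\<bar> \<le> 1" shows "\<bar>layer_kernel d i s\<bar> \<le> 1"
proof -
  have "0 \<le> (1 + s) * (arc_kernel 1 - (arc_kernel s + arc_slope s * (1 - s)))"
    "0 \<le> (1 - s) * (arc_kernel (-1) - (arc_kernel s + arc_slope s * (-1 - s)))"
    using assms arc_kernel_tangent[of 1 s] arc_kernel_tangent[of "-1" s]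
    by (auto intro!: mult_nonneg_nonneg)
  then have "2 * arc_kernel s \<le> 1 + s" by (simp add: algebra_simps)
  then show ?thesis using arc_kernel_bounds[OF assms] assms by (auto simp: layer_kernel_def abs_le_iff)
qed

lemma layer_kernel_lipschitz:
  assumes "\<bar>s\<bar> \<le> 1" "\<bar>t\<bar> \<le> 1"
  shows "\<bar>layer_kernel d i s - layer_kernel d i t\<bar> \<le> \<bar>s - t\<bar>"
  using arc_kernel_mono_lipschitz[OF assms] arc_kernel_mono_lipschitz[OF assms(2,1)]
  by (cases "s \<le> t") (auto simp: layer_kernel_def)

lemma layer_slope_bound:
  assumes "\<bar>s\<bar> \<le> 1" shows "\<bar>layer_slope d i s\<bar> \<le> 1"
  using arc_slope_bounds[OF assms] by (auto simp: layer_slope_def)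

lemma layer_residual:
  "layer_kernel d i s - s * layer_slope d i s = (if i < d then 1 else 2) * sqrt (1 - s\<^sup>2) / pi"
  using arc_kernel_residual[of s] by (auto simp: layer_kernel_def layer_slope_def algebra_simps)

lemma layer_residual_bounds:
  assumes "\<bar>s\<bar> \<le> 1"
  shows "0 \<le> layer_kernel d i s - s * layer_slope d i s"
        "layer_kernel d i s - s * layer_slope d i s \<le> 1"
proof -
  have "0 \<le> sqrt (1 - s\<^sup>2)" "2 * sqrt (1 - s\<^sup>2) \<le> pi" "sqrt (1 - s\<^sup>2) \<le> pi"
    using pi_ge_two real_sqrt_le_1_iff[of "1 - s\<^sup>2"] zero_le_power2[of s] assms
    by (simp add: abs_square_le_1, linarith+)
  then show "0 \<le> layer_kernel d i s - s * layer_slope d i s"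
        "layer_kernel d i s - s * layer_slope d i s \<le> 1"
    unfolding layer_residual by (auto simp: field_simps)
qed

lemma layer_slope_hoelder:
  assumes "\<bar>s\<bar> \<le> 1" "\<bar>t\<bar> \<le> 1"
  shows "\<bar>layer_slope d i s - layer_slope d i t\<bar> \<le> 2 * sqrt \<bar>s - t\<bar>"
proof -
  have "0 \<le> sqrt \<bar>s - t\<bar>" by simp
  then show ?thesis using arc_slope_hoelder[OF assms] by (auto simp: layer_slope_def)
qed

lemma layer_residual_hoelder:
  assumes "\<bar>s\<bar> \<le> 1" "\<bar>t\<bar> \<le> 1"
  shows "\<bar>(layer_kernel d i s - s * layer_slope d i s) - (layer_kernel d i t - t * layer_slope d i t)\<bar>
    \<le> 2 * sqrt \<bar>s - t\<bar>"
proof -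
  define q where "q = (if i < d then 1 else 2 :: real)"
  have "\<bar>(layer_kernel d i s - s * layer_slope d i s) - (layer_kernel d i t - t * layer_slope d i t)\<bar>
     = q / pi * \<bar>sqrt (1 - s\<^sup>2) - sqrt (1 - t\<^sup>2)\<bar>"
    unfolding layer_residual q_def[symmetric] diff_divide_distrib[symmetric] right_diff_distrib[symmetric]
    by (simp add: abs_mult q_def)
  also have "\<dots> \<le> q / pi * (3/2 * sqrt \<bar>s - t\<bar>)"
    using arc_residual_hoelder[OF assms] by (intro mult_left_mono) (auto simp: q_def)
  also have "\<dots> = q / pi * (3/2) * sqrt \<bar>s - t\<bar>" by simp
  also have "\<dots> \<le> 2 * sqrt \<bar>s - t\<bar>"
    using pi_ge_two by (intro mult_right_mono) (auto simp: q_def field_simps)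
  finally show ?thesis .
qed

lemma layer_kernel_tangent:
  assumes "\<bar>s\<bar> \<le> 1" "\<bar>t\<bar> \<le> 1"
  shows "layer_kernel d i t + layer_slope d i t * (s - t) \<le> layer_kernel d i s"
  using arc_kernel_tangent[OF assms] by (auto simp: layer_kernel_def layer_slope_def algebra_simps)

section \<open>Composition of the layer kernels\<close>

text \<open>Ideal cosine between two outputs after i layers when the inputs have cosine s. The step
  from d to Suc d is the layer of absolute values.\<close>

primrec orbit :: "nat \<Rightarrow> real \<Rightarrow> nat \<Rightarrow> real" where
  "orbit d s 0 = s"
| "orbit d s (Suc i) = layer_kernel d i (orbit d s i)"

text \<open>The derivative of \<open>orbit\<close> in s, by the chain rule.\<close>

primrec orbit_slope :: "nat \<Rightarrow> real \<Rightarrow> nat \<Rightarrow> real" where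
  "orbit_slope d s 0 = 1"
| "orbit_slope d s (Suc i) = layer_slope d i (orbit d s i) * orbit_slope d s i"

lemma orbit_range: "\<bar>s\<bar> \<le> 1 \<Longrightarrow> \<bar>orbit d s i\<bar> \<le> 1"
  by (induction i) (auto intro: layer_kernel_range)

lemma orbit_slope_abs: "\<bar>s\<bar> \<le> 1 \<Longrightarrow> \<bar>orbit_slope d s i\<bar> \<le> 1"
proof (induction i)
  case (Suc i)
  then show ?case
    using mult_le_one[OF layer_slope_bound[OF orbit_range] _ Suc.IH] by (simp add: abs_mult)
qed simp

lemma orbit_nonneg: "\<bar>s\<bar> \<le> 1 \<Longrightarrow> 0 < i \<Longrightarrow> i \<le> d \<Longrightarrow> 0 \<le> orbit d s i"
  by (cases i) (auto simp: layer_kernel_def arc_kernel_bounds orbit_range)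

lemma orbit_mono_index:
  assumes "\<bar>s\<bar> \<le> 1" "i \<le> j" "j \<le> d" shows "orbit d s i \<le> orbit d s j"
  using assms(2,3)
proof (induction j rule: dec_induct)
  case (step j)
  then show ?case using arc_kernel_bounds(2)[OF orbit_range[OF assms(1), of d j]]
    by (simp add: layer_kernel_def)
qed simp

text \<open>The slope 2 \<open>arc_slope\<close> p - 1 of the last layer is nonnegative only for p
  \<ge> 0; as 0 < d, a layer of positive parts precedes it and makes the orbit nonnegative.\<close>

lemma layer_slope_orbit_nonneg:
  assumes "\<bar>s\<bar> \<le> 1" "0 < d" "i \<le> d" shows "0 \<le> layer_slope d i (orbit d s i)"
proof (cases "i < d")
  case True then show ?thesis using arc_slope_bounds[OF orbit_range[OF assms(1)]] by (simp add: layer_slope_def)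
next
  case False
  then have "0 \<le> orbit d s i" "i = d" using assms orbit_nonneg[OF assms(1), of i d] by auto
  then show ?thesis using arc_slope_mono[of 0 "orbit d s i"] orbit_range[OF assms(1), of d i]
    by (simp add: layer_slope_def)
qed

lemma orbit_slope_nonneg:
  assumes "\<bar>s\<bar> \<le> 1" "0 < d" "i \<le> Suc d" shows "0 \<le> orbit_slope d s i"
  using assms(3) by (induction i) (auto intro!: mult_nonneg_nonneg layer_slope_orbit_nonneg[OF assms(1,2)])

text \<open>Convexity of the composition: a tangent bound passes through a convex outer kernel
  because the slope of that kernel at the orbit is nonnegative.\<close>

lemma orbit_tangent:
  assumes "\<bar>s\<bar> \<le> 1" "\<bar>t\<bar> \<le> 1" "0 < d" "i \<le> Suc d"
  shows "orbit d t i + orbit_slope d t i * (s - t) \<le> orbit d s i"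
  using assms(4)
proof (induction i)
  case (Suc i)
  let ?L = "layer_slope d i (orbit d t i)"
  have "?L * (orbit_slope d t i * (s - t)) \<le> ?L * (orbit d s i - orbit d t i)"
    using Suc layer_slope_orbit_nonneg[OF assms(2,3), of i] by (intro mult_left_mono) auto
  then show ?case
    using layer_kernel_tangent[OF orbit_range[OF assms(1), of d i] orbit_range[OF assms(2), of d i], of d i]
    by (simp add: algebra_simps)
qed simp

lemma orbit_one [simp]: "orbit d 1 i = 1" "orbit_slope d 1 i = 1"
  by (induction i) (auto simp: layer_kernel_def layer_slope_def)

text \<open>By the chain rule the residual of a composition is the residual of its last layer plus
  the slope of that layer times the previous residual.\<close>

lemma orbit_residual_nonneg:
  assumes "\<bar>s\<bar> \<le> 1" "0 < d" "i \<le> Suc d"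
  shows "0 \<le> orbit d s i - s * orbit_slope d s i"
  using assms(3)
proof (induction i)
  case (Suc i)
  let ?p = "orbit d s i" and ?L = "layer_slope d i (orbit d s i)"
  have "orbit d s (Suc i) - s * orbit_slope d s (Suc i)
     = (layer_kernel d i ?p - ?p * ?L) + ?L * (?p - s * orbit_slope d s i)"
    by (simp add: algebra_simps)
  moreover have "0 \<le> ?L * (?p - s * orbit_slope d s i)"
    using Suc layer_slope_orbit_nonneg[OF assms(1,2), of i] by (intro mult_nonneg_nonneg) auto
  ultimately show ?case
    using layer_residual_bounds(1)[OF orbit_range[OF assms(1), of d i], of d i] by linarith
qed simp

lemma continuous_on_arc: "continuous_on {-1..1} arc_kernel" "continuous_on {-1..1} arc_slope"
  unfolding arc_kernel_def arc_slope_def by (auto intro!: continuous_intros)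

lemma continuous_on_layer:
  "continuous_on {-1..1} (layer_kernel d i)" "continuous_on {-1..1} (layer_slope d i)"
  unfolding layer_kernel_def layer_slope_def
  by (cases "i < d"; auto intro!: continuous_intros continuous_on_arc)+

lemma continuous_on_orbit:
  "continuous_on {-1..1} (\<lambda>s. orbit d s i)" "continuous_on {-1..1} (\<lambda>s. orbit_slope d s i)"
proof -
  have im: "(\<lambda>s. orbit d s i) ` {-1..1} \<subseteq> {-1..1}" for i
    using orbit_range[of _ d i] by (force simp: abs_le_iff)
  show *: "continuous_on {-1..1} (\<lambda>s. orbit d s i)" for i
  proof (induction i)
    case (Suc i)
    show ?case using continuous_on_compose2[OF continuous_on_layer(1) Suc im] by simp
  qed simp
  show "continuous_on {-1..1} (\<lambda>s. orbit_slope d s i)"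
  proof (induction i)
    case (Suc i)
    show ?case using continuous_on_compose2[OF continuous_on_layer(2) * im] Suc
      by (auto intro!: continuous_intros)
  qed simp
qed

section \<open>Quantitative behaviour of the limiting kernel\<close>

text \<open>Lets an upper bound on w be inserted into the recursion of
  \<open>arc_kernel_decay\<close>.\<close>

lemma damped_mono: "w \<le> a \<Longrightarrow> w + a \<le> 12 \<Longrightarrow> w - w\<^sup>2/12 \<le> a - a\<^sup>2/12" for a w :: real
proof -
  assume "w \<le> a" "w + a \<le> 12"
  then have "0 \<le> (a - w) * (12 - (w + a))" by simp
  then show ?thesis by (simp add: algebra_simps power2_eq_square)
qed

text \<open>One step maps \<open>w = sqrt (1 - s)\<close> to at most \<open>w - w\<^sup>2 / 12\<close>, hence angles decay like the inverse
  depth. This is the source of the polynomial dependence on the depth.\<close>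

lemma orbit_decay:
  assumes "\<bar>s\<bar> \<le> 1" "0 < i" "i \<le> d"
  shows "sqrt (1 - orbit d s i) \<le> 12 / (real i + 11)"
  using assms(2,3)
proof (induction i rule: nat_induct_non_zero)
  case 1
  then show ?case using orbit_nonneg[OF assms(1), of 1 d] by simp
next
  case (Suc n)
  let ?w = "sqrt (1 - orbit d s n)" and ?a = "12 / (real n + 11)"
  have n: "0 \<le> orbit d s n" "orbit d s n \<le> 1"
    using orbit_nonneg[OF assms(1), of n d] orbit_range[OF assms(1), of d n] Suc by auto
  have w: "0 \<le> ?w" "?w \<le> ?a" using Suc n by auto
  have "?a \<le> 1" using Suc by (simp add: field_simps)
  then have "?w - ?w\<^sup>2/12 \<le> ?a - ?a\<^sup>2/12"
    using w \<open>?a \<le> 1\<close> by (intro damped_mono) linarith+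
  \<comment> \<open>12 / (i + 11) solves the recursion because 1 / x - 1 / x^2 \<le> 1 / (x + 1).
    The shift 11 makes it equal to 1 at i = 1, where only nonnegativity of the orbit is
    known.\<close>
  also have "?a - ?a\<^sup>2/12 \<le> 12 / (real (Suc n) + 11)"
  proof -
    define x where "x = real n + 11"
    have "x > 0" by (simp add: x_def)
    then have "12 / x - (12 / x)\<^sup>2/12 \<le> 12 / (x + 1)" by (simp add: field_simps power2_eq_square)
    then show ?thesis by (simp add: x_def add.commute add.left_commute)
  qed
  finally show ?case using arc_kernel_decay[OF n] Suc by (simp add: layer_kernel_def)
qed

text \<open>Bernoulli's inequality 1 + 9 / (n + 3) \<le> (1 + 1 / (n + 3))^9. The number 9 is 3/4 *
  12, the product of the constants of \<open>arc_slope_lower\<close> and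
  \<open>orbit_decay\<close>.\<close>

lemma slope_step:
  "((real n + 3) / (real n + 4)) ^ 9 \<le> (real n + 3) / (real n + 12)"
proof -
  have "1 + real 9 * (1 / (real n + 3)) \<le> (1 + 1 / (real n + 3)) ^ 9"
    by (rule Bernoulli_inequality) (simp add: field_simps)
  then have "(real n + 12) / (real n + 3) \<le> ((real n + 4) / (real n + 3)) ^ 9" by (simp add: field_simps)
  then have "inverse (((real n + 4) / (real n + 3)) ^ 9) \<le> inverse ((real n + 12) / (real n + 3))"
    by (intro le_imp_inverse_le) auto
  then show ?thesis by (simp add: power_divide)
qed

text \<open>The first slope stays as a factor, since it vanishes at s = -1. The later ones are at
  least (n + 3) / (n + 12), and by \<open>slope_step\<close> their product is bounded by a
  telescoping one.\<close>

lemma orbit_slope_decay: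
  assumes "\<bar>s\<bar> \<le> 1" "i < d"
  shows "arc_slope s * (3 / (real i + 3)) ^ 9 \<le> orbit_slope d s (Suc i)"
  using assms(2)
proof (induction i)
  case 0 then show ?case by (simp add: layer_slope_def)
next
  case (Suc n)
  let ?p = "orbit d s (Suc n)"
  have p: "0 \<le> ?p" "?p \<le> 1"
    using orbit_nonneg[OF assms(1), of "Suc n" d] orbit_range[OF assms(1), of d "Suc n"] Suc by auto
  have "1 - 3/4 * (12 / (real (Suc n) + 11)) \<le> 1 - 3/4 * sqrt (1 - ?p)"
    using orbit_decay[OF assms(1), of "Suc n" d] Suc by simp
  also have "\<dots> \<le> layer_slope d (Suc n) ?p"
    using arc_slope_lower[OF p] Suc by (simp add: layer_slope_def)
  finally have 1: "(real n + 3) / (real n + 12) \<le> layer_slope d (Suc n) ?p" by (simp add: field_simps)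
  have "arc_slope s * (3 / (real (Suc n) + 3)) ^ 9
      = ((real n + 3) / (real n + 4)) ^ 9 * (arc_slope s * (3 / (real n + 3)) ^ 9)"
    by (simp add: power_divide add.commute[of 4])
  also have "\<dots> \<le> layer_slope d (Suc n) ?p * orbit_slope d s (Suc n)"
    using 1 slope_step[of n] Suc arc_slope_bounds[OF assms(1)]
      layer_slope_orbit_nonneg[OF assms(1), of d "Suc n"] by (intro mult_mono) auto
  finally show ?case by simp
qed

lemma arcsin_ge_self: "0 \<le> x \<Longrightarrow> x \<le> 1 \<Longrightarrow> x \<le> arcsin x"
  using sin_x_le_x[of "arcsin x"] arcsin_bounded[of x] arcsin_nonneg[of x] by auto

text \<open>Two layers of positive parts lift every cosine to at least \<open>arc_kernel\<close> 0 =
  1 / pi, which uses depth at least 2. The last slope is (2 / pi) arcsin p, hence at least 2 /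
  pi^2.\<close>

lemma orbit_last_slope:
  assumes "\<bar>s\<bar> \<le> 1" "2 \<le> d" shows "1 / 10 \<le> layer_slope d d (orbit d s d)" "1 / pi \<le> orbit d s d"
proof -
  have "arc_kernel 0 \<le> arc_kernel (orbit d s 1)"
    using orbit_nonneg[OF assms(1), of 1 d] orbit_range[OF assms(1), of d 1] assms
    by (intro arc_kernel_mono_lipschitz) auto
  then have "1 / pi \<le> orbit d s 2" using assms by (simp add: layer_kernel_def numeral_2_eq_2)
  then show p: "1 / pi \<le> orbit d s d" using orbit_mono_index[OF assms(1), of 2 d d] assms by simp
  have r: "0 \<le> orbit d s d" "orbit d s d \<le> 1" using p orbit_range[OF assms(1), of d d] pi_gt_zero
    by (auto intro: order_trans[rotated])
  have "1 / pi \<le> arcsin (orbit d s d)" using arcsin_ge_self[OF r] p by simp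
  moreover have "arccos (orbit d s d) = pi/2 - arcsin (orbit d s d)" using r by (simp add: arccos_arcsin_eq)
  ultimately have "2 / pi * (1 / pi) \<le> 2 / pi * (pi / 2 - arccos (orbit d s d))"
    by (intro mult_left_mono) auto
  also have "\<dots> = layer_slope d d (orbit d s d)"
    by (simp add: layer_slope_def arc_slope_def field_simps)
  finally have "2 / pi * (1 / pi) \<le> layer_slope d d (orbit d s d)" .
  moreover have "1 / 10 \<le> 2 / pi * (1 / pi)"
  proof -
    have "pi * pi \<le> 4 * 4" using pi_less_4 by (intro mult_mono) auto
    then show ?thesis by (simp add: field_simps)
  qed
  ultimately show "1 / 10 \<le> layer_slope d d (orbit d s d)" by linarith
qed

lemma arc_slope_minus_half: "arc_slope (-1/2) = 1/3"
proof -
  have "arccos (-1/2) = 2 * pi / 3" using arccos_cos[of "2*pi/3"] cos_120 by simp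
  then show ?thesis by (simp add: arc_slope_def field_simps)
qed

section \<open>The profile of the whole network\<close>

definition net_kernel :: "nat \<Rightarrow> real \<Rightarrow> real" where
  "net_kernel d s = orbit d s (Suc d)"

definition net_slope :: "nat \<Rightarrow> real \<Rightarrow> real" where
  "net_slope d s = orbit_slope d s (Suc d)"

lemma net_kernel_tangent:
  assumes "\<bar>s\<bar> \<le> 1" "\<bar>t\<bar> \<le> 1" "2 \<le> d"
  shows "net_kernel d t + net_slope d t * (s - t) \<le> net_kernel d s"
  using orbit_tangent[of s t d "Suc d"] assms by (simp add: net_kernel_def net_slope_def)

lemma net_kernel_one [simp]: "net_kernel d 1 = 1" "net_slope d 1 = 1"
  unfolding net_kernel_def net_slope_def by (simp_all only: orbit_one)

lemma net_slope_bounds: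
  assumes "\<bar>s\<bar> \<le> 1" "2 \<le> d" shows "0 \<le> net_slope d s" "net_slope d s \<le> 1"
  using orbit_slope_nonneg[of s d "Suc d"] orbit_slope_abs[of s d "Suc d"] assms
  by (auto simp: net_slope_def simp del: orbit_slope.simps)

lemma net_residual_nonneg:
  assumes "\<bar>s\<bar> \<le> 1" "2 \<le> d" shows "0 \<le> net_kernel d s - s * net_slope d s"
  using orbit_residual_nonneg[of s d "Suc d"] assms
  by (simp add: net_kernel_def net_slope_def del: orbit.simps orbit_slope.simps)

lemma net_kernel_bounds:
  assumes "\<bar>s\<bar> \<le> 1" "2 \<le> d"
  shows "1 / 2 \<le> net_kernel d s" "s \<le> net_kernel d s" "net_kernel d s \<le> 1"
proof -
  \<comment> \<open>The last kernel has slope 0 at 0, so by convexity its minimum is its value 2 /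
    pi there.\<close>
  have "layer_kernel d d 0 + layer_slope d d 0 * (orbit d s d - 0) \<le> layer_kernel d d (orbit d s d)"
    using orbit_range[OF assms(1), of d d] by (intro layer_kernel_tangent) auto
  then have "2 / pi \<le> net_kernel d s" by (simp add: net_kernel_def layer_kernel_def layer_slope_def)
  moreover have "1 / 2 \<le> 2 / pi" using pi_less_4 by (simp add: field_simps)
  ultimately show "1 / 2 \<le> net_kernel d s" by linarith
  show "s \<le> net_kernel d s" using net_kernel_tangent[of s 1 d] assms by simp
  show "net_kernel d s \<le> 1" using orbit_range[OF assms(1), of d "Suc d"]
    by (simp add: net_kernel_def del: orbit.simps)
qed

lemma depth_power_lower:
  assumes "1 \<le> d" shows "1 / real d ^ 9 \<le> (3 / (real (d - 1) + 3)) ^ 9"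
proof -
  have "1 / real d \<le> 3 / (real (d - 1) + 3)" using assms by (simp add: field_simps of_nat_diff)
  then have "(1 / real d) ^ 9 \<le> (3 / (real (d - 1) + 3)) ^ 9" by (intro power_mono) auto
  then show ?thesis by (simp add: power_divide)
qed

text \<open>For s \<ge> -1/2 the first slope is at least 1/3, as arccos (-1/2) = 2 pi / 3; at s = -1
  it is 0 and no such bound holds. The last slope contributes the factor 1/10.\<close>

lemma net_slope_lower:
  assumes "-1/2 \<le> s" "s \<le> 1" "2 \<le> d" shows "1 / (30 * real d ^ 9) \<le> net_slope d s"
proof -
  have s: "\<bar>s\<bar> \<le> 1" using assms by auto
  have a: "1/3 \<le> arc_slope s" using arc_slope_mono[of "-1/2" s] arc_slope_minus_half assms s by simp
  have "1/3 * (1 / real d ^ 9) \<le> arc_slope s * (3 / (real (d - 1) + 3)) ^ 9"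
    using a depth_power_lower[of d] assms by (intro mult_mono) auto
  also have "\<dots> \<le> orbit_slope d s d" using orbit_slope_decay[OF s, of "d - 1" d] assms by simp
  finally have "1/10 * (1/3 * (1 / real d ^ 9)) \<le> layer_slope d d (orbit d s d) * orbit_slope d s d"
    using orbit_last_slope(1)[OF s assms(3)] assms by (intro mult_mono) auto
  then show ?thesis by (simp add: net_slope_def)
qed

text \<open>The first layer separates \<open>s\<close> from \<open>-s\<close> exactly (its odd part is the identity), and
  the later layers cannot shrink the gap by more than their slopes along the lower orbit.\<close>

lemma orbit_gap:
  assumes "0 \<le> s" "s \<le> 1" "2 \<le> d" "i < d"
  shows "s * (3 / (real i + 3)) ^ 9 \<le> orbit d s (Suc i) - orbit d (-s) (Suc i)"
    (is "_ \<le> ?gap i")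
proof -
  have s: "\<bar>s\<bar> \<le> 1" "\<bar>-s\<bar> \<le> 1" using assms by auto
  have step: "layer_slope d (Suc i) (orbit d (-s) (Suc i)) * ?gap i
      \<le> layer_kernel d (Suc i) (orbit d s (Suc i)) - layer_kernel d (Suc i) (orbit d (-s) (Suc i))" for i
    using layer_kernel_tangent[OF orbit_range[OF s(1), of d "Suc i"] orbit_range[OF s(2), of d "Suc i"], of d "Suc i"]
    by simp
  show ?thesis using assms(4)
  proof (induction i)
    case 0
    then show ?case using arc_kernel_odd_part[OF s(1)] by (simp add: layer_kernel_def)
  next
    case (Suc n)
    let ?p = "orbit d (-s) (Suc n)"
    have p: "0 \<le> ?p" "?p \<le> 1"
      using orbit_nonneg[OF s(2), of "Suc n" d] orbit_range[OF s(2), of d "Suc n"] Suc by auto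
    have "1 - 3/4 * (12 / (real (Suc n) + 11)) \<le> 1 - 3/4 * sqrt (1 - ?p)"
      using orbit_decay[OF s(2), of "Suc n" d] Suc by simp
    also have "\<dots> \<le> layer_slope d (Suc n) ?p"
      using arc_slope_lower[OF p] Suc by (simp add: layer_slope_def)
    finally have 1: "(real n + 3) / (real n + 12) \<le> layer_slope d (Suc n) ?p" by (simp add: field_simps)
    have "s * (3 / (real (Suc n) + 3)) ^ 9
        = ((real n + 3) / (real n + 4)) ^ 9 * (s * (3 / (real n + 3)) ^ 9)"
      by (simp add: power_divide add.commute[of 4])
    also have "\<dots> \<le> layer_slope d (Suc n) ?p * ?gap n"
      using 1 slope_step[of n] Suc assms layer_slope_orbit_nonneg[OF s(2), of d "Suc n"]
      by (intro mult_mono) auto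
    also have "\<dots> \<le> ?gap (Suc n)" using step[of n] by simp
    finally show ?case .
  qed
qed

lemma net_kernel_gap:
  assumes "0 \<le> s" "s \<le> 1" "2 \<le> d"
  shows "s / (10 * real d ^ 9) \<le> net_kernel d s - net_kernel d (-s)"
proof -
  have s: "\<bar>s\<bar> \<le> 1" "\<bar>-s\<bar> \<le> 1" using assms by auto
  have "s * (1 / real d ^ 9) \<le> s * (3 / (real (d - 1) + 3)) ^ 9"
    using depth_power_lower[of d] assms by (intro mult_left_mono) auto
  also have "\<dots> \<le> orbit d s d - orbit d (-s) d" using orbit_gap[of s d "d - 1"] assms by simp
  finally have "1/10 * (s * (1 / real d ^ 9))
      \<le> layer_slope d d (orbit d (-s) d) * (orbit d s d - orbit d (-s) d)"
    using orbit_last_slope(1)[OF s(2) assms(3)] assms by (intro mult_mono) auto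
  also have "\<dots> \<le> net_kernel d s - net_kernel d (-s)"
    using layer_kernel_tangent[OF orbit_range[OF s(1), of d d] orbit_range[OF s(2), of d d], of d d]
    by (simp add: net_kernel_def)
  finally show ?thesis by simp
qed

text \<open>For s \<ge> -1/2 the tangent at s, evaluated at 1, gives the bound with 30. Below -1/2
  the slope degenerates; monotonicity reduces the claim to -1/2, and 60 in place of 30 makes up for
  the larger 1 - s.\<close>

lemma net_kernel_deficit:
  assumes "\<bar>s\<bar> \<le> 1" "2 \<le> d" shows "(1 - s) / (60 * real d ^ 9) \<le> 1 - net_kernel d s"
proof -
  have *: "(1 - t) / (30 * real d ^ 9) \<le> 1 - net_kernel d t" if "-1/2 \<le> t" "t \<le> 1" for t
  proof -
    have "1 / (30 * real d ^ 9) * (1 - t) \<le> net_slope d t * (1 - t)"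
      using net_slope_lower[OF that assms(2)] that by (intro mult_right_mono) auto
    also have "\<dots> \<le> 1 - net_kernel d t" using net_kernel_tangent[of 1 t d] assms that by (simp add: abs_le_iff)
    finally show ?thesis by simp
  qed
  have d0: "0 < real d ^ 9" using assms by simp
  show ?thesis
  proof (cases "-1/2 \<le> s")
    case True
    have "(1 - s) / (60 * real d ^ 9) \<le> (1 - s) / (30 * real d ^ 9)"
      using d0 assms by (intro divide_left_mono) auto
    moreover have "s \<le> 1" using assms by simp
    ultimately show ?thesis using *[OF True] by linarith
  next
    case False
    have "0 \<le> net_slope d s * (-1/2 - s)" using False net_slope_bounds[OF assms] by simp
    then have "net_kernel d s \<le> net_kernel d (-1/2)" using net_kernel_tangent[of "-1/2" s d] assms by simp
    moreover have "(1 - s) / (60 * real d ^ 9) \<le> (1 - (-1/2)) / (30 * real d ^ 9)"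
      using d0 assms by (simp add: divide_simps)
    ultimately show ?thesis using *[of "-1/2"] by simp
  qed
qed

lemma continuous_on_net:
  "continuous_on {-1..1} (net_kernel d)" "continuous_on {-1..1} (net_slope d)"
  unfolding net_kernel_def net_slope_def by (intro continuous_on_orbit)+

section \<open>Cosines and norms\<close>

text \<open>Division by zero makes it 0 when an argument vanishes, so \<open>cosine_bound\<close>
  and \<open>inner_eq_cosine\<close> hold for all vectors.\<close>

definition cosine :: "'a::real_inner \<Rightarrow> 'a \<Rightarrow> real" where
  "cosine x y = inner x y / (norm x * norm y)"

lemma cosine_bound: "\<bar>cosine x y\<bar> \<le> 1"
proof (cases "norm x * norm y = 0")
  case False
  then have "0 < norm x * norm y" using norm_ge_zero by (metis less_eq_real_def mult_nonneg_nonneg)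
  then show ?thesis using Cauchy_Schwarz_ineq2[of x y] by (simp add: cosine_def)
qed (auto simp: cosine_def)

lemma inner_eq_cosine: "inner x y = norm x * norm y * cosine x y"
  by (cases "x = 0"; cases "y = 0") (auto simp: cosine_def)

lemma abs_diff_le_of_square:
  fixes a b :: real
  assumes "\<bar>a\<^sup>2 - b\<^sup>2\<bar> \<le> e * b\<^sup>2" "0 \<le> a" "0 < b"
  shows "\<bar>a - b\<bar> \<le> e * b"
proof -
  have "\<bar>a - b\<bar> * b \<le> \<bar>a - b\<bar> * (a + b)" using assms by (intro mult_left_mono) auto
  also have "\<dots> = \<bar>a\<^sup>2 - b\<^sup>2\<bar>"
    using assms abs_mult[of "a - b" "a + b"] by (simp add: power2_eq_square square_diff_square_factored mult.commute)
  also have "\<dots> \<le> (e * b) * b" using assms by (simp add: power2_eq_square)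
  finally show ?thesis using assms by simp
qed

section \<open>Almost isometric layers\<close>

text \<open>\<open>L i z\<close> is the linear map given by layer \<open>i\<close> with its activation pattern frozen at \<open>z\<close>, and \<open>G i x\<close>
  is the output of the first \<open>i\<close> layers.\<close>

locale layered_net =
  fixes V :: "'a::real_inner set" and d :: nat and L :: "nat \<Rightarrow> 'a \<Rightarrow> 'a \<Rightarrow> 'a"
    and G :: "nat \<Rightarrow> 'a \<Rightarrow> 'a" and \<epsilon> :: real
  assumes depth: "2 \<le> d"
    and eps_pos: "0 < \<epsilon>"
    and subspace_V: "subspace V"
    and G_0: "x \<in> V \<Longrightarrow> G 0 x = x"
    and G_Suc: "x \<in> V \<Longrightarrow> i \<le> d \<Longrightarrow> G (Suc i) x = L i (G i x) (G i x)"
    and L_diff: "L i x (u - w) = L i x u - L i x w"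
    and G_zero: "i \<le> Suc d \<Longrightarrow> G i 0 = 0"
    and isometry: "\<lbrakk>x \<in> V; x \<noteq> 0; i \<le> d; a \<in> V; b \<in> V; a' \<in> V; b' \<in> V\<rbrakk> \<Longrightarrow>
      \<bar>inner (L i (G i x) (G i a - G i b)) (L i (G i x) (G i a' - G i b'))
        - inner (G i a - G i b) (G i a' - G i b')\<bar>
      \<le> \<epsilon> * norm (G i a - G i b) * norm (G i a' - G i b')"
    and cross: "\<lbrakk>x \<in> V; y \<in> V; G i x \<noteq> 0; G i y \<noteq> 0; i \<le> d; a \<in> V; b \<in> V\<rbrakk> \<Longrightarrow>
      \<bar>inner (L i (G i x) (G i a - G i b)) (G (Suc i) y)
        - (layer_slope d i (cosine (G i x) (G i y)) * inner (G i a - G i b) (G i y)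
          + (layer_kernel d i (cosine (G i x) (G i y))
              - cosine (G i x) (G i y) * layer_slope d i (cosine (G i x) (G i y)))
            * norm (G i y) / norm (G i x) * inner (G i a - G i b) (G i x))\<bar>
      \<le> \<epsilon> * norm (G i a - G i b) * norm (G i y)"
    and stable: "\<lbrakk>x \<in> V; y \<in> V; G i x \<noteq> 0; G i y \<noteq> 0; i \<le> d; a \<in> V; b \<in> V\<rbrakk> \<Longrightarrow>
      (norm (L i (G i x) (G i a - G i b) - L i (G i y) (G i a - G i b)))\<^sup>2
      \<le> (8 * norm (G i x - G i y) / norm (G i x) + 4 * \<epsilon>) * (norm (G i a - G i b))\<^sup>2"
    and mismatch: "\<lbrakk>x \<in> V; y \<in> V; i \<le> d\<rbrakk> \<Longrightarrow>
      norm (L i (G i x) (G i y) - L i (G i y) (G i y))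
      \<le> norm (L i (G i x) (G i x - G i y) - L i (G i y) (G i x - G i y))"
    and eps_small: "100 * (real d + 1) * \<epsilon> \<le> 1"
begin

lemma zero_V: "0 \<in> V" using subspace_V by (rule subspace_0)

lemma eps_le: "i \<le> Suc d \<Longrightarrow> 100 * real i * \<epsilon> \<le> 1" "\<epsilon> \<le> 1 / 300"
proof -
  assume "i \<le> Suc d"
  then have "real i * \<epsilon> \<le> (real d + 1) * \<epsilon>" using eps_pos by (intro mult_right_mono) auto
  then show "100 * real i * \<epsilon> \<le> 1" using eps_small by (simp add: algebra_simps)
next
  have "3 * \<epsilon> \<le> (real d + 1) * \<epsilon>" using eps_pos depth by (intro mult_right_mono) auto
  then show "\<epsilon> \<le> 1 / 300" using eps_small by (simp add: algebra_simps)
qed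

lemma L_zero: "L i x 0 = 0" using L_diff[of i x 0 0] by simp

lemma L_minus: "L i x (- u) = - L i x u" using L_diff[of i x 0 u] by (simp add: L_zero)

text \<open>The vectors to which the layer hypotheses apply at stage i: the condition on the
  measurement matrix speaks only about such differences, not about arbitrary vectors.\<close>

definition tests :: "nat \<Rightarrow> 'a set" where
  "tests i = {G i a - G i b | a b. a \<in> V \<and> b \<in> V}"

lemma tests_diff: "a \<in> V \<Longrightarrow> b \<in> V \<Longrightarrow> G i a - G i b \<in> tests i"
  by (auto simp: tests_def)

lemma tests_G: "a \<in> V \<Longrightarrow> i \<le> Suc d \<Longrightarrow> G i a \<in> tests i"
  using tests_diff[of a 0 i] zero_V by (simp add: G_zero)

lemma tests_minus: "u \<in> tests i \<Longrightarrow> - u \<in> tests i"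
  unfolding tests_def using minus_diff_eq by blast

lemma isometry_tests:
  "\<lbrakk>x \<in> V; x \<noteq> 0; i \<le> d; u \<in> tests i; w \<in> tests i\<rbrakk> \<Longrightarrow>
    \<bar>inner (L i (G i x) u) (L i (G i x) w) - inner u w\<bar> \<le> \<epsilon> * norm u * norm w"
  unfolding tests_def using isometry by blast

lemma norm_L:
  assumes "x \<in> V" "x \<noteq> 0" "i \<le> d" "u \<in> tests i"
  shows "\<bar>norm (L i (G i x) u) - norm u\<bar> \<le> \<epsilon> * norm u"
proof (cases "u = 0")
  case False
  have "\<bar>(norm (L i (G i x) u))\<^sup>2 - (norm u)\<^sup>2\<bar> \<le> \<epsilon> * (norm u)\<^sup>2"
    using isometry_tests[OF assms assms(4)] by (simp add: power2_norm_eq_inner[symmetric] power2_eq_square mult.assoc)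
  then show ?thesis using False abs_diff_le_of_square by simp
qed (simp add: L_zero)

lemma norm_G_step:
  assumes "x \<in> V" "x \<noteq> 0" "i \<le> d"
  shows "\<bar>norm (G (Suc i) x) - norm (G i x)\<bar> \<le> \<epsilon> * norm (G i x)"
  using norm_L[OF assms tests_G[of x i]] assms by (simp add: G_Suc)

lemma norm_G:
  assumes "x \<in> V" "x \<noteq> 0" "i \<le> Suc d"
  shows "\<bar>norm (G i x) - norm x\<bar> \<le> 2 * real i * \<epsilon> * norm x"
  using assms(3)
proof (induction i)
  case 0 then show ?case using assms by (simp add: G_0)
next
  case (Suc i)
  have i: "i \<le> d" "2 * real i * \<epsilon> \<le> 1" using Suc eps_le(1)[of i] eps_pos by auto
  have "norm (G i x) \<le> norm x + 1 * norm x"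
    using Suc i mult_right_mono[OF i(2), of "norm x"] by auto
  then have "\<epsilon> * norm (G i x) \<le> \<epsilon> * (2 * norm x)" using eps_pos by (intro mult_left_mono) auto
  then show ?case using norm_G_step[OF assms(1,2) i(1)] Suc by (simp add: algebra_simps)
qed

lemma norm_G_bounds:
  assumes "x \<in> V" "x \<noteq> 0" "i \<le> Suc d"
  shows "98/100 * norm x \<le> norm (G i x)" "norm (G i x) \<le> 102/100 * norm x" "G i x \<noteq> 0"
proof -
  have "2 * real i * \<epsilon> * norm x \<le> 2/100 * norm x"
    using eps_le(1)[OF assms(3)] by (intro mult_right_mono) auto
  then show *: "98/100 * norm x \<le> norm (G i x)" "norm (G i x) \<le> 102/100 * norm x"
    using norm_G[OF assms] by auto
  show "G i x \<noteq> 0" using *(1) assms by auto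
qed

section \<open>Propagation along a frozen activation pattern\<close>

text \<open>Sequences that follow the layers frozen at z up to a relative error \<mu> per step. The
  outputs at z follow them exactly, differences of outputs near z approximately.\<close>

definition transported :: "'a \<Rightarrow> real \<Rightarrow> (nat \<Rightarrow> 'a) \<Rightarrow> bool" where
  "transported z \<mu> k \<longleftrightarrow> (\<forall>i \<le> d. k i \<in> tests i \<and> norm (k (Suc i) - L i (G i z) (k i)) \<le> \<mu> * norm (k i))"

lemma transported_G: "z \<in> V \<Longrightarrow> 0 \<le> \<mu> \<Longrightarrow> transported z \<mu> (\<lambda>i. G i z)"
  by (auto simp: transported_def tests_G G_Suc)

lemma transported_minus: "transported z \<mu> k \<Longrightarrow> transported z \<mu> (\<lambda>i. - k i)"
proof -
  assume k: "transported z \<mu> k"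
  have "norm (- k (Suc i) - L i (G i z) (- k i)) = norm (k (Suc i) - L i (G i z) (k i))" for i
    by (simp only: L_minus minus_diff_minus norm_minus_cancel)
  then show ?thesis using k tests_minus unfolding transported_def by (metis norm_minus_cancel)
qed

text \<open>The induction step shared by \<open>transported_norm\<close> and
  \<open>diff_transported\<close>. In the latter, transport is proved from smallness of the
  difference and smallness from transport, so both have to advance together layer by layer.\<close>

lemma norm_step_bound:
  assumes "z \<in> V" "z \<noteq> 0" "i \<le> d" "u \<in> tests i" "norm (u' - L i (G i z) u) \<le> \<mu> * norm u"
    "\<epsilon> \<le> \<mu>" "20 * (real d + 1) * \<mu> \<le> 1" "norm u \<le> (1 + 3 * real i * \<mu>) * c" "0 \<le> c"
  shows "norm u' \<le> (1 + 3 * real (Suc i) * \<mu>) * c"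
proof -
  have mu: "0 \<le> \<mu>" using assms eps_pos by linarith
  have "real i * \<mu> \<le> (real d + 1) * \<mu>" using assms mu by (intro mult_right_mono) auto
  then have im: "6 * real i * \<mu> \<le> 1" using assms(7) mu by (simp add: algebra_simps)
  have "norm u' \<le> norm (L i (G i z) u) + norm (u' - L i (G i z) u)"
    using norm_triangle_ineq[of "L i (G i z) u" "u' - L i (G i z) u"] by simp
  also have "\<dots> \<le> (1 + 2 * \<mu>) * norm u"
    using norm_L[OF assms(1-4)] assms(5) mult_right_mono[OF assms(6), of "norm u"]
    by (simp add: algebra_simps abs_le_iff)
  also have "\<dots> \<le> (1 + 2 * \<mu>) * ((1 + 3 * real i * \<mu>) * c)" using assms mu by (intro mult_left_mono) auto
  \<comment> \<open>The quadratic term is absorbed into one further \<mu>, which turns 2 \<mu> into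
    3 \<mu> per layer.\<close>
  also have "\<dots> = (1 + 2 * \<mu> + 3 * real i * \<mu> + (6 * real i * \<mu>) * \<mu>) * c" by (simp add: algebra_simps)
  also have "\<dots> \<le> (1 + 2 * \<mu> + 3 * real i * \<mu> + 1 * \<mu>) * c"
    using im mu assms by (intro mult_right_mono add_left_mono) auto
  finally show ?thesis by (simp add: algebra_simps)
qed

lemma growth_factor:
  assumes "0 \<le> \<mu>" "20 * (real d + 1) * \<mu> \<le> 1" "i \<le> Suc d" "0 \<le> c"
  shows "(1 + 3 * real i * \<mu>) * c \<le> 23/20 * c"
proof -
  have "real i * \<mu> \<le> (real d + 1) * \<mu>" using assms by (intro mult_right_mono) auto
  then have "1 + 3 * real i * \<mu> \<le> 23/20" using assms(2) by (simp add: algebra_simps)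
  then show ?thesis using assms(4) by (rule mult_right_mono)
qed

lemma transported_norm:
  assumes "z \<in> V" "z \<noteq> 0" "transported z \<mu> k" "\<epsilon> \<le> \<mu>" "20 * (real d + 1) * \<mu> \<le> 1" "i \<le> Suc d"
  shows "norm (k i) \<le> 23/20 * norm (k 0)"
proof -
  have "norm (k i) \<le> (1 + 3 * real i * \<mu>) * norm (k 0)" using assms(6)
  proof (induction i)
    case (Suc i)
    then have i: "i \<le> d" by simp
    then show ?case using Suc assms(3)
      by (intro norm_step_bound[OF assms(1,2) i _ _ assms(4,5)]) (auto simp: transported_def)
  qed simp
  also have "\<dots> \<le> 23/20 * norm (k 0)" using assms eps_pos by (intro growth_factor) auto
  finally show ?thesis .
qed

text \<open>The error of a step is the output at y seen through two patterns. Patterns disagree only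
  where a coordinate changes sign, so \<open>mismatch\<close> replaces that output by the difference
  of the outputs, and \<open>stable\<close> applies with relative distance 2 \<delta>.\<close>

lemma diff_transported:
  assumes z: "z \<in> V" "z \<noteq> 0" and y: "y \<in> V" and close: "norm (y - z) \<le> \<delta> * norm z" "\<delta> \<le> 1/2"
    and mu: "\<epsilon> + sqrt (16 * \<delta> + 4 * \<epsilon>) \<le> \<mu>" "20 * (real d + 1) * \<mu> \<le> 1"
  shows "transported z \<mu> (\<lambda>i. G i y - G i z)"
proof -
  have d0: "0 \<le> \<delta>"
  proof -
    have "0 \<le> \<delta> * norm z" using close norm_ge_zero order_trans by blast
    then show ?thesis using z by (simp add: zero_le_mult_iff)
  qed
  have "0 \<le> sqrt (16 * \<delta> + 4 * \<epsilon>)" using d0 eps_pos by simp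
  then have em: "\<epsilon> \<le> \<mu>" and mu0: "0 \<le> \<mu>" and sm: "sqrt (16 * \<delta> + 4 * \<epsilon>) \<le> \<mu>"
    using mu eps_pos by linarith+
  have y0: "y \<noteq> 0"
  proof
    assume "y = 0"
    then have "norm z \<le> \<delta> * norm z" using close by simp
    also have "\<dots> \<le> 1/2 * norm z" using close by (intro mult_right_mono) auto
    finally show False using z by simp
  qed
  define g where "g i = G i y - G i z" for i
  have main: "norm (g (Suc i) - L i (G i z) (g i)) \<le> \<mu> * norm (g i)"
    if i: "i \<le> d" and gi: "norm (g i) \<le> (1 + 3 * real i * \<mu>) * norm (y - z)" for i
  proof -
    have "norm (g i) \<le> 23/20 * norm (y - z)"
      using gi growth_factor[OF mu0 mu(2), of i "norm (y - z)"] i by simp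
    also have "\<dots> \<le> 23/20 * (\<delta> * norm z)" using close by simp
    also have "\<dots> \<le> \<delta> * (2 * norm (G i z))"
    proof -
      have "23/20 * norm z \<le> 2 * norm (G i z)" using norm_G_bounds(1)[OF z, of i] i norm_ge_zero[of z] by linarith
      from mult_left_mono[OF this d0] show ?thesis by simp
    qed
    finally have "norm (g i) / norm (G i z) \<le> 2 * \<delta>"
      using norm_G_bounds(3)[OF z, of i] i by (simp add: field_simps)
    then have c: "8 * norm (G i z - G i y) / norm (G i z) + 4 * \<epsilon> \<le> 16 * \<delta> + 4 * \<epsilon>"
      by (simp add: g_def norm_minus_commute)
    have nz: "G i z \<noteq> 0" "G i y \<noteq> 0" using norm_G_bounds(3) z y y0 i by auto
    have "(norm (L i (G i z) (G i z - G i y) - L i (G i y) (G i z - G i y)))\<^sup>2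
       \<le> (8 * norm (G i z - G i y) / norm (G i z) + 4 * \<epsilon>) * (norm (G i z - G i y))\<^sup>2"
      using stable[OF z(1) y nz i z(1) y] .
    also have "\<dots> \<le> (16 * \<delta> + 4 * \<epsilon>) * (norm (g i))\<^sup>2"
      unfolding g_def norm_minus_commute[of "G i y"] by (rule mult_right_mono[OF c]) simp
    also have "\<dots> = (sqrt (16 * \<delta> + 4 * \<epsilon>) * norm (g i))\<^sup>2"
      using d0 eps_pos by (simp add: power_mult_distrib)
    finally have st: "norm (L i (G i z) (G i z - G i y) - L i (G i y) (G i z - G i y))
       \<le> sqrt (16 * \<delta> + 4 * \<epsilon>) * norm (g i)"
      by (rule power2_le_imp_le) (use d0 eps_pos in simp)
    \<comment> \<open>Linearity cancels the output at z.\<close>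
    have "g (Suc i) - L i (G i z) (g i) = - (L i (G i z) (G i y) - L i (G i y) (G i y))"
      using z y i by (simp add: g_def G_Suc L_diff)
    then have "norm (g (Suc i) - L i (G i z) (g i)) = norm (L i (G i z) (G i y) - L i (G i y) (G i y))"
      by (simp only: norm_minus_cancel)
    also have "\<dots> \<le> sqrt (16 * \<delta> + 4 * \<epsilon>) * norm (g i)" using mismatch[OF z(1) y i] st by linarith
    also have "\<dots> \<le> \<mu> * norm (g i)" using sm by (intro mult_right_mono) auto
    finally show ?thesis .
  qed
  have bd: "i \<le> Suc d \<Longrightarrow> norm (g i) \<le> (1 + 3 * real i * \<mu>) * norm (y - z)" for i
  proof (induction i)
    case 0 then show ?case using z y by (simp add: g_def G_0)
  next
    case (Suc i)
    then have i: "i \<le> d" by simp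
    have gt: "g i \<in> tests i" unfolding g_def using z y by (intro tests_diff)
    show ?case using Suc i by (intro norm_step_bound[OF z i gt main em mu(2)]) auto
  qed
  show ?thesis unfolding transported_def
    using main bd tests_diff[OF y z(1)] by (auto simp: g_def)
qed

text \<open>A layer perturbs the inner product by the isometry defect \<mu> and by three terms with
  transport errors, 3 \<mu> + 3 \<mu>^2 together; with the norm growth (23/20)^2 this stays below 5
  \<mu>.\<close>

lemma transported_inner:
  assumes z: "z \<in> V" "z \<noteq> 0" and tr: "transported z \<mu> g" "transported z \<mu> k"
    and mu: "\<epsilon> \<le> \<mu>" "20 * (real d + 1) * \<mu> \<le> 1" and i: "i \<le> Suc d"
  shows "\<bar>inner (g i) (k i) - inner (g 0) (k 0)\<bar> \<le> 5 * real i * \<mu> * norm (g 0) * norm (k 0)"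
  using i
proof (induction i)
  case (Suc i)
  then have i: "i \<le> d" "i \<le> Suc d" by auto
  have mu0: "0 \<le> \<mu>" using mu eps_pos by linarith
  have "3 * \<mu> \<le> (real d + 1) * \<mu>" using depth mu0 by (intro mult_right_mono) auto
  then have mus: "\<mu> \<le> 1/60" using mu(2) by (simp add: algebra_simps)
  let ?Lg = "L i (G i z) (g i)" and ?Lk = "L i (G i z) (k i)"
  define m where "m = g (Suc i) - ?Lg"
  define n where "n = k (Suc i) - ?Lk"
  have t: "g i \<in> tests i" "k i \<in> tests i" and mn: "norm m \<le> \<mu> * norm (g i)" "norm n \<le> \<mu> * norm (k i)"
    using tr i by (auto simp: transported_def m_def n_def)
  have Lg: "norm ?Lg \<le> (1 + \<mu>) * norm (g i)" and Lk: "norm ?Lk \<le> (1 + \<mu>) * norm (k i)"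
    using norm_L[OF z i(1) t(1)] norm_L[OF z i(1) t(2)] mult_right_mono[OF mu(1), of "norm (g i)"]
      mult_right_mono[OF mu(1), of "norm (k i)"] by (auto simp: algebra_simps abs_le_iff)
  have e: "inner (g (Suc i)) (k (Suc i)) = inner ?Lg ?Lk + inner ?Lg n + inner m ?Lk + inner m n"
    by (simp add: m_def n_def algebra_simps)
  have 1: "\<bar>inner ?Lg ?Lk - inner (g i) (k i)\<bar> \<le> \<mu> * (norm (g i) * norm (k i))"
    using isometry_tests[OF z i(1) t] mult_right_mono[OF mu(1), of "norm (g i) * norm (k i)"]
    by (simp add: mult.assoc)
  have 2: "\<bar>inner ?Lg n\<bar> \<le> (1 + \<mu>) * \<mu> * (norm (g i) * norm (k i))"
    using order_trans[OF Cauchy_Schwarz_ineq2 mult_mono[OF Lg mn(2)]] mu0 by (simp add: mult_ac)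
  have 3: "\<bar>inner m ?Lk\<bar> \<le> (1 + \<mu>) * \<mu> * (norm (g i) * norm (k i))"
    using order_trans[OF Cauchy_Schwarz_ineq2 mult_mono[OF mn(1) Lk]] mu0 by (simp add: mult_ac)
  have 4: "\<bar>inner m n\<bar> \<le> \<mu> * \<mu> * (norm (g i) * norm (k i))"
    using order_trans[OF Cauchy_Schwarz_ineq2 mult_mono[OF mn]] mu0 by (simp add: mult_ac)
  have "\<bar>inner (g (Suc i)) (k (Suc i)) - inner (g i) (k i)\<bar> \<le> (3 * \<mu> + 3 * (\<mu> * \<mu>)) * (norm (g i) * norm (k i))"
    using 1 2 3 4 unfolding e by (simp add: algebra_simps)
  also have "\<dots> \<le> (3 * \<mu> + 3 * (\<mu> * (1/60))) * (norm (g i) * norm (k i))"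
    using mus mu0 by (intro mult_right_mono add_left_mono mult_left_mono) auto
  also have "\<dots> \<le> (3 * \<mu> + 3 * (\<mu> * (1/60))) * ((23/20 * norm (g 0)) * (23/20 * norm (k 0)))"
    using transported_norm[OF z tr(1) mu i(2)] transported_norm[OF z tr(2) mu i(2)] mu0
    by (intro mult_left_mono mult_mono) auto
  also have "\<dots> = (3 * (61/60) * (23/20) * (23/20)) * (\<mu> * (norm (g 0) * norm (k 0)))" by simp
  also have "\<dots> \<le> 5 * (\<mu> * (norm (g 0) * norm (k 0)))" using mu0 by (intro mult_right_mono) auto
  finally show ?case using Suc by (simp add: algebra_simps)
qed simp

end

lemma abs_triangle3: "\<bar>a\<bar> \<le> A \<Longrightarrow> \<bar>b\<bar> \<le> B \<Longrightarrow> \<bar>c\<bar> \<le> C \<Longrightarrow> \<bar>a + b - c\<bar> \<le> A + B + C"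
  for a b c :: real
  by (simp only: abs_le_iff) linarith

lemma abs_triangle5:
  "\<bar>a\<bar> \<le> A \<Longrightarrow> \<bar>b\<bar> \<le> B \<Longrightarrow> \<bar>c\<bar> \<le> C \<Longrightarrow> \<bar>e\<bar> \<le> E \<Longrightarrow> \<bar>f\<bar> \<le> F \<Longrightarrow> \<bar>a + b + c + e + f\<bar> \<le> A + B + C + E + F"
  for a b c :: real
  by (simp only: abs_le_iff) linarith

lemma abs_triangle4:
  "\<bar>a\<bar> \<le> A \<Longrightarrow> \<bar>b\<bar> \<le> B \<Longrightarrow> \<bar>c\<bar> \<le> C \<Longrightarrow> \<bar>e\<bar> \<le> E \<Longrightarrow> \<bar>a - b - c + e\<bar> \<le> A + B + C + E"
  for a b c :: real
  by (simp only: abs_le_iff) linarith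

lemma half_square_norm_diff:
  fixes y z q :: "'a::real_inner"
  shows "(norm (y - q))\<^sup>2 / 2 - (norm (z - q))\<^sup>2 / 2 = inner (z - q) (y - z) + (norm (y - z))\<^sup>2 / 2"
proof -
  have "y - q = (z - q) + (y - z)" by simp
  then have "(norm (y - q))\<^sup>2 = (norm (z - q))\<^sup>2 + 2 * inner (z - q) (y - z) + (norm (y - z))\<^sup>2"
    by (simp only: power2_norm_eq_inner inner_add_left inner_add_right inner_commute[of "y - z" "z - q"])
  then show ?thesis by (simp add: add_divide_distrib)
qed

context layered_net
begin

section \<open>Angles and components across the layers\<close>

lemma cross_tests:
  assumes "x \<in> V" "y \<in> V" "x \<noteq> 0" "y \<noteq> 0" "i \<le> d" "u \<in> tests i"
  defines "c \<equiv> cosine (G i x) (G i y)"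
  shows "\<bar>inner (L i (G i x) u) (G (Suc i) y)
      - norm (G i y) * (layer_slope d i c * (inner (G i y) u / norm (G i y))
          + (layer_kernel d i c - c * layer_slope d i c) * (inner (G i x) u / norm (G i x)))\<bar>
      \<le> \<epsilon> * norm u * norm (G i y)"
proof -
  obtain a b where ab: "a \<in> V" "b \<in> V" "u = G i a - G i b" using assms(6) by (auto simp: tests_def)
  have nz: "G i x \<noteq> 0" "G i y \<noteq> 0" using norm_G_bounds(3) assms by auto
  have "norm (G i y) * (layer_slope d i c * (inner (G i y) u / norm (G i y))
          + (layer_kernel d i c - c * layer_slope d i c) * (inner (G i x) u / norm (G i x)))
      = layer_slope d i c * inner u (G i y) + (layer_kernel d i c - c * layer_slope d i c)
          * norm (G i y) / norm (G i x) * inner u (G i x)"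
    using nz by (simp add: distrib_left inner_commute[of u])
  then show ?thesis using cross[OF assms(1,2) nz assms(5) ab(1,2)] by (simp add: ab(3) c_def)
qed

text \<open>The cross estimate is applied to the output at x itself, where slope and residual
  recombine to the kernel. The constant 4 is 1 for this estimate and 3 for the change of the two
  norms.\<close>

lemma cosine_step:
  assumes x: "x \<in> V" "x \<noteq> 0" and y: "y \<in> V" "y \<noteq> 0" and i: "i \<le> d"
  shows "\<bar>cosine (G (Suc i) x) (G (Suc i) y) - layer_kernel d i (cosine (G i x) (G i y))\<bar> \<le> 4 * \<epsilon>"
proof -
  define X Y X' Y' c c' where defs: "X = norm (G i x)" "Y = norm (G i y)"
    "X' = norm (G (Suc i) x)" "Y' = norm (G (Suc i) y)"
    "c = cosine (G i x) (G i y)" "c' = cosine (G (Suc i) x) (G (Suc i) y)"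
  have pos: "0 < X" "0 < Y" using norm_G_bounds(3)[OF x, of i] norm_G_bounds(3)[OF y, of i] i by (auto simp: defs)
  have c1: "\<bar>c'\<bar> \<le> 1" by (simp add: defs cosine_bound)
  have nx: "\<bar>X' - X\<bar> \<le> \<epsilon> * X" "\<bar>Y' - Y\<bar> \<le> \<epsilon> * Y" using norm_G_step x y i by (auto simp: defs)
  have "inner (G i y) (G i x) / Y = X * c" "inner (G i x) (G i x) / X = X"
    using pos inner_eq_cosine[of "G i x" "G i y"]
    by (simp_all add: defs inner_commute[of "G i y"] flip: power2_norm_eq_inner) (simp add: power2_eq_square)
  then have e: "Y * (layer_slope d i c * (inner (G i y) (G i x) / Y)
          + (layer_kernel d i c - c * layer_slope d i c) * (inner (G i x) (G i x) / X))
      = X * Y * layer_kernel d i c" by (simp add: algebra_simps)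
  have 1: "\<bar>X' * Y' * c' - X * Y * layer_kernel d i c\<bar> \<le> \<epsilon> * (X * Y)"
  proof -
    have "i \<le> Suc d" using i by simp
    note ct = cross_tests[OF x(1) y(1) x(2) y(2) i tests_G[OF x(1) this], folded G_Suc[OF x(1) i]]
    have "inner (G (Suc i) x) (G (Suc i) y) = X' * Y' * c'" by (simp add: defs inner_eq_cosine[of "G (Suc i) x"])
    then show ?thesis using ct[folded defs] unfolding e by (simp add: mult.assoc)
  qed
  have "\<bar>X' * Y' - X * Y\<bar> = \<bar>(X' - X) * Y' + X * (Y' - Y)\<bar>" by (simp add: algebra_simps)
  also have "\<dots> \<le> \<bar>X' - X\<bar> * Y' + X * \<bar>Y' - Y\<bar>"
    using pos abs_triangle_ineq[of "(X' - X) * Y'" "X * (Y' - Y)"] by (simp add: abs_mult defs)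
  also have "\<dots> \<le> (\<epsilon> * X) * (2 * Y) + X * (\<epsilon> * Y)"
  proof -
    have "\<epsilon> * Y \<le> 1 * Y" using eps_le pos by (intro mult_right_mono) auto
    then have "Y' \<le> 2 * Y" "0 \<le> Y'" using nx by (auto simp: defs)
    then show ?thesis using nx pos by (intro add_mono mult_mono) auto
  qed
  finally have 2: "\<bar>X' * Y' - X * Y\<bar> \<le> 3 * \<epsilon> * (X * Y)" by (simp add: algebra_simps)
  have "\<bar>(X' * Y' - X * Y) * c'\<bar> \<le> 3 * \<epsilon> * (X * Y)"
    using mult_mono[OF 2 c1] pos eps_pos by (simp add: abs_mult)
  then have "\<bar>X * Y * c' - X * Y * layer_kernel d i c\<bar> \<le> 4 * \<epsilon> * (X * Y)"
    using 1 by (simp add: algebra_simps)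
  also have "X * Y * c' - X * Y * layer_kernel d i c = X * Y * (c' - layer_kernel d i c)"
    by (simp add: algebra_simps)
  finally have "X * Y * \<bar>c' - layer_kernel d i c\<bar> \<le> X * Y * (4 * \<epsilon>)" using pos by (simp add: abs_mult mult_ac)
  then show ?thesis using pos by (simp add: defs)
qed

text \<open>The kernels are 1-Lipschitz, so the errors of the layers add up without
  amplification.\<close>

lemma cosine_orbit:
  assumes "x \<in> V" "x \<noteq> 0" "y \<in> V" "y \<noteq> 0" "i \<le> Suc d"
  shows "\<bar>cosine (G i x) (G i y) - orbit d (cosine x y) i\<bar> \<le> 4 * real i * \<epsilon>"
  using assms(5)
proof (induction i)
  case 0 then show ?case using assms by (simp add: G_0)
next
  case (Suc i)
  have "\<bar>layer_kernel d i (cosine (G i x) (G i y)) - layer_kernel d i (orbit d (cosine x y) i)\<bar>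
      \<le> \<bar>cosine (G i x) (G i y) - orbit d (cosine x y) i\<bar>"
    by (intro layer_kernel_lipschitz orbit_range cosine_bound)
  then show ?case using cosine_step[OF assms(1-4), of i] Suc by (simp add: algebra_simps)
qed

text \<open>The components along w and along z obey a linear recursion in i, with slope and residual
  of the layer as coefficients; this is how the derivative of the objective is followed through the
  layers.\<close>

definition along :: "'a \<Rightarrow> (nat \<Rightarrow> 'a) \<Rightarrow> nat \<Rightarrow> real" where
  "along w g i = inner (G i w) (g i) / norm (G i w)"

lemma along_bound: "\<bar>along w g i\<bar> \<le> norm (g i)"
proof (cases "G i w = 0")
  case False
  then show ?thesis using Cauchy_Schwarz_ineq2[of "G i w" "g i"] by (simp add: along_def field_simps)
qed (simp add: along_def)

text \<open>The sequence and the outputs at z are transported by the same pattern, so their inner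
  product is nearly preserved, at cost 5 per layer; the change of the norm of the output costs at
  most 3.\<close>

lemma along_self:
  assumes z: "z \<in> V" "z \<noteq> 0" and tr: "transported z \<mu> g"
    and mu: "\<epsilon> \<le> \<mu>" "20 * (real d + 1) * \<mu> \<le> 1" and i: "i \<le> Suc d"
  shows "\<bar>along z g i - along z g 0\<bar> \<le> 8 * real i * \<mu> * norm (g 0)"
proof -
  have mu0: "0 \<le> \<mu>" using mu eps_pos by linarith
  have pos: "0 < norm z" "0 < norm (G i z)" using z norm_G_bounds(3)[OF z i] by auto
  have "\<bar>inner (g i) (G i z) - inner (g 0) (G 0 z)\<bar> \<le> 5 * real i * \<mu> * norm (g 0) * norm (G 0 z)"
    by (rule transported_inner[OF z tr transported_G[OF z(1) mu0] mu i])
  moreover have "inner (g i) (G i z) = along z g i * norm (G i z)" "inner (g 0) (G 0 z) = along z g 0 * norm z"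
    using pos z by (simp_all add: along_def inner_commute G_0)
  ultimately have 1: "\<bar>along z g i * norm (G i z) - along z g 0 * norm z\<bar> \<le> 5 * real i * \<mu> * norm (g 0) * norm z"
    using z by (simp add: G_0)
  have "\<bar>along z g i * (norm (G i z) - norm z)\<bar> \<le> (23/20 * norm (g 0)) * (2 * real i * \<epsilon> * norm z)"
    unfolding abs_mult using along_bound[of z g i] transported_norm[OF z tr mu i] norm_G[OF z i]
    by (intro mult_mono) auto
  also have "\<dots> = 23/10 * real i * norm (g 0) * norm z * \<epsilon>" by simp
  also have "\<dots> \<le> 23/10 * real i * norm (g 0) * norm z * \<mu>" using mu by (intro mult_left_mono) auto
  also have "\<dots> = 23/10 * (real i * \<mu> * norm (g 0) * norm z)" by simp
  also have "\<dots> \<le> 3 * (real i * \<mu> * norm (g 0) * norm z)" using mu0 by (intro mult_right_mono) auto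
  finally have "\<bar>(along z g i - along z g 0) * norm z\<bar> \<le> (8 * real i * \<mu> * norm (g 0)) * norm z"
    using 1 by (simp add: algebra_simps)
  then show ?thesis using pos by (simp add: abs_mult)
qed

lemma along_step:
  assumes z: "z \<in> V" "z \<noteq> 0" and w: "w \<in> V" "w \<noteq> 0" and tr: "transported z \<mu> g"
    and mu: "\<epsilon> \<le> \<mu>" "20 * (real d + 1) * \<mu> \<le> 1" and i: "i \<le> d"
  defines "c \<equiv> cosine (G i z) (G i w)"
  shows "\<bar>along w g (Suc i) - (layer_slope d i c * along w g i
      + (layer_kernel d i c - c * layer_slope d i c) * along z g i)\<bar> \<le> 4 * \<mu> * norm (g 0)"
proof -
  let ?R = "layer_slope d i c * along w g i + (layer_kernel d i c - c * layer_slope d i c) * along z g i"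
  have mu0: "0 \<le> \<mu>" using mu eps_pos by linarith
  define W W' where W: "W = norm (G i w)" "W' = norm (G (Suc i) w)"
  have pos: "0 < W" "0 < W'" using norm_G_bounds(3)[OF w, of i] norm_G_bounds(3)[OF w, of "Suc i"] i by (auto simp: W)
  have WW: "\<bar>W' - W\<bar> \<le> \<epsilon> * W" using norm_G_step[OF w i] by (simp add: W)
  have "\<epsilon> * W \<le> 1/300 * W" using eps_le(2) pos by (intro mult_right_mono) auto
  then have WW': "W' \<le> 301/300 * W" using WW by linarith
  define m where "m = g (Suc i) - L i (G i z) (g i)"
  have gt: "g i \<in> tests i" and m: "norm m \<le> \<mu> * norm (g i)" using tr i by (auto simp: transported_def m_def)
  have g1: "norm (g i) \<le> 23/20 * norm (g 0)" "norm (g (Suc i)) \<le> 23/20 * norm (g 0)"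
    using transported_norm[OF z tr mu] i by auto
  have 1: "\<bar>inner (L i (G i z) (g i)) (G (Suc i) w) - W * ?R\<bar> \<le> \<epsilon> * norm (g i) * W"
    using cross_tests[OF z(1) w(1) z(2) w(2) i gt] by (simp add: W along_def c_def)
  also have "\<dots> \<le> \<mu> * (23/20 * norm (g 0)) * W" using mu mu0 g1 pos by (intro mult_right_mono mult_mono) auto
  finally have 1: "\<bar>inner (L i (G i z) (g i)) (G (Suc i) w) - W * ?R\<bar> \<le> \<mu> * (23/20 * norm (g 0)) * W" .
  have "\<bar>inner m (G (Suc i) w)\<bar> \<le> norm m * W'" using Cauchy_Schwarz_ineq2 by (simp add: W)
  also have "\<dots> \<le> (\<mu> * (23/20 * norm (g 0))) * (301/300 * W)"
  proof (rule mult_mono[OF _ WW'])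
    show "norm m \<le> \<mu> * (23/20 * norm (g 0))" using m mult_left_mono[OF g1(1) mu0] by linarith
  qed (use mu0 pos in auto)
  finally have 2: "\<bar>inner m (G (Suc i) w)\<bar> \<le> \<mu> * (23/20 * norm (g 0)) * (301/300 * W)" .
  have "\<bar>along w g (Suc i) * (W' - W)\<bar> \<le> (23/20 * norm (g 0)) * (\<mu> * W)"
    unfolding abs_mult using along_bound[of w g "Suc i"] g1 order_trans[OF WW mult_right_mono[OF mu(1), of W]] pos
    by (intro mult_mono) auto
  moreover have "along w g (Suc i) * W' = inner (L i (G i z) (g i)) (G (Suc i) w) + inner m (G (Suc i) w)"
    using pos by (simp add: along_def W m_def inner_diff_left inner_commute[of "G (Suc i) w"])
  moreover from this have "(along w g (Suc i) - ?R) * W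
      = (inner (L i (G i z) (g i)) (G (Suc i) w) - W * ?R) + inner m (G (Suc i) w) - along w g (Suc i) * (W' - W)"
    by (simp add: algebra_simps)
  ultimately have "\<bar>(along w g (Suc i) - ?R) * W\<bar>
     \<le> \<mu> * (23/20 * norm (g 0)) * W + \<mu> * (23/20 * norm (g 0)) * (301/300 * W) + (23/20 * norm (g 0)) * (\<mu> * W)"
    using abs_triangle3[OF 1 2] by metis
  also have "\<dots> = (23/20 * (1 + 301/300 + 1)) * (\<mu> * norm (g 0) * W)" by (simp add: algebra_simps)
  also have "\<dots> \<le> 4 * (\<mu> * norm (g 0) * W)" using mu0 pos by (intro mult_right_mono) auto
  finally have "\<bar>along w g (Suc i) - ?R\<bar> * W \<le> (4 * \<mu> * norm (g 0)) * W" using pos by (simp add: abs_mult)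
  then show ?thesis using pos by simp
qed

text \<open>Error per layer in the recursion for \<open>along\<close>. The first term collects
  transport errors; the second is the order one half continuity of slope and residual when the
  orbit, off by at most 4 (d + 1) \<epsilon>, replaces the true cosine.\<close>

definition cross_error :: "real \<Rightarrow> real" where
  "cross_error \<mu> = 12 * (real d + 1) * \<mu> + 5 * sqrt (4 * (real d + 1) * \<epsilon>)"

text \<open>With orbit values in place of the true cosines the recursion is solved by
  \<open>orbit_slope\<close> and the residual of the orbit. Errors are only added, since slopes are
  at most 1 in absolute value.\<close>

lemma along_orbit:
  assumes z: "z \<in> V" "z \<noteq> 0" and w: "w \<in> V" "w \<noteq> 0" and tr: "transported z \<mu> g"
    and mu: "\<epsilon> \<le> \<mu>" "20 * (real d + 1) * \<mu> \<le> 1" and i: "i \<le> Suc d"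
  defines "r \<equiv> cosine z w"
  shows "\<bar>along w g i - (orbit_slope d r i * along w g 0
      + (orbit d r i - r * orbit_slope d r i) * along z g 0)\<bar> \<le> real i * cross_error \<mu> * norm (g 0)"
  using i
proof (induction i)
  case (Suc i)
  have mu0: "0 \<le> \<mu>" using mu eps_pos by linarith
  have i: "i \<le> d" "i \<le> Suc d" using Suc by auto
  have r: "\<bar>r\<bar> \<le> 1" by (simp add: r_def cosine_bound)
  let ?c = "cosine (G i z) (G i w)" and ?p = "orbit d r i"
  let ?k = "\<lambda>s. layer_kernel d i s - s * layer_slope d i s" and ?l = "layer_slope d i"
  let ?S = "orbit_slope d r i * along w g 0 + (orbit d r i - r * orbit_slope d r i) * along z g 0"
  define h where "h = sqrt (4 * (real d + 1) * \<epsilon>)"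
  have h0: "0 \<le> h" using eps_pos by (simp add: h_def)
  define g0 where "g0 = norm (g 0)"
  have cp: "\<bar>?c\<bar> \<le> 1" "\<bar>?p\<bar> \<le> 1" by (auto intro: cosine_bound orbit_range r)
  have "\<bar>?c - ?p\<bar> \<le> 4 * real i * \<epsilon>" unfolding r_def by (rule cosine_orbit[OF z w i(2)])
  also have "\<dots> \<le> 4 * (real d + 1) * \<epsilon>" using i eps_pos by (intro mult_right_mono) auto
  finally have sq: "2 * sqrt \<bar>?c - ?p\<bar> \<le> 2 * h" by (simp add: h_def)
  have gi: "norm (g i) \<le> 23/20 * g0" unfolding g0_def by (rule transported_norm[OF z tr mu i(2)])
  have al: "\<bar>along w g i\<bar> \<le> 23/20 * g0" "\<bar>along z g i\<bar> \<le> 23/20 * g0"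
    using along_bound[of w g i] along_bound[of z g i] gi by linarith+
  have 1: "\<bar>(?l ?c - ?l ?p) * along w g i\<bar> \<le> (2 * h) * (23/20 * g0)"
    unfolding abs_mult using order_trans[OF layer_slope_hoelder[OF cp] sq] al h0
    by (intro mult_mono) auto
  have 2: "\<bar>(?k ?c - ?k ?p) * along z g i\<bar> \<le> (2 * h) * (23/20 * g0)"
    unfolding abs_mult using order_trans[OF layer_residual_hoelder[OF cp] sq] al h0
    by (intro mult_mono) auto
  have 3: "\<bar>?k ?p * (along z g i - along z g 0)\<bar> \<le> 1 * (8 * real i * \<mu> * g0)"
    unfolding abs_mult g0_def using layer_residual_bounds[OF cp(2), of d i] along_self[OF z tr mu i(2)] mu0
    by (intro mult_mono) auto
  have 4: "\<bar>?l ?p * (along w g i - ?S)\<bar> \<le> 1 * (real i * cross_error \<mu> * g0)"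
    unfolding abs_mult g0_def using layer_slope_bound[OF cp(2), of d i] Suc.IH i
    by (intro mult_mono) auto
  have 5: "\<bar>along w g (Suc i) - (?l ?c * along w g i + ?k ?c * along z g i)\<bar> \<le> 4 * \<mu> * g0"
    unfolding g0_def by (rule along_step[OF z w tr mu i(1)])
  have "orbit_slope d r (Suc i) * along w g 0 + (orbit d r (Suc i) - r * orbit_slope d r (Suc i)) * along z g 0
      = ?l ?p * ?S + ?k ?p * along z g 0" by (simp add: algebra_simps)
  then have "along w g (Suc i) - (orbit_slope d r (Suc i) * along w g 0
         + (orbit d r (Suc i) - r * orbit_slope d r (Suc i)) * along z g 0)
      = (along w g (Suc i) - (?l ?c * along w g i + ?k ?c * along z g i))
        + (?l ?c - ?l ?p) * along w g i + (?k ?c - ?k ?p) * along z g i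
        + ?k ?p * (along z g i - along z g 0) + ?l ?p * (along w g i - ?S)"
    by (simp add: algebra_simps)
  then have "\<bar>along w g (Suc i) - (orbit_slope d r (Suc i) * along w g 0
         + (orbit d r (Suc i) - r * orbit_slope d r (Suc i)) * along z g 0)\<bar>
      \<le> 4 * \<mu> * g0 + (2 * h) * (23/20 * g0) + (2 * h) * (23/20 * g0) + 8 * real i * \<mu> * g0
        + real i * cross_error \<mu> * g0"
    using abs_triangle5[OF 5 1 2 3 4] by simp
  also have "\<dots> \<le> real (Suc i) * cross_error \<mu> * g0"
  proof -
    have "(4 * \<mu> + 8 * real i * \<mu>) * g0 \<le> (12 * (real d + 1) * \<mu>) * g0"
    proof (rule mult_right_mono)
      have "real i * \<mu> \<le> real d * \<mu>" using i mu0 by (intro mult_right_mono) auto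
      then show "4 * \<mu> + 8 * real i * \<mu> \<le> 12 * (real d + 1) * \<mu>"
      proof -
        have "0 \<le> real d * \<mu>" using mu0 by simp
        moreover have "12 * (real d + 1) * \<mu> = 12 * (real d * \<mu>) + 12 * \<mu>" by (simp add: algebra_simps)
        moreover have "8 * real i * \<mu> = 8 * (real i * \<mu>)" by simp
        ultimately show ?thesis using mu0 \<open>real i * \<mu> \<le> real d * \<mu>\<close> by linarith
      qed
    qed (simp add: g0_def)
    moreover have "(23/5) * (h * g0) \<le> 5 * (h * g0)"
      using eps_pos by (intro mult_right_mono) (auto simp: h_def g0_def)
    moreover have "cross_error \<mu> = 12 * (real d + 1) * \<mu> + 5 * h" by (simp add: cross_error_def h_def)
    ultimately show ?thesis by (simp add: algebra_simps)
  qed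
  finally show ?case by (simp add: g0_def)
qed simp

section \<open>The objective function and its surrogate gradient\<close>

definition obj :: "'a \<Rightarrow> 'a \<Rightarrow> 'a \<Rightarrow> real" where
  "obj \<eta> w x = (norm (G (Suc d) x - G (Suc d) w - \<eta>))\<^sup>2 / 2"

text \<open>The gradient of the surrogate in terms of two unit vectors: the profile's slope is the
  coefficient along w, and its residual is what remains along z.\<close>

definition field :: "'a \<Rightarrow> 'a \<Rightarrow> 'a" where
  "field w z = z - norm w *\<^sub>R (net_slope d (cosine z w) *\<^sub>R (w /\<^sub>R norm w)
     + (net_kernel d (cosine z w) - cosine z w * net_slope d (cosine z w)) *\<^sub>R (z /\<^sub>R norm z))"

lemma obj_diff:
  "obj \<eta> w y - obj \<eta> w z = inner (G (Suc d) z) (G (Suc d) y - G (Suc d) z)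
     - inner (G (Suc d) w) (G (Suc d) y - G (Suc d) z) - inner \<eta> (G (Suc d) y - G (Suc d) z)
     + (norm (G (Suc d) y - G (Suc d) z))\<^sup>2 / 2"
  using half_square_norm_diff[of "G (Suc d) y" "G (Suc d) w + \<eta>" "G (Suc d) z"]
  by (simp add: obj_def inner_diff_left inner_add_left diff_diff_eq)

text \<open>Expanding the square leaves inner products with the difference of the outputs. The one
  with the output at z is preserved by transport; the one with the output at w is given by
  \<open>along_orbit\<close> at the last stage, whose coefficients are those of
  \<open>field\<close>.\<close>

lemma objective_linearization:
  assumes z: "z \<in> V" "z \<noteq> 0" and w: "w \<in> V" "w \<noteq> 0" and y: "y \<in> V"
    and close: "norm (y - z) \<le> \<delta> * norm z" "\<delta> \<le> 1/2"
    and mu: "\<epsilon> + sqrt (16 * \<delta> + 4 * \<epsilon>) \<le> \<mu>" "20 * (real d + 1) * \<mu> \<le> 1"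
  shows "\<bar>obj \<eta> w y - obj \<eta> w z - inner (field w z) (y - z)\<bar>
    \<le> (((real d + 1) * (cross_error \<mu> + 5 * \<mu>) + \<delta>) * (norm z + norm w) + 6/5 * norm \<eta>) * norm (y - z)"
proof -
  define n where "n = Suc d"
  define g where "g i = G i y - G i z" for i
  define r where "r = cosine z w"
  define gn where "gn = norm (y - z)"
  define A where "A = net_slope d r * along w g 0 + (net_kernel d r - r * net_slope d r) * along z g 0"
  have d0: "0 \<le> \<delta>"
  proof -
    have "0 \<le> \<delta> * norm z" using close norm_ge_zero order_trans by blast
    then show ?thesis using z by (simp add: zero_le_mult_iff)
  qed
  have "0 \<le> sqrt (16 * \<delta> + 4 * \<epsilon>)" using d0 eps_pos by simp
  then have em: "\<epsilon> \<le> \<mu>" and mu0: "0 \<le> \<mu>" using mu eps_pos by linarith+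
  have tr: "transported z \<mu> g" unfolding g_def by (rule diff_transported[OF z y close mu])
  have g0: "g 0 = y - z" using y z by (simp add: g_def G_0)
  have gn1: "norm (g n) \<le> 23/20 * gn" using transported_norm[OF z tr em mu(2), of n] by (simp add: n_def gn_def g0)
  have 1: "\<bar>inner (G n z) (g n) - inner z (y - z)\<bar> \<le> 5 * (real d + 1) * \<mu> * (gn * norm z)"
    using transported_inner[OF z tr transported_G[OF z(1) mu0] em mu(2), of n] z
    by (simp add: n_def g0 G_0 gn_def inner_commute mult.assoc add.commute)
  have s: "\<bar>along w g n - A\<bar> \<le> (real d + 1) * cross_error \<mu> * gn"
    using along_orbit[OF z w tr em mu(2), of n]
    by (simp add: A_def n_def r_def net_kernel_def net_slope_def g0 gn_def add.commute del: orbit.simps orbit_slope.simps)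
  have nw: "\<bar>norm (G n w) - norm w\<bar> \<le> 2 * (real d + 1) * \<mu> * norm w"
  proof -
    have "2 * (real d + 1) * \<epsilon> * norm w \<le> 2 * (real d + 1) * \<mu> * norm w"
      using em by (intro mult_right_mono mult_left_mono) auto
    moreover have "\<bar>norm (G n w) - norm w\<bar> \<le> 2 * (real d + 1) * \<epsilon> * norm w"
      using norm_G[OF w, of n] by (simp add: n_def add.commute)
    ultimately show ?thesis by linarith
  qed
  have "inner (G n w) (g n) = norm (G n w) * along w g n"
    using norm_G_bounds(3)[OF w, of n] by (simp add: along_def n_def)
  then have "inner (G n w) (g n) - norm w * A
     = (norm (G n w) - norm w) * along w g n + norm w * (along w g n - A)"
    by (simp add: algebra_simps)
  also have "\<bar>\<dots>\<bar> \<le> (2 * (real d + 1) * \<mu> * norm w) * (23/20 * gn) + norm w * ((real d + 1) * cross_error \<mu> * gn)"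
  proof (rule order_trans[OF abs_triangle_ineq add_mono])
    show "\<bar>(norm (G n w) - norm w) * along w g n\<bar> \<le> (2 * (real d + 1) * \<mu> * norm w) * (23/20 * gn)"
      unfolding abs_mult by (rule mult_mono[OF nw order_trans[OF along_bound[of w g n] gn1]]) (use mu0 in auto)
    show "\<bar>norm w * (along w g n - A)\<bar> \<le> norm w * ((real d + 1) * cross_error \<mu> * gn)"
      using mult_left_mono[OF s norm_ge_zero[of w]] by (simp add: abs_mult)
  qed
  finally have 2: "\<bar>inner (G n w) (g n) - norm w * A\<bar>
     \<le> (real d + 1) * (cross_error \<mu> + 23/10 * \<mu>) * (gn * norm w)"
    by (simp add: algebra_simps add_divide_distrib)
  have "\<bar>inner \<eta> (g n)\<bar> \<le> norm \<eta> * (23/20 * gn)"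
    using order_trans[OF Cauchy_Schwarz_ineq2 mult_left_mono[OF gn1]] by simp
  then have 3: "\<bar>inner \<eta> (g n)\<bar> \<le> 6/5 * norm \<eta> * gn"
    using mult_nonneg_nonneg[of "norm \<eta>" gn] by (simp add: gn_def)
  have "(norm (g n))\<^sup>2 \<le> (23/20 * gn)\<^sup>2" using gn1 by (intro power_mono) auto
  also have "\<dots> = 529/400 * (gn * gn)" by (simp add: power2_eq_square)
  also have "\<dots> \<le> 529/400 * ((\<delta> * norm z) * gn)"
    using close by (intro mult_left_mono mult_right_mono) (auto simp: gn_def)
  also have "\<dots> \<le> 2 * ((\<delta> * norm z) * gn)" using d0 by (intro mult_right_mono) (auto simp: gn_def)
  finally have 4: "(norm (g n))\<^sup>2 / 2 \<le> \<delta> * (gn * norm z)" by (simp add: mult_ac)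
  have e: "inner (field w z) (y - z) = inner z (y - z) - norm w * A"
    using z w by (simp add: field_def A_def along_def g0 G_0 r_def inner_diff_left inner_add_left divide_inverse algebra_simps)
  have "obj \<eta> w y - obj \<eta> w z - inner (field w z) (y - z)
     = (inner (G n z) (g n) - inner z (y - z)) - (inner (G n w) (g n) - norm w * A) - inner \<eta> (g n) + (norm (g n))\<^sup>2 / 2"
    unfolding obj_diff e by (simp add: n_def g_def)
  then have "\<bar>obj \<eta> w y - obj \<eta> w z - inner (field w z) (y - z)\<bar> \<le>
     5 * (real d + 1) * \<mu> * (gn * norm z) + (real d + 1) * (cross_error \<mu> + 23/10 * \<mu>) * (gn * norm w)
     + 6/5 * norm \<eta> * gn + \<delta> * (gn * norm z)"
    using abs_triangle4[OF 1 2 3, of "(norm (g n))\<^sup>2 / 2" "\<delta> * (gn * norm z)"] 4 by simp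
  also have "\<dots> \<le> ((real d + 1) * (cross_error \<mu> + 5 * \<mu>)) * (gn * norm z)
     + ((real d + 1) * (cross_error \<mu> + 5 * \<mu>)) * (gn * norm w) + 6/5 * norm \<eta> * gn
     + (\<delta> * (gn * norm z) + \<delta> * (gn * norm w))"
  proof -
    have ce: "0 \<le> cross_error \<mu>" using mu0 eps_pos by (simp add: cross_error_def)
    have "5 * (real d + 1) * \<mu> * (gn * norm z) \<le> ((real d + 1) * (cross_error \<mu> + 5 * \<mu>)) * (gn * norm z)"
      using ce mu0 by (intro mult_right_mono) (auto simp: gn_def algebra_simps)
    moreover have "(real d + 1) * (cross_error \<mu> + 23/10 * \<mu>) * (gn * norm w)
      \<le> ((real d + 1) * (cross_error \<mu> + 5 * \<mu>)) * (gn * norm w)"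
      using ce mu0 by (intro mult_right_mono mult_left_mono) (auto simp: gn_def)
    moreover have "0 \<le> \<delta> * (gn * norm w)" using d0 by (simp add: gn_def)
    ultimately show ?thesis by linarith
  qed
  also have "\<dots> = (((real d + 1) * (cross_error \<mu> + 5 * \<mu>) + \<delta>) * (norm z + norm w) + 6/5 * norm \<eta>) * gn"
    by (simp add: algebra_simps)
  finally show ?thesis by (simp add: gn_def)
qed

text \<open>Here w is itself close to z, so the outputs at z and w enter only through their
  difference, which is transported like y - z. The error therefore carries the factor |z -
  w|.\<close>

lemma objective_local_linearization:
  assumes z: "z \<in> V" "z \<noteq> 0" and w: "w \<in> V" and y: "y \<in> V"
    and close: "norm (y - z) \<le> \<delta> * norm z" "norm (w - z) \<le> \<delta> * norm z" "\<delta> \<le> 1/2"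
    and mu: "\<epsilon> + sqrt (16 * \<delta> + 4 * \<epsilon>) \<le> \<mu>" "20 * (real d + 1) * \<mu> \<le> 1"
  shows "\<bar>obj \<eta> w y - obj \<eta> w z - inner (z - w) (y - z)\<bar>
    \<le> (5 * (real d + 1) * \<mu> * norm (z - w) + 6/5 * norm \<eta> + norm (y - z)) * norm (y - z)"
proof -
  define n where "n = Suc d"
  define g where "g i = G i y - G i z" for i
  define k where "k i = - (G i w - G i z)" for i
  have "0 \<le> \<delta> * norm z" using close norm_ge_zero order_trans by blast
  then have d0: "0 \<le> \<delta>" using z by (simp add: zero_le_mult_iff)
  have "0 \<le> sqrt (16 * \<delta> + 4 * \<epsilon>)" using d0 eps_pos by simp
  then have em: "\<epsilon> \<le> \<mu>" using mu eps_pos by linarith+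
  have tr: "transported z \<mu> g" unfolding g_def by (rule diff_transported[OF z y close(1,3) mu])
  have tk: "transported z \<mu> k" unfolding k_def
    by (rule transported_minus[OF diff_transported[OF z w close(2,3) mu]])
  have g0: "g 0 = y - z" "k 0 = z - w" using y z w by (simp_all add: g_def k_def G_0)
  have gn1: "norm (g n) \<le> 23/20 * norm (y - z)" using transported_norm[OF z tr em mu(2), of n] by (simp add: n_def g0)
  have 1: "\<bar>inner (k n) (g n) - inner (z - w) (y - z)\<bar> \<le> 5 * (real d + 1) * \<mu> * norm (z - w) * norm (y - z)"
    using transported_inner[OF z tk tr em mu(2), of n] by (simp add: n_def g0 add.commute)
  have "\<bar>inner \<eta> (g n)\<bar> \<le> norm \<eta> * (23/20 * norm (y - z))"
    using order_trans[OF Cauchy_Schwarz_ineq2 mult_left_mono[OF gn1]] by simp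
  then have 3: "\<bar>inner \<eta> (g n)\<bar> \<le> 6/5 * norm \<eta> * norm (y - z)"
    using mult_nonneg_nonneg[of "norm \<eta>" "norm (y - z)"] by simp
  have "(norm (g n))\<^sup>2 \<le> (23/20 * norm (y - z))\<^sup>2" using gn1 by (intro power_mono) auto
  also have "\<dots> \<le> 2 * (norm (y - z) * norm (y - z))" by (simp add: power2_eq_square)
  finally have 4: "(norm (g n))\<^sup>2 / 2 \<le> norm (y - z) * norm (y - z)" by simp
  have "obj \<eta> w y - obj \<eta> w z - inner (z - w) (y - z)
     = (inner (k n) (g n) - inner (z - w) (y - z)) - inner \<eta> (g n) + (norm (g n))\<^sup>2 / 2"
    unfolding obj_diff by (simp add: n_def g_def k_def inner_diff_left)
  then have "\<bar>obj \<eta> w y - obj \<eta> w z - inner (z - w) (y - z)\<bar> \<le>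
     5 * (real d + 1) * \<mu> * norm (z - w) * norm (y - z) + 6/5 * norm \<eta> * norm (y - z) + norm (y - z) * norm (y - z)"
    using 1 3 4 zero_le_power2[of "norm (g n)"] by linarith
  then show ?thesis by (simp add: algebra_simps)
qed

text \<open>The lower bound is preservation of inner products for the difference paired with
  itself.\<close>

lemma G_local_bounds:
  assumes z: "z \<in> V" "z \<noteq> 0" and y: "y \<in> V" and close: "norm (y - z) \<le> \<delta> * norm z" "\<delta> \<le> 1/2"
    and mu: "\<epsilon> + sqrt (16 * \<delta> + 4 * \<epsilon>) \<le> \<mu>" "20 * (real d + 1) * \<mu> \<le> 1"
  shows "i \<le> Suc d \<Longrightarrow> norm (G i y - G i z) \<le> 6/5 * norm (y - z)"
    "4/5 * norm (y - z) \<le> norm (G (Suc d) y - G (Suc d) z)"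
proof -
  have "0 \<le> \<delta> * norm z" using close norm_ge_zero order_trans by blast
  then have d0: "0 \<le> \<delta>" using z by (simp add: zero_le_mult_iff)
  have "0 \<le> sqrt (16 * \<delta> + 4 * \<epsilon>)" using d0 eps_pos by simp
  then have em: "\<epsilon> \<le> \<mu>" using mu eps_pos by linarith+
  define g where "g i = G i y - G i z" for i
  have tr: "transported z \<mu> g" unfolding g_def by (rule diff_transported[OF z y close mu])
  have g0: "g 0 = y - z" using y z by (simp add: g_def G_0)
  show "norm (G i y - G i z) \<le> 6/5 * norm (y - z)" if "i \<le> Suc d"
    using transported_norm[OF z tr em mu(2) that, unfolded g0] norm_ge_zero[of "y - z"]
    unfolding g_def by linarith
  have "5 * (real d + 1) * \<mu> * (norm (y - z))\<^sup>2 \<le> 1/4 * (norm (y - z))\<^sup>2"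
    using mu(2) by (intro mult_right_mono) (auto simp: algebra_simps)
  then have "3/4 * (norm (y - z))\<^sup>2 \<le> (norm (g (Suc d)))\<^sup>2"
    using transported_inner[OF z tr tr em mu(2), of "Suc d"]
    by (simp add: g0 power2_norm_eq_inner[symmetric] add.commute power2_eq_square mult.assoc)
  moreover have "(4/5 * norm (y - z))\<^sup>2 \<le> 3/4 * (norm (y - z))\<^sup>2" by (simp add: power2_eq_square)
  ultimately show "4/5 * norm (y - z) \<le> norm (G (Suc d) y - G (Suc d) z)"
    unfolding g_def using power2_le_imp_le[OF order_trans] norm_ge_zero by blast
qed

text \<open>A comparison of values instead of slopes, valid at every distance: it decides between x
  and -x and bounds the objective from below. Subtracting the value at 0 removes the terms that
  involve only the target and the noise.\<close>

lemma objective_uniform: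
  assumes x: "x \<in> V" "x \<noteq> 0" and w: "w \<in> V" "w \<noteq> 0"
  shows "\<bar>obj \<eta> w x - obj \<eta> w 0 - ((norm x)\<^sup>2 / 2 - norm x * norm w * net_kernel d (cosine x w))\<bar>
    \<le> (9 * (real d + 1) * \<epsilon> * (norm x + norm w) + 6/5 * norm \<eta>) * norm x"
proof -
  define n where "n = Suc d"
  define X W where XW: "X = norm (G n x)" "W = norm (G n w)"
  define c where "c = cosine (G n x) (G n w)"
  define e where "e = (real d + 1) * \<epsilon>"
  have e: "0 \<le> e" "e \<le> 1/100" using eps_pos eps_small by (auto simp: e_def algebra_simps)
  have X: "\<bar>X - norm x\<bar> \<le> 2 * e * norm x" and W: "\<bar>W - norm w\<bar> \<le> 2 * e * norm w"
  proof -
    have "2 * real n * \<epsilon> = 2 * e" by (simp add: n_def e_def add.commute)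
    then show "\<bar>X - norm x\<bar> \<le> 2 * e * norm x" "\<bar>W - norm w\<bar> \<le> 2 * e * norm w"
      using norm_G[OF x, of n] norm_G[OF w, of n] by (simp_all add: XW n_def)
  qed
  have X2: "X \<le> 102/100 * norm x" "0 \<le> X" and W2: "W \<le> 102/100 * norm w" "0 \<le> W"
    using norm_G_bounds(2)[OF x, of n] norm_G_bounds(2)[OF w, of n] by (auto simp: XW n_def)
  have c: "\<bar>c - net_kernel d (cosine x w)\<bar> \<le> 4 * e" "\<bar>c\<bar> \<le> 1"
  proof -
    have "4 * real n * \<epsilon> = 4 * e" by (simp add: n_def e_def add.commute)
    then show "\<bar>c - net_kernel d (cosine x w)\<bar> \<le> 4 * e"
      using cosine_orbit[OF x w, of n] by (simp add: c_def n_def net_kernel_def del: orbit.simps)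
  qed (simp add: c_def cosine_bound)
  have "\<bar>X\<^sup>2 - (norm x)\<^sup>2\<bar> = \<bar>X - norm x\<bar> * (X + norm x)"
    using X2(2) abs_mult[of "X - norm x" "X + norm x"] by (simp add: power2_eq_square square_diff_square_factored mult.commute)
  also have "\<dots> \<le> (2 * e * norm x) * (3 * norm x)" using X X2 e by (intro mult_mono) auto
  finally have 1: "\<bar>X\<^sup>2/2 - (norm x)\<^sup>2/2\<bar> \<le> 3 * e * norm x * norm x" by (simp add: power2_eq_square)
  have "\<bar>X * W - norm x * norm w\<bar> = \<bar>(X - norm x) * W + norm x * (W - norm w)\<bar>" by (simp add: algebra_simps)
  also have "\<dots> \<le> (2 * e * norm x) * (102/100 * norm w) + norm x * (2 * e * norm w)"
  proof (rule order_trans[OF abs_triangle_ineq add_mono])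
    show "\<bar>(X - norm x) * W\<bar> \<le> (2 * e * norm x) * (102/100 * norm w)"
      unfolding abs_mult using W2 e by (intro mult_mono[OF X]) auto
    show "\<bar>norm x * (W - norm w)\<bar> \<le> norm x * (2 * e * norm w)"
      using mult_left_mono[OF W norm_ge_zero[of x]] by (simp add: abs_mult)
  qed
  finally have 2: "\<bar>X * W - norm x * norm w\<bar> \<le> 404/100 * (e * norm x * norm w)" by (simp add: algebra_simps)
  have "X * W * c - norm x * norm w * net_kernel d (cosine x w)
      = (X * W - norm x * norm w) * c + norm x * norm w * (c - net_kernel d (cosine x w))"
    by (simp add: algebra_simps)
  also have "\<bar>\<dots>\<bar> \<le> (404/100 * (e * norm x * norm w)) * 1 + norm x * norm w * (4 * e)"
  proof (rule order_trans[OF abs_triangle_ineq add_mono])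
    show "\<bar>(X * W - norm x * norm w) * c\<bar> \<le> (404/100 * (e * norm x * norm w)) * 1"
      unfolding abs_mult using e by (intro mult_mono[OF 2 c(2)]) auto
    show "\<bar>norm x * norm w * (c - net_kernel d (cosine x w))\<bar> \<le> norm x * norm w * (4 * e)"
      using mult_left_mono[OF c(1), of "norm x * norm w"] by (simp add: abs_mult)
  qed
  finally have 3: "\<bar>X * W * c - norm x * norm w * net_kernel d (cosine x w)\<bar> \<le> 9 * (e * norm x * norm w)"
    using mult_nonneg_nonneg[OF mult_nonneg_nonneg[OF e(1) norm_ge_zero[of x]] norm_ge_zero[of w]]
    by (simp add: mult_ac)
  have "\<bar>inner \<eta> (G n x)\<bar> \<le> norm \<eta> * (102/100 * norm x)"
    using order_trans[OF Cauchy_Schwarz_ineq2 mult_left_mono[OF X2(1)[unfolded XW]]] by simp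
  then have 4: "\<bar>inner \<eta> (G n x)\<bar> \<le> 6/5 * norm \<eta> * norm x"
    using mult_nonneg_nonneg[of "norm \<eta>" "norm x"] by simp
  have "obj \<eta> w x - obj \<eta> w 0 = X\<^sup>2/2 - X * W * c - inner \<eta> (G n x)"
    unfolding obj_diff using inner_eq_cosine[of "G n x" "G n w"]
    by (simp add: G_zero XW c_def n_def inner_commute)
  then have "\<bar>obj \<eta> w x - obj \<eta> w 0 - ((norm x)\<^sup>2 / 2 - norm x * norm w * net_kernel d (cosine x w))\<bar>
    \<le> 3 * e * norm x * norm x + 9 * (e * norm x * norm w) + 6/5 * norm \<eta> * norm x"
    using 1 3 4 by linarith
  also have "\<dots> \<le> 9 * e * norm x * norm x + 9 * (e * norm x * norm w) + 6/5 * norm \<eta> * norm x"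
    using e by (intro add_right_mono mult_right_mono) auto
  also have "\<dots> = (9 * (real d + 1) * \<epsilon> * (norm x + norm w) + 6/5 * norm \<eta>) * norm x"
    by (simp add: e_def algebra_simps)
  finally show ?thesis .
qed

end

lemma cosine_minus_left: "cosine (- x) y = - cosine x y"
  by (simp add: cosine_def)

lemma tendsto_cosine:
  assumes "x \<noteq> 0" "w \<noteq> 0" shows "((\<lambda>y. cosine y w) \<longlongrightarrow> cosine x w) (at x)"
  unfolding cosine_def using assms by (auto intro!: tendsto_intros)

section \<open>Clarke subgradients and the surrogate\<close>

text \<open>The support function of the subdifferential is replaced by all its local upper bounds \<open>c\<close>, which
  avoids an extended real limit superior.\<close>

definition clarke_subgradient :: "'a::real_inner set \<Rightarrow> ('a \<Rightarrow> real) \<Rightarrow> 'a \<Rightarrow> 'a \<Rightarrow> bool" where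
  "clarke_subgradient V f x v \<longleftrightarrow> v \<in> V \<and> (\<forall>u \<in> V. \<forall>c.
     (\<exists>\<delta>>0. \<forall>y \<in> V. \<forall>t. norm (y - x) < \<delta> \<and> 0 < t \<and> t < \<delta> \<longrightarrow> f (y + t *\<^sub>R u) - f y \<le> c * t) \<longrightarrow> inner v u \<le> c)"

text \<open>Testing the subgradient in the direction v - h gives |v - h|^2 \<le> c |v - h|. The
  slack \<xi> leaves room for estimates that become sharp only in the limit.\<close>

lemma clarke_subgradient_close:
  assumes v: "clarke_subgradient V f x v" and V: "subspace V" and h: "h \<in> V" and c: "0 \<le> c"
    and quot: "\<And>u \<xi>. u \<in> V \<Longrightarrow> 0 < \<xi> \<Longrightarrow> \<exists>\<delta>>0. \<forall>y \<in> V. \<forall>t. norm (y - x) < \<delta> \<and> 0 < t \<and> t < \<delta> \<longrightarrow>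
        f (y + t *\<^sub>R u) - f y \<le> (inner h u + c * norm u + \<xi>) * t"
  shows "norm (v - h) \<le> c"
proof -
  define u where "u = v - h"
  have u: "u \<in> V" using v h V unfolding u_def clarke_subgradient_def by (auto intro: subspace_diff)
  have "inner v u \<le> inner h u + c * norm u + \<xi>" if "0 < \<xi>" for \<xi>
    using v u quot[OF u that] unfolding clarke_subgradient_def by blast
  then have "inner v u \<le> inner h u + c * norm u" by (rule field_le_epsilon)
  then have "(norm u)\<^sup>2 \<le> c * norm u" by (simp add: u_def power2_norm_eq_inner inner_diff_left)
  then have "norm u \<le> c" using c by (cases "u = 0") (auto simp: power2_eq_square)
  then show ?thesis by (simp add: u_def)
qed

text \<open>\<open>E\<close> is the common relative error level: 200 d^2 sqrt \<epsilon> for the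
  linearization through all layers, plus the noise relative to the target. Its upper bound leaves a
  wide margin for the powers of the depth that follow.\<close>

locale descent = layered_net +
  fixes w \<eta> :: 'a and E :: real
  assumes w: "w \<in> V" "w \<noteq> 0"
    and E_ge: "200 * (real d)\<^sup>2 * sqrt \<epsilon> + 6/5 * norm \<eta> / norm w \<le> E"
    and E_le: "10 ^ 20 * real d ^ 40 * E \<le> 1"
begin

definition D :: real where "D = real d"
abbreviation f where "f \<equiv> obj \<eta> w"

lemma D_ge: "2 \<le> D" using depth by (simp add: D_def)

lemma D_sq: "1 \<le> D" "D \<le> D\<^sup>2" "2 \<le> D\<^sup>2" "1 \<le> D\<^sup>2"
proof -
  show 1: "1 \<le> D" using D_ge by simp
  have "D * 1 \<le> D * D" using 1 by (intro mult_left_mono) auto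
  then show "D \<le> D\<^sup>2" by (simp add: power2_eq_square)
  then show "2 \<le> D\<^sup>2" "1 \<le> D\<^sup>2" using D_ge by linarith+
qed

lemma E_pos: "0 < E"
proof -
  have "0 < 200 * D\<^sup>2 * sqrt \<epsilon>" using eps_pos D_ge by simp
  moreover have "0 \<le> 6/5 * norm \<eta> / norm w" by simp
  ultimately show ?thesis using E_ge unfolding D_def by linarith
qed

lemma E_small: "k \<le> 40 \<Longrightarrow> E * D ^ k \<le> 1 / 100000000000000000000"
proof -
  assume "k \<le> 40"
  then have "D ^ k \<le> D ^ 40" using D_ge by (intro power_increasing) auto
  then have "E * D ^ k \<le> E * D ^ 40" using E_pos by simp
  also have "\<dots> \<le> 1 / 100000000000000000000" using E_le by (simp add: field_simps D_def)
  finally show ?thesis .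
qed

lemma sqrt_eps: "200 * D\<^sup>2 * sqrt \<epsilon> \<le> E" "\<epsilon> \<le> sqrt \<epsilon> / 100" "sqrt \<epsilon> \<le> E" "sqrt \<epsilon> * D ^ 40 \<le> 1 / 100000000000000000000"
proof -
  have "0 \<le> 6/5 * norm \<eta> / norm w" by simp
  then show 1: "200 * D\<^sup>2 * sqrt \<epsilon> \<le> E" using E_ge unfolding D_def by linarith
  have "1 * sqrt \<epsilon> \<le> 200 * D\<^sup>2 * sqrt \<epsilon>"
    using D_sq eps_pos by (intro mult_right_mono) (linarith, simp)
  then show 2: "sqrt \<epsilon> \<le> E" using 1 by linarith
  then have "sqrt \<epsilon> * D ^ 40 \<le> E * D ^ 40" using D_ge by (intro mult_right_mono) auto
  then show "sqrt \<epsilon> * D ^ 40 \<le> 1 / 100000000000000000000" using E_small[of 40] by simp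
  have "sqrt \<epsilon> \<le> 1 / 100" using 2 E_small[of 0] by simp
  then have "sqrt \<epsilon> * sqrt \<epsilon> \<le> 1 / 100 * sqrt \<epsilon>" using eps_pos by (intro mult_right_mono) auto
  then show "\<epsilon> \<le> sqrt \<epsilon> / 100" using eps_pos by simp
qed

lemma noise_le: "6/5 * norm \<eta> \<le> E * norm w"
proof -
  have "0 \<le> 200 * D\<^sup>2 * sqrt \<epsilon>" using eps_pos by simp
  then have "6/5 * norm \<eta> / norm w \<le> E" using E_ge unfolding D_def by linarith
  then show ?thesis using w by (simp add: field_simps)
qed

lemma linearization:
  assumes z: "z \<in> V" "z \<noteq> 0" and y: "y \<in> V" and close: "norm (y - z) \<le> \<epsilon> * norm z"
  shows "\<bar>f y - f z - inner (field w z) (y - z)\<bar> \<le> E * (norm z + norm w) * norm (y - z)"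
proof -
  define q where "q = sqrt \<epsilon>"
  define n where "n = D + 1"
  \<comment> \<open>The relative radius is \<epsilon>, so both terms under the root are of the same
    order and \<mu> is at most 5 sqrt \<epsilon>.\<close>
  define \<mu> where "\<mu> = \<epsilon> + sqrt (16 * \<epsilon> + 4 * \<epsilon>)"
  have q: "0 \<le> q" "\<epsilon> \<le> q / 100" "\<epsilon> = q * q" using sqrt_eps eps_pos by (auto simp: q_def)
  have n: "3 \<le> n" "n \<le> 3/2 * D" using D_ge by (auto simp: n_def)
  have "sqrt (16 * \<epsilon> + 4 * \<epsilon>) = sqrt 20 * q" by (simp add: q_def flip: real_sqrt_mult)
  also have "\<dots> \<le> 49/10 * q"
    using q by (intro mult_right_mono real_le_lsqrt) (auto simp: power_divide)
  finally have mu: "\<mu> \<le> 5 * q" "0 \<le> \<mu>" using q eps_pos by (auto simp: \<mu>_def)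
  have "q * D \<le> q * D ^ 40" using q D_ge power_increasing[of 1 40 D] by (intro mult_left_mono) auto
  then have qD: "q * D \<le> 1 / 100000000000000000000" using sqrt_eps(4) by (simp add: q_def)
  have "n * \<mu> \<le> (3/2 * D) * (5 * q)" using n mu D_ge by (intro mult_mono) auto
  also have "(3/2 * D) * (5 * q) = 15/2 * (q * D)" by simp
  finally have "n * \<mu> \<le> 1 / 20" using qD by linarith
  then have nm: "20 * (D + 1) * \<mu> \<le> 1" by (simp add: n_def algebra_simps)
  have "sqrt (4 * n * \<epsilon>) \<le> 2 * n * q"
  proof (rule real_le_lsqrt)
    have "1 * (n * (q * q)) \<le> n * (n * (q * q))" using n by (intro mult_right_mono) auto
    then show "4 * n * \<epsilon> \<le> (2 * n * q)\<^sup>2" by (simp add: q(3) power2_eq_square mult_ac)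
  qed (use n q in auto)
  moreover have "12 * n * \<mu> \<le> 12 * n * (5 * q)" using mu n by (intro mult_left_mono) auto
  moreover have "cross_error \<mu> = 12 * n * \<mu> + 5 * sqrt (4 * n * \<epsilon>)"
    by (simp add: cross_error_def n_def D_def)
  moreover have "12 * n * (5 * q) = 60 * (n * q)" "2 * n * q = 2 * (n * q)" "70 * n * q = 70 * (n * q)" by simp_all
  ultimately have "cross_error \<mu> + 5 * \<mu> \<le> 70 * n * q + 25 * q" using mu by linarith
  \<comment> \<open>Origin of 200 d^2: each of the d + 1 layers contributes an error of order d sqrt
    \<epsilon>.\<close>
  then have "n * (cross_error \<mu> + 5 * \<mu>) \<le> n * (70 * n * q + 25 * q)" using n by (intro mult_left_mono) auto
  also have "\<dots> = (70 * n + 25) * n * q" by (simp add: algebra_simps)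
  also have "\<dots> \<le> (70 * (3/2 * D) + 25/2 * D) * (3/2 * D) * q"
    using n D_ge q by (intro mult_right_mono mult_mono) auto
  also have "\<dots> = 705/4 * D\<^sup>2 * q" by (simp add: power2_eq_square algebra_simps)
  also have "705/4 * D\<^sup>2 * q + \<epsilon> \<le> 200 * D\<^sup>2 * q"
  proof -
    have "1 * q \<le> D\<^sup>2 * q" using D_sq q by (intro mult_right_mono) auto
    then show ?thesis using q by linarith
  qed
  finally have co: "(D + 1) * (cross_error \<mu> + 5 * \<mu>) + \<epsilon> \<le> 200 * D\<^sup>2 * sqrt \<epsilon>" by (simp add: n_def q_def)
  have "norm \<eta> = (norm \<eta> / norm w) * norm w" using w by simp
  also have "\<dots> \<le> (norm \<eta> / norm w) * (norm z + norm w)" by (intro mult_left_mono) auto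
  finally have "6/5 * norm \<eta> \<le> (6/5 * norm \<eta> / norm w) * (norm z + norm w)" by simp
  moreover have "((D + 1) * (cross_error \<mu> + 5 * \<mu>) + \<epsilon>) * (norm z + norm w)
      \<le> (200 * D\<^sup>2 * sqrt \<epsilon>) * (norm z + norm w)" by (intro mult_right_mono co) auto
  ultimately have "((D + 1) * (cross_error \<mu> + 5 * \<mu>) + \<epsilon>) * (norm z + norm w) + 6/5 * norm \<eta>
      \<le> (200 * D\<^sup>2 * sqrt \<epsilon> + 6/5 * norm \<eta> / norm w) * (norm z + norm w)"
    unfolding distrib_right[of _ _ "_ + _"] by linarith
  also have "\<dots> \<le> E * (norm z + norm w)" using E_ge unfolding D_def by (intro mult_right_mono) auto
  finally have "(((D + 1) * (cross_error \<mu> + 5 * \<mu>) + \<epsilon>) * (norm z + norm w) + 6/5 * norm \<eta>) * norm (y - z)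
      \<le> E * (norm z + norm w) * norm (y - z)" by (rule mult_right_mono) simp
  moreover have "\<epsilon> \<le> 1/2" using eps_le by simp
  ultimately show ?thesis
    using objective_linearization[OF z w y close _ _ nm[unfolded D_def], of \<eta>] by (simp add: \<mu>_def D_def)
qed

lemma uniform_bound:
  assumes "x \<in> V" "x \<noteq> 0"
  shows "\<bar>f x - f 0 - ((norm x)\<^sup>2 / 2 - norm x * norm w * net_kernel d (cosine x w))\<bar>
    \<le> E * (norm x + norm w) * norm x"
proof -
  have "9 * (D + 1) \<le> 9 * (D\<^sup>2 + D\<^sup>2)" using D_sq by (intro mult_left_mono add_mono) auto
  also have "9 * (D\<^sup>2 + D\<^sup>2) \<le> 200 * D\<^sup>2" by simp
  finally have "9 * (D + 1) \<le> 200 * D\<^sup>2" .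
  then have "9 * (D + 1) * \<epsilon> \<le> 200 * D\<^sup>2 * sqrt \<epsilon>"
    by (rule mult_mono) (use sqrt_eps eps_pos D_sq in auto)
  then have "(9 * (D + 1) * \<epsilon>) * (norm x + norm w) \<le> (200 * D\<^sup>2 * sqrt \<epsilon>) * (norm x + norm w)"
    by (intro mult_right_mono) auto
  moreover have "6/5 * norm \<eta> \<le> (6/5 * norm \<eta> / norm w) * (norm x + norm w)"
    using w by (simp add: field_simps)
  ultimately have "9 * (D + 1) * \<epsilon> * (norm x + norm w) + 6/5 * norm \<eta>
      \<le> (200 * D\<^sup>2 * sqrt \<epsilon> + 6/5 * norm \<eta> / norm w) * (norm x + norm w)"
    unfolding distrib_right[of _ _ "_ + _"] by linarith
  also have "\<dots> \<le> E * (norm x + norm w)" using E_ge unfolding D_def by (intro mult_right_mono) auto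
  finally have "(9 * (D + 1) * \<epsilon> * (norm x + norm w) + 6/5 * norm \<eta>) * norm x \<le> E * (norm x + norm w) * norm x"
    by (rule mult_right_mono) simp
  then show ?thesis using objective_uniform[OF assms w, of \<eta>] unfolding D_def by linarith
qed

definition surrogate :: "'a \<Rightarrow> real" where
  "surrogate x = (norm x)\<^sup>2 / 2 - norm x * norm w * net_kernel d (cosine x w)"

lemma inner_field:
  "inner (field w x) u = inner x u - norm w * (net_slope d (cosine x w) * (inner w u / norm w)
     + (net_kernel d (cosine x w) - cosine x w * net_slope d (cosine x w)) * (inner x u / norm x))"
  by (simp add: field_def inner_diff_left inner_add_left divide_inverse mult.commute)

text \<open>The surrogate is a quadratic minus a convex function: the profile is convex, and its perspective
  is nondecreasing in the norm because the residual \<open>net_kernel - s net_slope\<close> is nonnegative.\<close>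

lemma surrogate_upper:
  assumes x: "x \<noteq> 0"
  shows "surrogate y \<le> surrogate x + inner (field w x) (y - x) + (norm (y - x))\<^sup>2 / 2"
proof -
  let ?r = "cosine x w" and ?b = "net_slope d (cosine x w)"
  let ?s = "net_kernel d ?r - ?r * ?b"
  have c: "\<bar>?r\<bar> \<le> 1" "\<bar>cosine y w\<bar> \<le> 1" by (auto simp: cosine_bound)
  have s: "0 \<le> ?s" using net_residual_nonneg[OF c(1) depth] .
  have iw: "inner w u / norm w = norm u * cosine u w" for u
    using w inner_eq_cosine[of u w] by (simp add: inner_commute)
  have "inner x (y - x) / norm x \<le> norm y - norm x"
  proof -
    have "inner x (y - x) \<le> norm x * norm y - norm x * norm x"
      using Cauchy_Schwarz_ineq2[of x y] power2_norm_eq_inner[of x]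
      by (simp add: inner_diff_right power2_eq_square abs_le_iff)
    then have "inner x (y - x) \<le> (norm y - norm x) * norm x" by (simp add: algebra_simps)
    then show ?thesis using x by (simp add: pos_divide_le_eq)
  qed
  then have 1: "?s * (inner x (y - x) / norm x) \<le> ?s * (norm y - norm x)" using s by (rule mult_left_mono)
  have 2: "inner w (y - x) / norm w = norm y * cosine y w - norm x * ?r"
    by (simp add: inner_diff_right diff_divide_distrib iw)
  have "norm y * (net_kernel d ?r + ?b * (cosine y w - ?r)) \<le> norm y * net_kernel d (cosine y w)"
    using net_kernel_tangent[OF c(2,1) depth] by (intro mult_left_mono) auto
  then have "norm x * net_kernel d ?r + (?b * (inner w (y - x) / norm w) + ?s * (inner x (y - x) / norm x))
      \<le> norm y * net_kernel d (cosine y w)"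
    using 1 unfolding 2 by (simp add: algebra_simps)
  then have "norm w * (norm x * net_kernel d ?r + (?b * (inner w (y - x) / norm w) + ?s * (inner x (y - x) / norm x)))
      \<le> norm w * (norm y * net_kernel d (cosine y w))" by (rule mult_left_mono) simp
  moreover have "(norm y)\<^sup>2 / 2 = (norm x)\<^sup>2 / 2 + inner x (y - x) + (norm (y - x))\<^sup>2 / 2"
    using half_square_norm_diff[of y 0 x] by simp
  ultimately show ?thesis unfolding surrogate_def inner_field by (simp add: algebra_simps)
qed

lemma field_bound: assumes "x \<noteq> 0" shows "norm (field w x) \<le> norm x + 3 * norm w"
proof -
  let ?r = "cosine x w" and ?b = "net_slope d (cosine x w)"
  have c: "\<bar>?r\<bar> \<le> 1" by (simp add: cosine_bound)
  have "\<bar>?r * ?b\<bar> \<le> 1 * 1" unfolding abs_mult using c net_slope_bounds[OF c depth] by (intro mult_mono) auto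
  then have s: "\<bar>net_kernel d ?r - ?r * ?b\<bar> \<le> 2"
    using net_residual_nonneg[OF c depth] net_kernel_bounds[OF c depth] by linarith
  have "norm (?b *\<^sub>R (w /\<^sub>R norm w) + (net_kernel d ?r - ?r * ?b) *\<^sub>R (x /\<^sub>R norm x)) \<le> 3"
  proof (rule norm_triangle_le)
    have "norm (w /\<^sub>R norm w) = 1" "norm (x /\<^sub>R norm x) = 1" using assms w by simp_all
    then have "norm (?b *\<^sub>R (w /\<^sub>R norm w)) = \<bar>?b\<bar>"
      "norm ((net_kernel d ?r - ?r * ?b) *\<^sub>R (x /\<^sub>R norm x)) = \<bar>net_kernel d ?r - ?r * ?b\<bar>"
      by (simp_all only: norm_scaleR mult_1_right)
    then show "norm (?b *\<^sub>R (w /\<^sub>R norm w)) + norm ((net_kernel d ?r - ?r * ?b) *\<^sub>R (x /\<^sub>R norm x)) \<le> 3"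
      using s net_slope_bounds[OF c depth] by linarith
  qed
  from mult_left_mono[OF this norm_ge_zero[of w]] show ?thesis
    unfolding field_def by (intro norm_triangle_le_diff) (simp add: mult.commute)
qed

lemma inner_field_self:
  assumes "x \<noteq> 0"
  shows "inner (field w x) x = (norm x)\<^sup>2 - norm x * norm w * net_kernel d (cosine x w)"
proof -
  have "inner w x / norm w = norm x * cosine x w"
    using w inner_eq_cosine[of x w] by (simp add: inner_commute)
  moreover have "inner x x / norm x = norm x"
    using assms by (simp add: power2_norm_eq_inner[symmetric] power2_eq_square)
  ultimately show ?thesis
    unfolding inner_field by (simp only: power2_norm_eq_inner) (simp add: algebra_simps)
qed

lemma field_in_V: "x \<in> V \<Longrightarrow> field w x \<in> V"
  unfolding field_def
  by (rule subspace_diff[OF subspace_V _ subspace_scale[OF subspace_V subspace_add[OF subspace_V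
        subspace_scale[OF subspace_V subspace_scale[OF subspace_V w(1)]]
        subspace_scale[OF subspace_V subspace_scale[OF subspace_V]]]]])

lemma tendsto_field: assumes "x \<noteq> 0" shows "(field w \<longlongrightarrow> field w x) (at x)"
proof -
  have c: "((\<lambda>y. cosine y w) \<longlongrightarrow> cosine x w) (at x)" using tendsto_cosine[OF assms w(2)] .
  have m: "cosine y w \<in> {-1..1}" for y using cosine_bound[of y w] by (auto simp: abs_le_iff)
  have "((\<lambda>y. net_kernel d (cosine y w)) \<longlongrightarrow> net_kernel d (cosine x w)) (at x)"
    "((\<lambda>y. net_slope d (cosine y w)) \<longlongrightarrow> net_slope d (cosine x w)) (at x)"
    by (rule continuous_on_tendsto_compose[OF _ c m]; simp add: continuous_on_net m del: atLeastAtMost_iff)+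
  then show ?thesis unfolding field_def using assms c by (auto intro!: tendsto_intros)
qed

text \<open>\<open>linearization\<close> at nearby points y bounds difference quotients by the field
  at y, and continuity of the field replaces y by x.\<close>

lemma subgradient_field:
  assumes x: "x \<in> V" "x \<noteq> 0" and v: "clarke_subgradient V f x v"
  shows "norm (v - field w x) \<le> E * (norm x + norm w)"
proof (rule clarke_subgradient_close[OF v subspace_V field_in_V[OF x(1)]])
  show "0 \<le> E * (norm x + norm w)" using E_pos by simp
  fix u :: 'a and \<xi> :: real assume u: "u \<in> V" and xi: "0 < \<xi>"
  define \<xi>' where "\<xi>' = \<xi> / (2 * (norm u + 1))"
  have xi': "0 < \<xi>'" "\<xi>' * norm u \<le> \<xi> / 2"
  proof -
    have "0 < norm u + 1" using norm_ge_zero[of u] by linarith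
    then show "0 < \<xi>'" "\<xi>' * norm u \<le> \<xi> / 2" using xi by (auto simp: \<xi>'_def field_simps)
  qed
  obtain s where s: "0 < s" "\<And>y. norm (y - x) < s \<Longrightarrow> norm (field w y - field w x) < \<xi>'"
  proof -
    obtain s where "0 < s" "\<forall>y. y \<noteq> x \<and> norm (y - x) < s \<longrightarrow> norm (field w y - field w x) < \<xi>'"
      using tendsto_field[OF x(2)] xi'(1) unfolding LIM_eq by blast
    then show ?thesis using xi'(1) by (intro that[of s]) (metis cancel_comm_monoid_add_class.diff_cancel norm_zero)+
  qed
  \<comment> \<open>The four bounds control, in order, the change of the field, the distance of y
    from 0, the growth of E |y|, and the step t u, which must stay within relative distance
    \<epsilon> of y.\<close>
  define \<delta> where "\<delta> = min (min s (norm x / 2)) (min (\<xi>' / (2 * E)) (\<epsilon> * norm x / (2 * (norm u + 1))))"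
  have u1: "0 < norm u + 1" using norm_ge_zero[of u] by linarith
  show "\<exists>\<delta>>0. \<forall>y\<in>V. \<forall>t. norm (y - x) < \<delta> \<and> 0 < t \<and> t < \<delta> \<longrightarrow>
      f (y + t *\<^sub>R u) - f y \<le> (inner (field w x) u + E * (norm x + norm w) * norm u + \<xi>) * t"
  proof (intro exI conjI ballI allI impI)
    show "0 < \<delta>" using s x xi' E_pos eps_pos u1 by (auto simp: \<delta>_def intro!: divide_pos_pos)
    fix y t assume y: "y \<in> V" and "norm (y - x) < \<delta> \<and> 0 < t \<and> t < \<delta>"
    then have yx: "norm (y - x) < s" "norm (y - x) < norm x / 2" "norm (y - x) < \<xi>' / (2 * E)"
      and t: "0 < t" "t < \<epsilon> * norm x / (2 * (norm u + 1))" by (auto simp: \<delta>_def)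
    have ny: "norm x / 2 \<le> norm y" "norm y \<le> norm x + \<xi>' / (2 * E)"
      using yx norm_triangle_ineq2[of x y] norm_triangle_ineq2[of y x] by (auto simp: norm_minus_commute)
    then have y0: "y \<noteq> 0" using x by auto
    have "t * norm u \<le> t * (norm u + 1)" using t by simp
    also have "\<dots> \<le> \<epsilon> * norm x / 2" using t u1 by (simp add: field_simps)
    also have "\<dots> \<le> \<epsilon> * norm y" using ny(1) eps_pos by simp
    finally have close: "norm ((y + t *\<^sub>R u) - y) \<le> \<epsilon> * norm y" using t by simp
    have yu: "y + t *\<^sub>R u \<in> V" using y u subspace_V by (intro subspace_add subspace_scale)
    have "f (y + t *\<^sub>R u) - f y \<le> inner (field w y) (t *\<^sub>R u) + E * (norm y + norm w) * norm (t *\<^sub>R u)"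
      using linearization[OF y y0 yu close] by (simp add: abs_le_iff)
    also have "\<dots> = (inner (field w x) u + inner (field w y - field w x) u + E * (norm y + norm w) * norm u) * t"
      using t by (simp add: inner_diff_left algebra_simps)
    also have "\<dots> \<le> (inner (field w x) u + E * (norm x + norm w) * norm u + \<xi>) * t"
    proof (rule mult_right_mono)
      have "inner (field w y - field w x) u \<le> \<xi>' * norm u"
        using order_trans[OF Cauchy_Schwarz_ineq2 mult_right_mono[OF less_imp_le[OF s(2)[OF yx(1)]] norm_ge_zero]]
        by (simp add: abs_le_iff)
      moreover have "E * (norm y + norm w) * norm u \<le> E * (norm x + norm w) * norm u + \<xi>' / 2 * norm u"
      proof -
        have "E * norm y \<le> E * (norm x + \<xi>' / (2 * E))" using ny E_pos by (intro mult_left_mono) auto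
        also have "\<dots> = E * norm x + \<xi>' / 2" using E_pos by (simp add: field_simps)
        finally have "E * (norm y + norm w) \<le> E * (norm x + norm w) + \<xi>' / 2" by (simp add: algebra_simps)
        then have "E * (norm y + norm w) * norm u \<le> (E * (norm x + norm w) + \<xi>' / 2) * norm u"
          by (rule mult_right_mono) simp
        then show ?thesis by (simp add: distrib_right)
      qed
      ultimately show "inner (field w x) u + inner (field w y - field w x) u + E * (norm y + norm w) * norm u
          \<le> inner (field w x) u + E * (norm x + norm w) * norm u + \<xi>" using xi'(2) xi by linarith
    qed (use t in simp)
    finally show "f (y + t *\<^sub>R u) - f y \<le> (inner (field w x) u + E * (norm x + norm w) * norm u + \<xi>) * t" .
  qed
qed

section \<open>Descent away from the target\<close>

text \<open>Matched to \<open>radius\<close> by 30 D^9 \<open>grad_tol\<close> = 3/10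
  \<open>radius\<close>: dividing a field of this size by the slope bound 1 / (30 D^9) leaves a sine
  of at most 3/10 \<open>radius\<close>.\<close>

definition grad_tol :: real where "grad_tol = 1 / (10 ^ 8 * D ^ 11)"
text \<open>The root of 32 \<open>radius\<close> has to stay below the error 1 / (150 D) allowed per
  layer near the target; hence the square of the depth.\<close>

definition radius :: real where "radius = 1 / (10 ^ 6 * D\<^sup>2)"

lemma D_pow_pos: "0 < D ^ k" using D_ge by simp

lemma tol_bounds: "0 < grad_tol" "E \<le> grad_tol / 300" "grad_tol \<le> radius / 100" "0 < radius" "radius \<le> 1 / 4000000"
proof -
  show "0 < grad_tol" "0 < radius" using D_ge by (auto simp: grad_tol_def radius_def)
  show "E \<le> grad_tol / 300" using E_small[of 11] D_pow_pos[of 11] by (simp add: grad_tol_def field_simps)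
  have "D\<^sup>2 \<le> D ^ 11" using D_ge by (intro power_increasing) auto
  then show "grad_tol \<le> radius / 100"
    using D_pow_pos[of 11] D_pow_pos[of 2] by (simp add: grad_tol_def radius_def field_simps)
  have "2\<^sup>2 \<le> D\<^sup>2" using D_ge by (intro power_mono) auto
  then show "radius \<le> 1 / 4000000" using D_pow_pos[of 2] by (simp add: radius_def field_simps)
qed

lemma segment_in_V: "x \<in> V \<Longrightarrow> y \<in> V \<Longrightarrow> x + s *\<^sub>R (y - x) \<in> V"
  using subspace_V by (simp add: subspace_add subspace_diff subspace_scale)

text \<open>The error of \<open>uniform_bound\<close> does not shrink with |y - x|, and
  \<open>linearization\<close> reaches only a relative distance \<epsilon>. So the segment is cut
  into short pieces and their linear errors are summed; it has to keep away from 0, where relative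
  distances degenerate.\<close>

lemma objective_along_segment:
  assumes xy: "x \<in> V" "y \<in> V" and m: "0 < m"
    and seg: "\<And>s. 0 \<le> s \<Longrightarrow> s \<le> 1 \<Longrightarrow> m \<le> norm (x + s *\<^sub>R (y - x)) \<and> norm (x + s *\<^sub>R (y - x)) \<le> M"
  shows "f y - f x \<le> surrogate y - surrogate x + 2 * E * (M + norm w) * norm (y - x)"
proof -
  have Mw: "0 < M + norm w" using seg[of 0] m w by simp (metis add_pos_pos less_le_trans order_less_le_trans zero_less_norm_iff)
  define c where "c = min (\<epsilon> * m) (2 * (E * (M + norm w)))"
  have c: "0 < c" "c \<le> \<epsilon> * m" "c / 2 \<le> E * (M + norm w)" using eps_pos m E_pos Mw by (auto simp: c_def)
  obtain n0 :: nat where n0: "norm (y - x) / c < real n0" using reals_Archimedean2 by blast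
  define n where "n = Suc n0"
  define h where "h = norm (y - x) / real n"
  have h: "0 \<le> h" "real n * h = norm (y - x)" by (auto simp: h_def n_def)
  have "norm (y - x) \<le> c * real n" using n0 c by (simp add: n_def field_simps)
  then have hc: "h \<le> c" by (simp add: h_def n_def field_simps)
  define z where "z j = x + (real j / real n) *\<^sub>R (y - x)" for j :: nat
  have bound: "f (z j) - f x \<le> surrogate (z j) - surrogate x + real j * (2 * (E * (M + norm w)) * h)"
    if "j \<le> n" for j
    using that
  proof (induction j)
    case 0 then show ?case by (simp add: z_def)
  next
    case (Suc j)
    have zV: "z j \<in> V" "z (Suc j) \<in> V" using xy by (auto simp: z_def intro: segment_in_V)
    have zs: "m \<le> norm (z (Suc j))" "norm (z (Suc j)) \<le> M"
      using seg[of "real (Suc j) / real n"] Suc.prems by (auto simp: z_def)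
    then have z0: "z (Suc j) \<noteq> 0" using m by auto
    have dz: "z j - z (Suc j) = - ((1 / real n) *\<^sub>R (y - x))"
    proof -
      have "real (Suc j) / real n = real j / real n + 1 / real n" by (simp add: add_divide_distrib)
      then show ?thesis by (simp only: z_def scaleR_left_distrib) simp
    qed
    have nz: "norm (z j - z (Suc j)) = h" unfolding dz norm_minus_cancel norm_scaleR by (simp add: h_def)
    \<comment> \<open>The linearization is taken at the far end of the piece and read backwards:
      \<open>surrogate_upper\<close> is an upper bound only, and from the far end it bounds the
      increase of the surrogate from below.\<close>
    have "h \<le> \<epsilon> * norm (z (Suc j))" using hc c(2) mult_left_mono[OF zs(1), of \<epsilon>] eps_pos by linarith
    then have "\<bar>f (z j) - f (z (Suc j)) - inner (field w (z (Suc j))) (z j - z (Suc j))\<bar>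
        \<le> E * (norm (z (Suc j)) + norm w) * h"
      using linearization[OF zV(2) z0 zV(1)] nz by simp
    also have "\<dots> \<le> (E * (M + norm w)) * h" using zs E_pos h by (intro mult_right_mono mult_left_mono) auto
    finally have 1: "\<bar>f (z j) - f (z (Suc j)) - inner (field w (z (Suc j))) (z j - z (Suc j))\<bar> \<le> (E * (M + norm w)) * h" .
    have 2: "surrogate (z j) \<le> surrogate (z (Suc j)) + inner (field w (z (Suc j))) (z j - z (Suc j)) + h\<^sup>2 / 2"
      using surrogate_upper[OF z0, of "z j"] nz by simp
    have "(h / 2) * h \<le> (E * (M + norm w)) * h" using hc c h by (intro mult_right_mono) auto
    then have "h\<^sup>2 / 2 \<le> (E * (M + norm w)) * h" by (simp add: power2_eq_square)
    then have "f (z (Suc j)) - f (z j) \<le> surrogate (z (Suc j)) - surrogate (z j) + 2 * ((E * (M + norm w)) * h)"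
      using 1 2 by linarith
    moreover have "real (Suc j) * (2 * (E * (M + norm w)) * h)
        = real j * (2 * (E * (M + norm w)) * h) + 2 * ((E * (M + norm w)) * h)" by (simp add: algebra_simps)
    ultimately show ?case using Suc by linarith
  qed
  have eq: "real n * (2 * (E * (M + norm w)) * h) = 2 * E * (M + norm w) * norm (y - x)"
    by (simp add: h(2)[symmetric] mult_ac)
  have "z n = y" by (simp add: z_def n_def)
  then show ?thesis using bound[OF order_refl] unfolding eq by simp
qed

text \<open>As the profile is at least 1/2, the inner product of a subgradient with x is at most 5/4
  |x|^2, so a step of length at most 1/4 keeps half the norm. Iterates and the segments between them
  thus avoid 0.\<close>

lemma step_norm_lower:
  assumes x: "x \<in> V" "x \<noteq> 0" and v: "clarke_subgradient V f x v" and a: "0 \<le> a" "a \<le> 1/4"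
  shows "norm x / 2 \<le> norm (x - a *\<^sub>R v)"
proof -
  define r R where rR: "r = norm x" "R = norm w"
  have pos: "0 < r" "0 < R" using x w by (auto simp: rR)
  have "inner (v - field w x) x \<le> (E * (r + R)) * r"
    using order_trans[OF Cauchy_Schwarz_ineq2 mult_right_mono[OF subgradient_field[OF x v] norm_ge_zero]]
    by (simp add: rR abs_le_iff)
  moreover have "r * R * (1/2) \<le> r * R * net_kernel d (cosine x w)"
    using net_kernel_bounds(1)[OF cosine_bound depth, of x w] pos by (intro mult_left_mono) auto
  ultimately have "inner v x \<le> r * r - r * R / 2 + (E * (r + R)) * r"
    using inner_field_self[OF x(2)] by (simp add: inner_diff_left rR power2_eq_square)
  also have "(E * (r + R)) * r \<le> (1/4 * (r + R)) * r"
    using tol_bounds pos by (intro mult_right_mono) auto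
  also have "r * r - r * R / 2 + (1/4 * (r + R)) * r \<le> 5/4 * (r * r)" using pos by (simp add: algebra_simps)
  finally have iv: "inner v x \<le> 5/4 * (r * r)" by simp
  have "a * inner v x \<le> a * (5/4 * (r * r))" using iv a by (intro mult_left_mono) auto
  also have "\<dots> \<le> (1/4) * (5/4 * (r * r))" using a pos by (intro mult_right_mono) auto
  finally have av: "a * inner v x \<le> (1/4) * (5/4 * (r * r))" .
  have "r / 2 * r \<le> inner (x - a *\<^sub>R v) x"
  proof -
    have "inner (x - a *\<^sub>R v) x = r * r - a * inner v x"
      by (simp add: inner_diff_left rR power2_norm_eq_inner[symmetric] power2_eq_square)
    moreover have "0 \<le> r * r" by simp
    ultimately show ?thesis using av by linarith
  qed
  also have "\<dots> \<le> norm (x - a *\<^sub>R v) * r" using Cauchy_Schwarz_ineq2[of "x - a *\<^sub>R v" x] by (simp add: rR abs_le_iff)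
  finally show ?thesis using pos by (simp add: rR)
qed

lemma field_norm_ge: assumes "x \<noteq> 0" shows "\<bar>norm x - norm w * net_kernel d (cosine x w)\<bar> \<le> norm (field w x)"
  "norm x - norm w \<le> norm (field w x)"
proof -
  have "inner (field w x) x = (norm x - norm w * net_kernel d (cosine x w)) * norm x"
    unfolding inner_field_self[OF assms] by (simp add: power2_eq_square algebra_simps)
  then have "\<bar>norm x - norm w * net_kernel d (cosine x w)\<bar> * norm x \<le> norm (field w x) * norm x"
    using Cauchy_Schwarz_ineq2[of "field w x" x] by (simp add: abs_mult)
  then show 1: "\<bar>norm x - norm w * net_kernel d (cosine x w)\<bar> \<le> norm (field w x)" using assms by simp
  have "norm w * net_kernel d (cosine x w) \<le> norm w * 1"
    using net_kernel_bounds(3)[OF cosine_bound depth] by (intro mult_left_mono) auto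
  then show "norm x - norm w \<le> norm (field w x)" using 1 by (simp add: abs_le_iff)
qed

text \<open>Above the threshold the subgradient differs from the field by at most a hundredth of it,
  and the quadratic upper bound of the surrogate gives the usual gradient step estimate.\<close>

lemma descent_step:
  assumes x: "x \<in> V" "x \<noteq> 0" and v: "clarke_subgradient V f x v" and a: "0 < a" "a \<le> 1/4"
    and big: "grad_tol * norm w < norm (field w x)"
  shows "f (x - a *\<^sub>R v) \<le> f x - a * (grad_tol * norm w)\<^sup>2 / 4"
proof -
  define r R H where rR: "r = norm x" "R = norm w" "H = norm (field w x)"
  have pos: "0 < r" "0 < R" "0 \<le> H" using x w by (auto simp: rR)
  \<comment> \<open>For r \<le> 2 R the error is compared with the threshold, beyond that with the
    field itself, which is at least r - R.\<close>
  have EH: "E * (r + R) \<le> H / 100"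
  proof (cases "r \<le> 2 * R")
    case True
    then have "E * (r + R) \<le> E * (3 * R)" using E_pos by (intro mult_left_mono) auto
    also have "\<dots> \<le> (grad_tol / 300) * (3 * R)" using tol_bounds pos by (intro mult_right_mono) auto
    finally show ?thesis using big by (simp add: rR mult.commute)
  next
    case False
    then have "r / 2 \<le> H" using field_norm_ge(2)[OF x(2)] by (simp add: rR)
    then have "r + R \<le> 3 * H" using False pos by simp
    then have "E * (r + R) \<le> E * (3 * H)" using E_pos by (intro mult_left_mono) auto
    also have "\<dots> \<le> 1/300 * (3 * H)" using E_small[of 0] pos by (intro mult_right_mono) auto
    finally show ?thesis by simp
  qed
  have vh: "norm (v - field w x) \<le> H / 100" using subgradient_field[OF x v] EH by (simp add: rR)
  define q where "q = norm v"
  have q: "99/100 * H \<le> q" "q \<le> 101/100 * H" "0 \<le> q"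
    using vh norm_triangle_ineq2[of "field w x" v] norm_triangle_ineq2[of v "field w x"]
    by (auto simp: q_def rR norm_minus_commute)
  have Hb: "H \<le> r + 3 * R" using field_bound[OF x(2)] by (simp add: rR)
  define y where "y = x - a *\<^sub>R v"
  have vV: "v \<in> V" using v by (simp add: clarke_subgradient_def)
  have yV: "y \<in> V" unfolding y_def using x vV subspace_V by (simp add: subspace_diff subspace_scale)
  have yx: "norm (y - x) = a * q" using a by (simp add: y_def q_def)
  have "f y - f x \<le> surrogate y - surrogate x + 2 * E * ((2 * r + R) + norm w) * norm (y - x)"
  proof (rule objective_along_segment[OF x(1) yV])
    show "0 < r / 2" using pos by simp
    fix s :: real assume s: "0 \<le> s" "s \<le> 1"
    have e: "x + s *\<^sub>R (y - x) = x - (s * a) *\<^sub>R v" by (simp add: y_def)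
    have sa: "0 \<le> s * a" "s * a \<le> 1/4" using s a mult_mono[of s 1 a "1/4"] by auto
    have "norm (x - (s * a) *\<^sub>R v) \<le> r + (s * a) * q"
      using norm_triangle_ineq4[of x "(s * a) *\<^sub>R v"] sa by (simp add: rR q_def)
    also have "(s * a) * q \<le> (1/4) * (101/100 * (r + 3 * R))" using sa q Hb by (intro mult_mono) auto
    also have "(1/4) * (101/100 * (r + 3 * R)) \<le> r + R" using pos by simp
    finally have "norm (x - (s * a) *\<^sub>R v) \<le> 2 * r + R" by simp
    then show "r / 2 \<le> norm (x + s *\<^sub>R (y - x)) \<and> norm (x + s *\<^sub>R (y - x)) \<le> 2 * r + R"
      unfolding e using step_norm_lower[OF x v sa] by (simp add: rR)
  qed
  also have "2 * E * ((2 * r + R) + norm w) * norm (y - x) = 4 * (E * (r + R)) * (a * q)"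
    by (simp add: yx rR algebra_simps)
  also have "\<dots> \<le> 4 * (H / 100) * (a * q)" using EH a q by (intro mult_right_mono) auto
  also have "surrogate y \<le> surrogate x + inner (field w x) (y - x) + (a * q)\<^sup>2 / 2"
    using surrogate_upper[OF x(2), of y] yx by simp
  finally have 1: "f y - f x \<le> inner (field w x) (y - x) + (a * q)\<^sup>2 / 2 + 4 * (H / 100) * (a * q)" by simp
  have "inner (v - field w x) v \<le> (H / 100) * q"
    using order_trans[OF Cauchy_Schwarz_ineq2 mult_right_mono[OF vh norm_ge_zero], of v]
    by (simp add: q_def abs_le_iff)
  then have "q * q - (H / 100) * q \<le> inner (field w x) v"
    by (simp add: inner_diff_left q_def power2_norm_eq_inner[symmetric] power2_eq_square)
  then have "a * (q * q - (H / 100) * q) \<le> a * inner (field w x) v" using a by (intro mult_left_mono) auto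
  then have 2: "inner (field w x) (y - x) \<le> - (a * (q * q - (H / 100) * q))" by (simp add: y_def)
  have "(a * q)\<^sup>2 / 2 = a * (a * (q * q)) / 2" by (simp add: power2_eq_square)
  also have "\<dots> \<le> a * (1/4 * (q * q)) / 2"
    using a by (intro divide_right_mono mult_left_mono mult_right_mono) auto
  finally have 3: "(a * q)\<^sup>2 / 2 \<le> a * (q * q) / 8" by simp
  have 4: "a * (H * q) \<le> a * (100/99 * q * q)"
    using q a by (intro mult_left_mono mult_right_mono) auto
  have "f y - f x \<le> - (a * (q * q)) + a * (q * q) / 8 + 5 / 100 * (a * (H * q))"
    using 1 2 3 by (simp add: algebra_simps)
  also have "\<dots> \<le> - (a * (q * q)) + a * (q * q) / 8 + 5 / 100 * (a * (100/99 * q * q))"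
    using 4 by linarith
  also have "\<dots> \<le> - (1/2) * (a * (q * q))"
  proof -
    have "0 \<le> a * (q * q)" using a by simp
    then show ?thesis by (simp add: algebra_simps)
  qed
  finally have 5: "f y - f x \<le> - (1/2) * (a * (q * q))" .
  have "99/100 * (grad_tol * R) \<le> q" using q big by (simp add: rR)
  then have "(99/100 * (grad_tol * R))\<^sup>2 \<le> q\<^sup>2" using tol_bounds pos by (intro power_mono) auto
  moreover have "(99/100 * (grad_tol * R))\<^sup>2 = 9801/10000 * (grad_tol * R)\<^sup>2"
    by (simp only: power_mult_distrib) (simp add: power_divide)
  moreover have "(grad_tol * R)\<^sup>2 / 2 \<le> 9801/10000 * (grad_tol * R)\<^sup>2" by simp
  ultimately have "(grad_tol * R)\<^sup>2 / 2 \<le> q\<^sup>2" by linarith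
  then have "(grad_tol * R)\<^sup>2 / 2 \<le> q * q" by (simp add: power2_eq_square)
  then have "a * ((grad_tol * R)\<^sup>2 / 2) \<le> a * (q * q)" using a by (intro mult_left_mono) auto
  then show ?thesis using 5 by (simp add: y_def rR)
qed

section \<open>Points with a small surrogate gradient\<close>

lemma norm_diff_sq: "(norm (x - w))\<^sup>2 = (norm x - norm w)\<^sup>2 + 2 * (norm x * norm w * (1 - cosine x w))"
  using inner_eq_cosine[of x w]
  by (simp add: power2_norm_eq_inner inner_diff_left inner_diff_right inner_commute[of w x])
     (simp add: power2_norm_eq_inner[symmetric] power2_eq_square algebra_simps)

text \<open>The field lies in the plane of x and w; the left side is the square of its component
  orthogonal to x, to which only the part along w contributes.\<close>

lemma field_orthogonal:
  assumes "x \<noteq> 0"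
  shows "(norm w * net_slope d (cosine x w))\<^sup>2 * (1 - (cosine x w)\<^sup>2) \<le> (norm (field w x))\<^sup>2"
proof -
  let ?r = "cosine x w" and ?b = "net_slope d (cosine x w)"
  define A where "A = norm x - norm w * (net_kernel d ?r - ?r * ?b)"
  define B where "B = norm w * ?b"
  define p where "p = x /\<^sub>R norm x"
  define q where "q = w /\<^sub>R norm w"
  have pq: "inner p p = 1" "inner q q = 1" "inner p q = ?r"
    using assms w
    by (auto simp: p_def q_def power2_norm_eq_inner[symmetric] power2_eq_square cosine_def divide_inverse)
  have e: "field w x = A *\<^sub>R p - B *\<^sub>R q"
    using assms by (simp add: field_def A_def B_def p_def q_def algebra_simps)
  have "(norm (field w x))\<^sup>2 = A\<^sup>2 + B\<^sup>2 - 2 * A * B * ?r"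
    unfolding power2_norm_eq_inner e using pq
    by (simp add: inner_diff_left inner_diff_right inner_commute[of q p] power2_eq_square algebra_simps)
  also have "\<dots> = (A - B * ?r)\<^sup>2 + B\<^sup>2 * (1 - ?r\<^sup>2)" by (simp add: power2_eq_square algebra_simps)
  finally show ?thesis by (simp add: B_def)
qed

text \<open>If the cosine were below -1/2, the gap of the profile between s and -s would exceed the
  uniform error, and -x would have the smaller objective.\<close>

lemma cosine_not_opposite:
  assumes x: "x \<in> V" "x \<noteq> 0" and sel: "f x \<le> f (- x)" and r: "norm x \<le> 2 * norm w"
  shows "-1/2 \<le> cosine x w"
proof (rule ccontr)
  assume neg: "\<not> -1/2 \<le> cosine x w"
  define r R s where rR: "r = norm x" "R = norm w" "s = - cosine x w"
  have pos: "0 < r" "0 < R" using x w by (auto simp: rR)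
  have s: "1/2 < s" "s \<le> 1" using neg cosine_bound[of x w] by (auto simp: rR abs_le_iff)
  have xm: "- x \<in> V" "- x \<noteq> 0" using x subspace_V by (auto simp: subspace_neg)
  have "f x - f 0 \<ge> r\<^sup>2/2 - r * R * net_kernel d (- s) - E * (r + R) * r"
    "f (- x) - f 0 \<le> r\<^sup>2/2 - r * R * net_kernel d s + E * (r + R) * r"
    using uniform_bound[OF x] uniform_bound[OF xm] by (simp_all add: rR cosine_minus_left abs_le_iff)
  then have "r * R * (net_kernel d s - net_kernel d (- s)) \<le> 2 * (E * (r + R) * r)"
    using sel by (simp add: algebra_simps)
  also have "\<dots> \<le> 2 * (E * (3 * R) * r)" using r E_pos pos by (intro mult_left_mono mult_right_mono) (auto simp: rR)
  finally have "(r * R) * (net_kernel d s - net_kernel d (- s)) \<le> (r * R) * (6 * E)" by (simp add: algebra_simps)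
  then have "net_kernel d s - net_kernel d (- s) \<le> 6 * E" using pos by simp
  moreover have "s / (10 * D ^ 9) \<le> net_kernel d s - net_kernel d (- s)"
    unfolding D_def using s depth by (intro net_kernel_gap) auto
  ultimately have "s / (10 * D ^ 9) \<le> 6 * E" by linarith
  then have "s \<le> 60 * (E * D ^ 9)" using D_pow_pos[of 9] by (simp add: field_simps)
  then show False using E_small[of 9] s by simp
qed

text \<open>The component of the field orthogonal to x bounds the sine of the angle, the sign
  selection excludes the opposite direction, and the component along x then fixes the norm.\<close>

lemma small_field_near:
  assumes x: "x \<in> V" "x \<noteq> 0" and sel: "f x \<le> f (- x)" and small: "norm (field w x) \<le> grad_tol * norm w"
  shows "norm (x - w) \<le> radius * norm w"
proof -
  define r R c where rR: "r = norm x" "R = norm w" "c = cosine x w"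
  have pos: "0 < r" "0 < R" using x w by (auto simp: rR)
  have "grad_tol * R \<le> 1 * R" using tol_bounds pos by (intro mult_right_mono) auto
  then have r2: "r \<le> 2 * R" using field_norm_ge(2)[OF x(2)] small by (simp add: rR)
  have c: "-1/2 \<le> c" "c \<le> 1" "\<bar>c\<bar> \<le> 1"
    using cosine_not_opposite[OF x sel] r2 cosine_bound[of x w] by (auto simp: rR abs_le_iff)
  define b where "b = net_slope d c"
  have b: "1 / (30 * D ^ 9) \<le> b" using net_slope_lower[OF c(1,2) depth] by (simp add: b_def D_def)
  have c2: "0 \<le> 1 - c\<^sup>2" using c by (simp add: abs_square_le_1)
  have "(R / (30 * D ^ 9))\<^sup>2 * (1 - c\<^sup>2) \<le> (R * b)\<^sup>2 * (1 - c\<^sup>2)"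
    using b pos D_pow_pos[of 9] mult_left_mono[OF b, of R] c2 by (intro mult_right_mono power_mono) auto
  also have "\<dots> \<le> (norm (field w x))\<^sup>2" using field_orthogonal[OF x(2)] by (simp add: rR b_def)
  also have "\<dots> \<le> (grad_tol * R)\<^sup>2" using small by (intro power_mono) (auto simp: rR)
  also have "\<dots> = (R / (30 * D ^ 9))\<^sup>2 * (30 * D ^ 9 * grad_tol)\<^sup>2"
    using D_pow_pos[of 9] by (simp add: power_mult_distrib power_divide)
  finally have "1 - c\<^sup>2 \<le> (30 * D ^ 9 * grad_tol)\<^sup>2" using pos D_pow_pos[of 9] by simp
  also have "30 * D ^ 9 * grad_tol = 3/10 * radius"
    using D_ge power_add[of D 9 2] by (simp add: grad_tol_def radius_def field_simps)
  finally have "1 - c\<^sup>2 \<le> 9/100 * radius\<^sup>2" by (simp add: power_mult_distrib power_divide)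
  \<comment> \<open>Since 1 + c \<ge> 1/2, a small sine forces c close to 1.\<close>
  moreover have "(1/2) * (1 - c) \<le> 1 - c\<^sup>2"
  proof -
    have "(1/2) * (1 - c) \<le> (1 + c) * (1 - c)" using c by (intro mult_right_mono) auto
    also have "\<dots> = 1 - c\<^sup>2" by (simp add: power2_eq_square algebra_simps)
    finally show ?thesis .
  qed
  ultimately have "(1/2) * (1 - c) \<le> 9/100 * radius\<^sup>2" by (rule order_trans[rotated])
  then have c1: "1 - c \<le> 18/100 * radius\<^sup>2" by simp
  have rad: "radius\<^sup>2 \<le> radius / 18"
    using tol_bounds mult_right_mono[of radius "1/18" radius] by (simp add: power2_eq_square)
  define P where "P = net_kernel d c"
  have P: "c \<le> P" "P \<le> 1" using net_kernel_bounds[OF c(3) depth] by (auto simp: P_def)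
  have "\<bar>r - R * P\<bar> \<le> radius / 100 * R"
  proof -
    have "\<bar>r - R * P\<bar> \<le> grad_tol * R" using field_norm_ge(1)[OF x(2)] small by (simp add: rR P_def)
    also have "\<dots> \<le> radius / 100 * R" using tol_bounds(3) pos by (intro mult_right_mono) auto
    finally show ?thesis .
  qed
  moreover have "R * (1 - P) \<le> R * (radius / 100)" using P c1 rad pos by (intro mult_left_mono) auto
  moreover have "0 \<le> R * (1 - P)" using P pos by simp
  moreover have "\<bar>r - R\<bar> \<le> \<bar>r - R * P\<bar> + \<bar>R * (1 - P)\<bar>"
    using abs_triangle_ineq4[of "r - R * P" "R * (1 - P)"] by (simp add: algebra_simps)
  ultimately have "\<bar>r - R\<bar> \<le> radius / 50 * R" by (simp add: mult.commute[of radius R])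
  then have 1: "(r - R)\<^sup>2 \<le> (radius / 50 * R)\<^sup>2" using power_mono[of "\<bar>r - R\<bar>" _ 2] by simp
  have "r * R * (1 - c) \<le> (2 * R * R) * (18/100 * radius\<^sup>2)"
    using r2 c1 pos c by (intro mult_mono) auto
  then have "(norm (x - w))\<^sup>2 \<le> (radius / 50 * R)\<^sup>2 + 2 * ((2 * R * R) * (18/100 * radius\<^sup>2))"
    using 1 norm_diff_sq[of x] by (simp add: rR)
  also have "\<dots> \<le> (radius * R)\<^sup>2"
    using zero_le_power2[of "radius * R"] by (simp add: power2_eq_square algebra_simps)
  finally show ?thesis unfolding rR(2) by (rule power2_le_imp_le) (use tol_bounds in simp)
qed

text \<open>The permitted number of iterations is proportional to the initial objective, so a run
  that starts far away needs this floor to pay for its contraction phase.\<close>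

lemma objective_far:
  assumes x: "x \<in> V" "x \<noteq> 0" and far: "radius * norm w < norm (x - w)"
  shows "(norm w)\<^sup>2 / (10 ^ 15 * D ^ 13) \<le> f x"
proof -
  define r R c u where rR: "r = norm x" "R = norm w" "c = cosine x w" "u = norm (x - w)"
  have pos: "0 < r" "0 < R" "0 \<le> u" using x w by (auto simp: rR)
  have c: "\<bar>c\<bar> \<le> 1" by (simp add: rR cosine_bound)
  have ww: "cosine w w = 1" using w by (simp add: cosine_def power2_norm_eq_inner[symmetric] power2_eq_square)
  \<comment> \<open>The value at 0 is eliminated by the uniform bound at the target itself, where
    the objective is nonnegative.\<close>
  have "0 \<le> f w" by (simp add: obj_def)
  then have "R\<^sup>2 / 2 - 2 * (E * (R * R)) \<le> f 0"
    using uniform_bound[OF w] by (simp add: ww rR[symmetric] abs_le_iff power2_eq_square algebra_simps)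
  moreover have "r\<^sup>2/2 - r * R * net_kernel d c - E * ((r + R) * r) \<le> f x - f 0"
    using uniform_bound[OF x] by (simp add: rR abs_le_iff mult.assoc)
  ultimately have 1: "r\<^sup>2/2 + R\<^sup>2/2 - r * R * net_kernel d c - E * ((r + R) * r + 2 * (R * R)) \<le> f x"
    by (simp add: algebra_simps)
  define k where "k = 1 / (60 * D ^ 9)"
  have k: "0 < k" "k \<le> 1" using D_pow_pos[of 9] one_le_power[OF D_sq(1), of 9] by (auto simp: k_def field_simps)
  have "k * (1 - c) \<le> 1 - net_kernel d c" using net_kernel_deficit[OF c depth] by (simp add: k_def D_def)
  then have rk: "r * R * (k * (1 - c)) \<le> r * R * (1 - net_kernel d c)" using pos by (intro mult_left_mono) auto
  have "k * ((r - R)\<^sup>2 / 2) \<le> 1 * ((r - R)\<^sup>2 / 2)" using k by (intro mult_right_mono) auto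
  then have "k * ((r - R)\<^sup>2 / 2 + r * R * (1 - c)) \<le> r\<^sup>2/2 + R\<^sup>2/2 - r * R * net_kernel d c"
  proof -
    have "k * ((r - R)\<^sup>2 / 2 + r * R * (1 - c)) = k * ((r - R)\<^sup>2 / 2) + r * R * (k * (1 - c))"
      by (simp add: algebra_simps)
    moreover have "r\<^sup>2/2 + R\<^sup>2/2 - r * R * net_kernel d c = (r - R)\<^sup>2 / 2 + r * R * (1 - net_kernel d c)"
      by (simp add: power2_diff add_divide_distrib diff_divide_distrib algebra_simps)
    ultimately show ?thesis
      using rk \<open>k * ((r - R)\<^sup>2 / 2) \<le> 1 * ((r - R)\<^sup>2 / 2)\<close> by linarith
  qed
  moreover have "u\<^sup>2 / 2 = (r - R)\<^sup>2 / 2 + r * R * (1 - c)" using norm_diff_sq[of x] by (simp add: rR)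
  ultimately have "k * (u\<^sup>2 / 2) \<le> r\<^sup>2/2 + R\<^sup>2/2 - r * R * net_kernel d c" by (simp only:)
  then have 2: "k * u\<^sup>2 / 2 \<le> r\<^sup>2/2 + R\<^sup>2/2 - r * R * net_kernel d c" by simp
  have ru: "r \<le> R + u" using norm_triangle_ineq2[of x w] by (simp add: rR)
  define l where "l = 1 / radius"
  have l: "0 < l" "l = 10 ^ 6 * D\<^sup>2" using tol_bounds by (auto simp: l_def radius_def)
  have l1: "1 \<le> l" using l D_sq by simp
  have Ru: "R \<le> l * u" using far tol_bounds by (simp add: rR l_def field_simps)
  have ul: "u \<le> l * u" using mult_right_mono[OF l1 pos(3)] by simp
  have "(r + R) * r + 2 * (R * R) \<le> (3 * (l * u)) * (2 * (l * u)) + 2 * ((l * u) * (l * u))"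
    using ru Ru ul pos l by (intro add_mono mult_mono mult_left_mono) auto
  also have "\<dots> = 8 * l\<^sup>2 * u\<^sup>2" by (simp add: power2_eq_square)
  finally have "E * ((r + R) * r + 2 * (R * R)) \<le> E * (8 * l\<^sup>2 * u\<^sup>2)" using E_pos by (intro mult_left_mono) auto
  also have "E * (8 * l\<^sup>2 * u\<^sup>2) = (8 * E * l\<^sup>2) * u\<^sup>2" by simp
  also have "\<dots> \<le> (k / 4) * u\<^sup>2"
  proof (rule mult_right_mono)
    have "D ^ 13 = D ^ 9 * (D\<^sup>2)\<^sup>2" by (simp flip: power_mult power_add)
    then show "8 * E * l\<^sup>2 \<le> k / 4" using E_small[of 13] D_pow_pos[of 9]
      by (simp add: l(2) k_def field_simps power_mult_distrib)
  qed simp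
  finally have "k / 4 * u\<^sup>2 \<le> f x" using 1 2 by simp
  moreover have "k / 4 * (radius * R)\<^sup>2 \<le> k / 4 * u\<^sup>2"
    using far tol_bounds pos k by (intro mult_left_mono power_mono) (auto simp: rR)
  moreover have "R\<^sup>2 / (10 ^ 15 * D ^ 13) \<le> k / 4 * (radius * R)\<^sup>2"
  proof -
    have e: "D ^ 13 = D ^ 9 * (D\<^sup>2)\<^sup>2" by (simp flip: power_mult power_add)
    have "0 \<le> R\<^sup>2 / D ^ 13" using D_pow_pos[of 13] by simp
    moreover have "k / 4 * (radius * R)\<^sup>2 = R\<^sup>2 / D ^ 13 * (1 / (240 * 10 ^ 12))"
      unfolding e by (simp add: k_def radius_def power_mult_distrib power_divide)
    moreover have "R\<^sup>2 / (10 ^ 15 * D ^ 13) = R\<^sup>2 / D ^ 13 * (1 / 10 ^ 15)" by simp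
    ultimately show ?thesis by (simp only: mult_left_mono) (auto intro!: mult_left_mono)
  qed
  ultimately show ?thesis by (simp add: rR)
qed

section \<open>Contraction near the target\<close>

text \<open>Error per layer near the target; the factor 150 brings the accumulated error 5 (d + 1)
  \<open>loc_tol\<close> down to 1/20.\<close>

definition loc_tol :: real where "loc_tol = 1 / (150 * D)"

lemma loc_tol_props:
  "\<epsilon> + sqrt (16 * (2 * radius) + 4 * \<epsilon>) \<le> loc_tol" "20 * (real d + 1) * loc_tol \<le> 1"
  "5 * (real d + 1) * loc_tol \<le> 1/20" "2 * radius \<le> 1/2"
proof -
  have D0: "0 < D" using D_ge by simp
  have q: "0 \<le> sqrt \<epsilon>" "sqrt \<epsilon> * D ^ 2 \<le> 1 / 100000000000000000000" "\<epsilon> \<le> sqrt \<epsilon> / 100"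
  proof -
    have "sqrt \<epsilon> * D ^ 2 \<le> sqrt \<epsilon> * D ^ 40"
      using eps_pos D_ge by (intro mult_left_mono power_increasing) auto
    then show "sqrt \<epsilon> * D ^ 2 \<le> 1 / 100000000000000000000" using sqrt_eps(4) by linarith
  qed (use eps_pos sqrt_eps in auto)
  have "\<epsilon> * D\<^sup>2 \<le> sqrt \<epsilon> / 100 * D\<^sup>2" using q by (intro mult_right_mono) auto
  then have "\<epsilon> * D\<^sup>2 \<le> 1 / 10 ^ 10" using q(2) by simp
  then have e2: "\<epsilon> \<le> 1 / (10 ^ 10 * D\<^sup>2)" using D_pow_pos[of 2] by (simp add: field_simps)
  have "1 / (10 ^ 10 * D\<^sup>2) \<le> 1 / (10 ^ 10 * D)" using D_sq D0 by (intro divide_left_mono) auto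
  then have e1: "\<epsilon> \<le> 1 / (10 ^ 10 * D)" using e2 by linarith
  have "16 * (2 * radius) + 4 * \<epsilon> \<le> (64 / (10000 * D))\<^sup>2"
  proof -
    define i where "i = 1 / D\<^sup>2"
    have "0 \<le> i" "\<epsilon> \<le> i / 10 ^ 10" "radius = i / 10 ^ 6" "(64 / (10000 * D))\<^sup>2 = 4096 / 10 ^ 8 * i"
      using e2 by (simp_all add: i_def radius_def power_divide power_mult_distrib)
    then show ?thesis by simp
  qed
  then have "sqrt (16 * (2 * radius) + 4 * \<epsilon>) \<le> 64 / (10000 * D)" using D0 by (intro real_le_lsqrt) auto
  then have "\<epsilon> + sqrt (16 * (2 * radius) + 4 * \<epsilon>) \<le> 1 / (10 ^ 10 * D) + 64 / (10000 * D)" using e1 by linarith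
  also have "\<dots> \<le> loc_tol" using D0 by (simp add: loc_tol_def field_simps)
  finally show "\<epsilon> + sqrt (16 * (2 * radius) + 4 * \<epsilon>) \<le> loc_tol" .
  have "(D + 1) * loc_tol \<le> (3/2 * D) * loc_tol" using D_ge by (intro mult_right_mono) (auto simp: loc_tol_def)
  also have "\<dots> = 1/100" using D0 by (simp add: loc_tol_def)
  finally have "(real d + 1) * loc_tol \<le> 1/100" by (simp add: D_def)
  then show "20 * (real d + 1) * loc_tol \<le> 1" "5 * (real d + 1) * loc_tol \<le> 1/20"
    by (simp_all add: algebra_simps)
  show "2 * radius \<le> 1/2" using tol_bounds by simp
qed

lemma subgradient_local:
  assumes x: "x \<in> V" and near: "norm (x - w) \<le> radius * norm w" and v: "clarke_subgradient V f x v"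
  shows "norm (v - (x - w)) \<le> norm (x - w) / 20 + 6/5 * norm \<eta>"
proof (rule clarke_subgradient_close[OF v subspace_V])
  show "x - w \<in> V" using x w subspace_V by (simp add: subspace_diff)
  show "0 \<le> norm (x - w) / 20 + 6/5 * norm \<eta>" by simp
  fix u :: 'a and \<xi> :: real assume u: "u \<in> V" and xi: "0 < \<xi>"
  have R: "0 < norm w" using w by simp
  have u1: "0 < norm u + 2" using norm_ge_zero[of u] by linarith
  \<comment> \<open>The first bound fits all terms with \<delta> into \<xi>; the second keeps y, y +
    t u and w within relative distance 2 \<open>radius\<close> of y.\<close>
  define \<delta> where "\<delta> = min (\<xi> / ((norm u + 2) * (norm u + 2))) (radius * norm w / (4 * (norm u + 2)))"
  show "\<exists>\<delta>>0. \<forall>y\<in>V. \<forall>t. norm (y - x) < \<delta> \<and> 0 < t \<and> t < \<delta> \<longrightarrow>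
      f (y + t *\<^sub>R u) - f y \<le> (inner (x - w) u + (norm (x - w) / 20 + 6/5 * norm \<eta>) * norm u + \<xi>) * t"
  proof (intro exI conjI ballI allI impI)
    show "0 < \<delta>" using xi u1 R tol_bounds by (simp add: \<delta>_def)
    fix y t assume y: "y \<in> V" and "norm (y - x) < \<delta> \<and> 0 < t \<and> t < \<delta>"
    then have yx: "norm (y - x) \<le> \<delta>" and t: "0 < t" "t \<le> \<delta>" by auto
    have dl: "\<delta> * ((norm u + 2) * (norm u + 2)) \<le> \<xi>" "\<delta> * (norm u + 2) \<le> radius * norm w / 4" "0 < \<delta>"
    proof -
      have "\<delta> \<le> \<xi> / ((norm u + 2) * (norm u + 2))" "\<delta> \<le> radius * norm w / (4 * (norm u + 2))" by (auto simp: \<delta>_def)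
      then show "\<delta> * ((norm u + 2) * (norm u + 2)) \<le> \<xi>" "\<delta> * (norm u + 2) \<le> radius * norm w / 4"
        using u1 unfolding pos_le_divide_eq[OF mult_pos_pos[OF u1 u1]] by (auto simp: field_simps)
    qed fact
    have "\<delta> * 1 \<le> \<delta> * (norm u + 2)" using dl u1 by (intro mult_left_mono) auto
    then have dr: "\<delta> \<le> radius * norm w / 4" using dl by linarith
    have "radius * norm w \<le> 1/100 * norm w" using tol_bounds R by (intro mult_right_mono) auto
    moreover have yw: "norm (y - w) \<le> norm (x - w) + \<delta>"
      using norm_triangle_ineq[of "y - x" "x - w"] yx by simp
    moreover define q where "q = radius * norm w"
    ultimately have ny: "9/10 * norm w \<le> norm y"
      using norm_triangle_ineq2[of w y] near dr R unfolding norm_minus_commute[of w y] q_def[symmetric]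
      by linarith
    then have y0: "y \<noteq> 0" using R by auto
    have rn: "9/5 * (radius * norm w) \<le> 2 * radius * norm y"
      using mult_left_mono[OF ny, of "2 * radius"] tol_bounds by simp
    have c2: "norm (w - y) \<le> 2 * radius * norm y"
      using yw near dr rn tol_bounds R norm_minus_commute[of w y] mult_pos_pos[OF tol_bounds(4) R] by linarith
    have "t * norm u \<le> \<delta> * (norm u + 2)" using t by (intro mult_mono) auto
    also have "\<dots> \<le> 2 * radius * norm y" using dl rn mult_pos_pos[OF tol_bounds(4) R] by linarith
    finally have c1: "norm ((y + t *\<^sub>R u) - y) \<le> 2 * radius * norm y" using t by simp
    have yu: "y + t *\<^sub>R u \<in> V" using y u subspace_V by (simp add: subspace_add subspace_scale)
    have "f (y + t *\<^sub>R u) - f y \<le> inner (y - w) (t *\<^sub>R u)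
       + (5 * (real d + 1) * loc_tol * norm (y - w) + 6/5 * norm \<eta> + norm (t *\<^sub>R u)) * norm (t *\<^sub>R u)"
      using objective_local_linearization[OF y y0 w(1) yu c1 c2 loc_tol_props(4,1,2), of \<eta>]
      by (simp add: abs_le_iff)
    also have "\<dots> = (inner (y - w) u + (5 * (real d + 1) * loc_tol * norm (y - w) + 6/5 * norm \<eta> + t * norm u) * norm u) * t"
      using t by (simp add: algebra_simps)
    also have "\<dots> \<le> (inner (x - w) u + (norm (x - w) / 20 + 6/5 * norm \<eta>) * norm u + \<xi>) * t"
    proof (rule mult_right_mono)
      have "inner (y - x) u \<le> \<delta> * norm u"
        using order_trans[OF Cauchy_Schwarz_ineq2 mult_right_mono[OF yx norm_ge_zero], of u] by (simp add: abs_le_iff)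
      then have 1: "inner (y - w) u \<le> inner (x - w) u + \<delta> * norm u" by (simp add: inner_diff_left)
      have "5 * (real d + 1) * loc_tol * norm (y - w) \<le> 1/20 * norm (y - w)"
        using loc_tol_props(3) by (intro mult_right_mono) auto
      also have "\<dots> \<le> norm (x - w) / 20 + \<delta>" using yw dl by simp
      finally have "5 * (real d + 1) * loc_tol * norm (y - w) + 6/5 * norm \<eta> + t * norm u
         \<le> (norm (x - w) / 20 + 6/5 * norm \<eta>) + (\<delta> + \<delta> * norm u)"
        using mult_right_mono[OF t(2) norm_ge_zero[of u]] by linarith
      from mult_right_mono[OF this norm_ge_zero[of u]]
      have 2: "(5 * (real d + 1) * loc_tol * norm (y - w) + 6/5 * norm \<eta> + t * norm u) * norm u
         \<le> (norm (x - w) / 20 + 6/5 * norm \<eta>) * norm u + (\<delta> + \<delta> * norm u) * norm u"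
        by (simp only: distrib_right)
      have "\<delta> * norm u + (\<delta> + \<delta> * norm u) * norm u = \<delta> * ((norm u + 2) * norm u)" by (simp add: algebra_simps)
      also have "\<dots> \<le> \<delta> * ((norm u + 2) * (norm u + 2))" using dl u1 by (intro mult_left_mono) auto
      finally have 3: "\<delta> * norm u + (\<delta> + \<delta> * norm u) * norm u \<le> \<xi>" using dl by linarith
      show "inner (y - w) u + (5 * (real d + 1) * loc_tol * norm (y - w) + 6/5 * norm \<eta> + t * norm u) * norm u
        \<le> inner (x - w) u + (norm (x - w) / 20 + 6/5 * norm \<eta>) * norm u + \<xi>"
        using 1 2 3 by linarith
    qed (use t in simp)
    finally show "f (y + t *\<^sub>R u) - f y \<le> (inner (x - w) u + (norm (x - w) / 20 + 6/5 * norm \<eta>) * norm u + \<xi>) * t" .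
  qed
qed

text \<open>The exact gradient x - w would contract by 1 - a. The relative error 1/20 leaves 1 -
  19/20 a, which is rounded to 1 - 7/8 a.\<close>

lemma contraction_step:
  assumes x: "x \<in> V" and near: "norm (x - w) \<le> radius * norm w" and v: "clarke_subgradient V f x v"
    and a: "0 < a" "a \<le> 1"
  shows "norm (x - a *\<^sub>R v - w) \<le> (1 - 7/8 * a) * norm (x - w) + 2 * a * norm \<eta>"
proof -
  have "x - a *\<^sub>R v - w = (1 - a) *\<^sub>R (x - w) - a *\<^sub>R (v - (x - w))" by (simp add: algebra_simps)
  then have "norm (x - a *\<^sub>R v - w) \<le> (1 - a) * norm (x - w) + a * norm (v - (x - w))"
    using norm_triangle_ineq4[of "(1 - a) *\<^sub>R (x - w)" "a *\<^sub>R (v - (x - w))"] a by simp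
  also have "\<dots> \<le> (1 - a) * norm (x - w) + a * (norm (x - w) / 20 + 6/5 * norm \<eta>)"
    using subgradient_local[OF x near v] a by (intro add_left_mono mult_left_mono) auto
  also have "(1 - a) * norm (x - w) + a * (norm (x - w) / 20 + 6/5 * norm \<eta>)
     = (1 - 7/8 * a) * norm (x - w) + 2 * a * norm \<eta> - (3/40 * (a * norm (x - w)) + 4/5 * (a * norm \<eta>))"
    by (simp add: algebra_simps)
  also have "\<dots> \<le> (1 - 7/8 * a) * norm (x - w) + 2 * a * norm \<eta>"
    using mult_nonneg_nonneg[OF less_imp_le[OF a(1)] norm_ge_zero[of "x - w"]]
      mult_nonneg_nonneg[OF less_imp_le[OF a(1)] norm_ge_zero[of \<eta>]] by linarith
  finally show ?thesis .
qed

lemma contraction_stays: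
  assumes "0 < a" "a \<le> 1" "b \<le> radius * norm w"
  shows "(1 - 7/8 * a) * b + 2 * a * norm \<eta> \<le> radius * norm w"
proof -
  have "2 * norm \<eta> \<le> 2 * (E * norm w)" using noise_le norm_ge_zero[of \<eta>] by linarith
  also have "2 * (E * norm w) = (2 * E) * norm w" by simp
  also have "\<dots> \<le> (7/8 * radius) * norm w" using tol_bounds by (intro mult_right_mono) auto
  finally have "a * (2 * norm \<eta>) \<le> a * ((7/8 * radius) * norm w)" using assms by (intro mult_left_mono) auto
  moreover have "(1 - 7/8 * a) * b \<le> (1 - 7/8 * a) * (radius * norm w)" using assms by (intro mult_left_mono) auto
  ultimately show ?thesis by (simp add: algebra_simps)
qed

text \<open>Near the target the cosine is at least 1/2, so the gap of the profile exceeds the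
  uniform error and the sign selection keeps x; the method is then a plain contraction.\<close>

lemma no_flip_near:
  assumes x: "x \<in> V" and near: "norm (x - w) \<le> radius * norm w"
  shows "f x \<le> f (- x)"
proof -
  define r R s where rR: "r = norm x" "R = norm w" "s = cosine x w"
  have R: "0 < R" using w by (simp add: rR)
  have "radius * R \<le> 1/100 * R" using tol_bounds R by (intro mult_right_mono) auto
  then have xw: "norm (x - w) \<le> 1/100 * R" using near by (simp add: rR)
  have r: "99/100 * R \<le> r" "r \<le> 101/100 * R"
    using xw norm_triangle_ineq2[of x w] norm_triangle_ineq2[of w x] by (auto simp: rR norm_minus_commute)
  then have r0: "0 < r" and x0: "x \<noteq> 0" using R by (auto simp: rR)
  have "inner (w - x) w \<le> 1/100 * R * R"
  proof -
    have "inner (w - x) w \<le> \<bar>inner (x - w) w\<bar>" by (simp add: inner_diff_left)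
    also have "\<dots> \<le> norm (x - w) * norm w" by (rule Cauchy_Schwarz_ineq2)
    also have "\<dots> \<le> 1/100 * R * R" using mult_right_mono[OF xw norm_ge_zero[of w]] by (simp add: rR)
    finally show ?thesis .
  qed
  then have "99/100 * (R * R) \<le> r * R * s"
    using inner_eq_cosine[of x w] by (simp add: inner_diff_left rR power2_norm_eq_inner[symmetric] power2_eq_square)
  then have "99/100 * R * R \<le> (r * s) * R" by (simp add: mult_ac)
  then have rs: "99/100 * R \<le> r * s" using R by (simp only: mult_le_cancel_right_pos)
  have s: "1/2 \<le> s"
  proof (rule ccontr)
    assume "\<not> 1/2 \<le> s"
    then have "r * s \<le> r * (1/2)" using r0 by (intro mult_left_mono) auto
    then show False using rs r R by linarith
  qed
  have s1: "s \<le> 1" using cosine_bound[of x w] by (simp add: rR abs_le_iff)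
  have xm: "- x \<in> V" "- x \<noteq> 0" using x x0 subspace_V by (auto simp: subspace_neg)
  have 1: "f x - f 0 \<le> r\<^sup>2/2 - r * R * net_kernel d s + E * (r + R) * r"
    "f (- x) - f 0 \<ge> r\<^sup>2/2 - r * R * net_kernel d (- s) - E * (r + R) * r"
    using uniform_bound[OF x x0] uniform_bound[OF xm] by (simp_all add: rR cosine_minus_left abs_le_iff)
  have "(1/2) / (10 * D ^ 9) \<le> s / (10 * D ^ 9)" using s D_pow_pos[of 9] by (intro divide_right_mono) auto
  also have "\<dots> \<le> net_kernel d s - net_kernel d (- s)"
    unfolding D_def using s s1 depth by (intro net_kernel_gap) auto
  finally have "(1/2) / (10 * D ^ 9) \<le> net_kernel d s - net_kernel d (- s)" .
  moreover have "6 * E \<le> (1/2) / (10 * D ^ 9)" using E_small[of 9] D_pow_pos[of 9] by (simp add: field_simps)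
  ultimately have "6 * E \<le> net_kernel d s - net_kernel d (- s)" by (rule order_trans[rotated])
  then have "r * R * (6 * E) \<le> r * R * (net_kernel d s - net_kernel d (- s))" using r0 R by (intro mult_left_mono) auto
  moreover have "2 * (E * (r + R) * r) \<le> 2 * (E * (3 * R) * r)"
    using r E_pos r0 R by (intro mult_left_mono mult_right_mono) auto
  moreover have "2 * (E * (3 * R) * r) = r * R * (6 * E)" by simp
  moreover have "r * R * (net_kernel d s - net_kernel d (- s)) = r * R * net_kernel d s - r * R * net_kernel d (- s)"
    by (simp add: algebra_simps)
  ultimately show ?thesis using 1 by linarith
qed

text \<open>The alternative in the second claim avoids squaring a lower bound that may be
  negative.\<close>

lemma near_bounds:
  assumes x: "x \<in> V" and near: "norm (x - w) \<le> radius * norm w"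
  shows "norm (G d x - G d w) \<le> 6/5 * norm (x - w)"
    "(4/5 * norm (x - w) - norm \<eta>)\<^sup>2 / 2 \<le> f x \<or> 4/5 * norm (x - w) < norm \<eta>"
proof -
  have c: "norm (x - w) \<le> 2 * radius * norm w"
    using near mult_pos_pos[OF tol_bounds(4), of "norm w"] w by simp
  show "norm (G d x - G d w) \<le> 6/5 * norm (x - w)"
    by (rule G_local_bounds(1)[OF w x c loc_tol_props(4,1,2)]) simp
  have "4/5 * norm (x - w) \<le> norm (G (Suc d) x - G (Suc d) w)"
    by (rule G_local_bounds(2)[OF w x c loc_tol_props(4,1,2)])
  also have "\<dots> - norm \<eta> \<le> norm (G (Suc d) x - G (Suc d) w - \<eta>)" by (rule norm_triangle_ineq2)
  finally have "4/5 * norm (x - w) - norm \<eta> \<le> norm (G (Suc d) x - G (Suc d) w - \<eta>)" by simp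
  then show "(4/5 * norm (x - w) - norm \<eta>)\<^sup>2 / 2 \<le> f x \<or> 4/5 * norm (x - w) < norm \<eta>"
    by (cases "4/5 * norm (x - w) < norm \<eta>") (auto simp: obj_def intro!: divide_right_mono power_mono)
qed

end

section \<open>Counting iterations\<close>

text \<open>Bernoulli's inequality replaces exponential decay by 1 / (1 + k x). The resulting
  iteration counts contain no logarithm, and the budget can afford them.\<close>

lemma power_one_minus_le: "0 \<le> x \<Longrightarrow> x \<le> 1 \<Longrightarrow> (1 - x) ^ k * (1 + real k * x) \<le> 1" for x :: real
proof -
  assume x: "0 \<le> x" "x \<le> 1"
  have "(1 - x) ^ k * (1 + real k * x) \<le> (1 - x) ^ k * (1 + x) ^ k"
    using x by (intro mult_left_mono Bernoulli_inequality) auto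
  also have "\<dots> = (1 - x\<^sup>2) ^ k" by (simp add: power_mult_distrib[symmetric] power2_eq_square algebra_simps)
  also have "\<dots> \<le> 1" using x by (intro power_le_one) (auto simp: power_le_one)
  finally show ?thesis .
qed

text \<open>Here \<alpha> stands for the original step size divided by 2 ^ d. The constant e is the
  concentration constant of the final bounds, kept apart from \<epsilon>, which is 33 times larger
  in the application.\<close>

locale descent_run = descent +
  fixes \<alpha> :: real and xs :: "nat \<Rightarrow> 'a" and e :: real
  assumes start: "xs 0 \<in> V" "xs 0 \<noteq> 0"
    and step: "\<exists>v. clarke_subgradient V f (if f (- xs t) < f (xs t) then - xs t else xs t) v \<and>
      xs (Suc t) = (if f (- xs t) < f (xs t) then - xs t else xs t) - \<alpha> *\<^sub>R v"
    and alpha: "0 < \<alpha>" "\<alpha> \<le> 1 / (real d)\<^sup>2"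
    and e_bounds: "0 < e" "e \<le> \<epsilon>"
begin

definition flip :: "nat \<Rightarrow> 'a" where
  "flip t = (if f (- xs t) < f (xs t) then - xs t else xs t)"

lemma alpha_le: "\<alpha> \<le> 1/4" "\<alpha> \<le> 1"
proof -
  have "2\<^sup>2 \<le> D\<^sup>2" using D_ge by (intro power_mono) auto
  then have "1 / D\<^sup>2 \<le> 1 / 4" by (intro divide_left_mono) auto
  then show "\<alpha> \<le> 1/4" using alpha(2) unfolding D_def by (rule order_trans[rotated])
  then show "\<alpha> \<le> 1" by simp
qed

lemma flip_step: obtains v where "clarke_subgradient V f (flip t) v" "xs (Suc t) = flip t - \<alpha> *\<^sub>R v"
  using step[of t] unfolding flip_def by blast

lemma iterates: "xs t \<in> V \<and> xs t \<noteq> 0"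
proof (induction t)
  case (Suc t)
  then have b: "flip t \<in> V" "flip t \<noteq> 0" using subspace_V by (auto simp: flip_def subspace_neg)
  obtain v where v: "clarke_subgradient V f (flip t) v" "xs (Suc t) = flip t - \<alpha> *\<^sub>R v" by (rule flip_step)
  have "v \<in> V" using v by (simp add: clarke_subgradient_def)
  then have "xs (Suc t) \<in> V" using b v subspace_V by (simp add: subspace_diff subspace_scale)
  moreover have "norm (flip t) / 2 \<le> norm (xs (Suc t))"
    unfolding v(2) using alpha alpha_le by (intro step_norm_lower[OF b v(1)]) auto
  then have "xs (Suc t) \<noteq> 0" using b by auto
  ultimately show ?case by simp
qed (simp add: start)

lemma flip_props: "flip t \<in> V" "flip t \<noteq> 0" "f (flip t) \<le> f (xs t)" "f (flip t) \<le> f (- flip t)"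
  using iterates[of t] subspace_V by (auto simp: flip_def subspace_neg)

lemma flip_near: "norm (xs t - w) \<le> radius * norm w \<Longrightarrow> flip t = xs t"
  using no_flip_near[of "xs t"] iterates[of t] by (simp add: flip_def)

lemma near_step:
  assumes "norm (flip t - w) \<le> radius * norm w"
  shows "norm (xs (Suc t) - w) \<le> (1 - 7/8 * \<alpha>) * norm (flip t - w) + 2 * \<alpha> * norm \<eta>"
    "norm (xs (Suc t) - w) \<le> radius * norm w"
proof -
  obtain v where v: "clarke_subgradient V f (flip t) v" "xs (Suc t) = flip t - \<alpha> *\<^sub>R v" by (rule flip_step)
  show 1: "norm (xs (Suc t) - w) \<le> (1 - 7/8 * \<alpha>) * norm (flip t - w) + 2 * \<alpha> * norm \<eta>"
    unfolding v(2) by (rule contraction_step[OF flip_props(1) assms v(1) alpha(1) alpha_le(2)])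
  then show "norm (xs (Suc t) - w) \<le> radius * norm w"
    using contraction_stays[OF alpha(1) alpha_le(2) assms] by linarith
qed

text \<open>Iterates in the ball are not flipped, so the contraction steps compose; the noise terms
  form a geometric series with sum at most 2 \<alpha> / (7/8 \<alpha>) = 16/7.\<close>

lemma tail:
  assumes "norm (xs N - w) \<le> radius * norm w"
  shows "norm (xs (N + k) - w) \<le> radius * norm w \<and>
    norm (xs (N + k) - w) \<le> (1 - 7/8 * \<alpha>) ^ k * norm (xs N - w) + 16/7 * norm \<eta>"
proof (induction k)
  case (Suc k)
  let ?t = "1 - 7/8 * \<alpha>"
  have near: "norm (flip (N + k) - w) \<le> radius * norm w" and fl: "flip (N + k) = xs (N + k)"
    using Suc flip_near[of "N + k"] by auto
  have "norm (xs (Suc (N + k)) - w) \<le> ?t * norm (xs (N + k) - w) + 2 * \<alpha> * norm \<eta>"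
    using near_step(1)[OF near] by (simp add: fl)
  also have "?t * norm (xs (N + k) - w) \<le> ?t * (?t ^ k * norm (xs N - w) + 16/7 * norm \<eta>)"
    using Suc alpha_le by (intro mult_left_mono) auto
  finally have "norm (xs (Suc (N + k)) - w) \<le> ?t * (?t ^ k * norm (xs N - w) + 16/7 * norm \<eta>) + 2 * \<alpha> * norm \<eta>"
    by simp
  note nn = this
  have "norm (xs (Suc (N + k)) - w) \<le> ?t ^ Suc k * norm (xs N - w) + 16/7 * norm \<eta>"
  proof -
    have "?t * (?t ^ k * norm (xs N - w) + 16/7 * norm \<eta>) + 2 * \<alpha> * norm \<eta>
        = ?t ^ Suc k * norm (xs N - w) + 16/7 * norm \<eta>" by (simp add: field_simps)
    then show ?thesis using nn by simp
  qed
  then show ?case using near_step(2)[OF near] by simp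
qed (use assms in simp)

section \<open>Length of the two phases\<close>

definition target :: real where
  "target = D ^ 12 * sqrt e * norm w + 3 * D ^ 9 * norm \<eta>"

text \<open>k steps shrink the distance by 1 / (1 + 7/8 k \<alpha>), which reaches the first term of
  \<open>target\<close>; the remaining noise 16/7 is below 3 D^9.\<close>

lemma target_after:
  assumes near: "norm (xs N - w) \<le> radius * norm w"
    and k: "8/7 * norm (xs N - w) / (\<alpha> * (D ^ 12 * sqrt e * norm w)) \<le> real k"
  shows "norm (xs (N + k) - w) \<le> target"
proof -
  define B P x where BPx: "B = norm (xs N - w)" "P = D ^ 12 * sqrt e * norm w" "x = 7/8 * \<alpha>"
  have P: "0 < P" using D_pow_pos[of 12] e_bounds w by (simp add: BPx)
  have x: "0 < x" "x \<le> 1" using alpha alpha_le by (auto simp: BPx)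
  have "8/7 * B / (\<alpha> * P) \<le> real k" using k by (simp only: BPx)
  then have "8/7 * B \<le> real k * (\<alpha> * P)" using alpha P by (simp only: pos_divide_le_eq mult_pos_pos)
  then have "B \<le> P * (real k * x)" by (simp add: BPx(3) mult_ac)
  also have "\<dots> \<le> P * (1 + real k * x)" using P by simp
  finally have "(1 - x) ^ k * B \<le> (1 - x) ^ k * (P * (1 + real k * x))" using x by (intro mult_left_mono) auto
  also have "\<dots> = P * ((1 - x) ^ k * (1 + real k * x))" by simp
  also have "\<dots> \<le> P * 1" using power_one_minus_le[of x k] x P by (intro mult_left_mono) auto
  finally have 1: "(1 - x) ^ k * B \<le> P" by simp
  have "(16/7) * norm \<eta> \<le> (3 * D ^ 9) * norm \<eta>"
    using one_le_power[OF D_sq(1), of 9] by (intro mult_right_mono) auto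
  then show ?thesis using tail[OF near, of k] 1 by (simp add: BPx target_def)
qed

definition budget :: real where
  "budget = f (xs 0) / (D ^ 6 * \<alpha> * e * (norm w)\<^sup>2)"

lemma e_small: "sqrt e * D ^ 40 \<le> 1 / 100000000000000000000" "0 < sqrt e" "sqrt e * sqrt e = e"
proof -
  have "sqrt e * D ^ 40 \<le> sqrt \<epsilon> * D ^ 40"
    using e_bounds D_pow_pos[of 40] by (intro mult_right_mono) auto
  then show "sqrt e * D ^ 40 \<le> 1 / 100000000000000000000" using sqrt_eps(4) by (rule order_trans)
qed (use e_bounds in auto)

text \<open>A start near the target may have a tiny objective and budget, but if
  \<open>target\<close> is not met yet, the objective is at least 3/10 B^2. The budget is then
  quadratic in \<beta> = B / P, while the contraction count is linear in it.\<close>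

lemma near_start:
  assumes near: "norm (xs 0 - w) \<le> radius * norm w"
  shows "\<exists>N. real N \<le> budget \<and> norm (xs N - w) \<le> target \<and> norm (xs N - w) \<le> radius * norm w"
proof (cases "norm (xs 0 - w) \<le> target")
  case True
  have "0 \<le> budget" using e_bounds alpha D_pow_pos[of 6] by (simp add: budget_def obj_def)
  then show ?thesis using True near by (intro exI[of _ 0]) simp
next
  case False
  define B P \<beta> where BP: "B = norm (xs 0 - w)" "P = D ^ 12 * sqrt e * norm w" "\<beta> = B / P"
  have R: "0 < norm w" using w by simp
  have P: "0 < P" using D_pow_pos[of 12] e_small w by (simp add: BP)
  have D9: "512 \<le> D ^ 9" "2 ^ 18 \<le> D ^ 18" using power_mono[of 2 D 9] power_mono[of 2 D 18] D_ge by auto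
  have "B > P" and eta: "3 * D ^ 9 * norm \<eta> < B"
  proof -
    have "P + 3 * D ^ 9 * norm \<eta> < B" using False by (simp add: BP target_def)
    moreover have "0 \<le> 3 * D ^ 9 * norm \<eta>" using D_pow_pos[of 9] by (intro mult_nonneg_nonneg) auto
    ultimately show "B > P" "3 * D ^ 9 * norm \<eta> < B" using P by linarith+
  qed
  then have b: "1 < \<beta>" using P by (simp add: BP(3))
  have "1536 * norm \<eta> \<le> 3 * D ^ 9 * norm \<eta>" using D9 by (intro mult_right_mono) auto
  then have "1536 * norm \<eta> \<le> B" using eta by linarith
  then have "79/100 * B \<le> 4/5 * B - norm \<eta>" "\<not> 4/5 * B < norm \<eta>" using P \<open>B > P\<close> by auto
  then have "(79/100 * B)\<^sup>2 / 2 \<le> (4/5 * B - norm \<eta>)\<^sup>2 / 2"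
    using P \<open>B > P\<close> by (intro divide_right_mono power_mono) auto
  also have "\<dots> \<le> f (xs 0)" using near_bounds(2)[OF _ near] start \<open>\<not> 4/5 * B < norm \<eta>\<close> by (simp add: BP)
  finally have "(79/100 * B)\<^sup>2 / 2 \<le> f (xs 0)" .
  moreover have "3/10 * B\<^sup>2 \<le> (79/100 * B)\<^sup>2 / 2" by (simp add: power_mult_distrib power_divide)
  ultimately have "3/10 * B\<^sup>2 \<le> f (xs 0)" by (rule order_trans[rotated])
  then have "3/10 * B\<^sup>2 / (D ^ 6 * \<alpha> * e * (norm w)\<^sup>2) \<le> budget"
    unfolding budget_def using e_bounds alpha D_pow_pos[of 6] by (intro divide_right_mono) auto
  also have "3/10 * B\<^sup>2 / (D ^ 6 * \<alpha> * e * (norm w)\<^sup>2) = 3/10 * \<beta>\<^sup>2 * D ^ 18 / \<alpha>"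
  proof -
    have "P\<^sup>2 = (D ^ 12 * D ^ 12) * (sqrt e * sqrt e) * (norm w)\<^sup>2"
      by (simp only: BP power2_eq_square mult_ac)
    moreover have "D ^ 12 * D ^ 12 = D ^ 18 * D ^ 6" by (simp flip: power_add)
    ultimately have P2: "P\<^sup>2 = D ^ 18 * (D ^ 6 * e * (norm w)\<^sup>2)"
      unfolding e_small(3) by (simp only: mult_ac)
    have "B = \<beta> * P" using P by (simp add: BP(3))
    then have "B\<^sup>2 = \<beta>\<^sup>2 * D ^ 18 * (D ^ 6 * e * (norm w)\<^sup>2)" using P2 by (simp add: power_mult_distrib)
    then have "3/10 * B\<^sup>2 / (D ^ 6 * \<alpha> * e * (norm w)\<^sup>2)
        = (3/10 * \<beta>\<^sup>2 * D ^ 18) * (D ^ 6 * e * (norm w)\<^sup>2) / (\<alpha> * (D ^ 6 * e * (norm w)\<^sup>2))"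
      by (simp add: mult_ac)
    moreover have "D ^ 6 * e * (norm w)\<^sup>2 \<noteq> 0" using D_pow_pos[of 6] e_bounds R by simp
    ultimately show ?thesis by (metis mult_divide_mult_cancel_right)
  qed
  finally have bud: "3/10 * \<beta>\<^sup>2 * D ^ 18 / \<alpha> \<le> budget" .
  define k where "k = nat \<lceil>8/7 * \<beta> / \<alpha>\<rceil>"
  have k: "8/7 * \<beta> / \<alpha> \<le> real k" "real k \<le> 8/7 * \<beta> / \<alpha> + 1"
  proof -
    have "0 \<le> 8/7 * \<beta> / \<alpha>" using b alpha by simp
    then show "8/7 * \<beta> / \<alpha> \<le> real k" "real k \<le> 8/7 * \<beta> / \<alpha> + 1" unfolding k_def by linarith+
  qed
  have "1 * 1 \<le> \<beta> / \<alpha>" using b alpha alpha_le by (simp add: field_simps)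
  then have "real k \<le> 3 * (\<beta> / \<alpha>)" using k(2) by simp
  also have "\<dots> = 3 * \<beta> / \<alpha>" by simp
  also have "\<dots> \<le> 3/10 * \<beta>\<^sup>2 * D ^ 18 / \<alpha>"
  proof (rule divide_right_mono)
    have "3 * (\<beta> * 1) \<le> (3/10 * D ^ 18) * (\<beta> * \<beta>)"
      using b D9 by (intro mult_mono mult_left_mono) auto
    then show "3 * \<beta> \<le> 3/10 * \<beta>\<^sup>2 * D ^ 18" by (simp add: power2_eq_square mult_ac)
  qed (use alpha in simp)
  finally have "real k \<le> budget" using bud by linarith
  moreover have "norm (xs (0 + k) - w) \<le> target"
  proof (rule target_after[OF near])
    have "8/7 * norm (xs 0 - w) / (\<alpha> * (D ^ 12 * sqrt e * norm w)) = 8/7 * \<beta> / \<alpha>"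
      unfolding BP(2)[symmetric] BP(1)[symmetric] BP(3) by simp
    then show "8/7 * norm (xs 0 - w) / (\<alpha> * (D ^ 12 * sqrt e * norm w)) \<le> real k" using k(1) by simp
  qed
  ultimately show ?thesis using tail[OF near, of k] by (intro exI[of _ k]) simp
qed

lemma small_field_reached:
  shows "\<exists>t. real t \<le> 4 * f (xs 0) / (\<alpha> * (grad_tol * norm w)\<^sup>2) \<and> norm (field w (flip t)) \<le> grad_tol * norm w"
proof (rule ccontr)
  define g where "g = \<alpha> * (grad_tol * norm w)\<^sup>2 / 4"
  have g: "0 < g" using alpha tol_bounds w by (simp add: g_def)
  \<comment> \<open>The negated claim covers the indices up to T, hence T + 1 steps, one more than
    the nonnegative objective can pay for.\<close>
  define T where "T = nat \<lfloor>f (xs 0) / g\<rfloor>"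
  have f0: "0 \<le> f x" for x by (simp add: obj_def)
  have T: "real T \<le> f (xs 0) / g" "f (xs 0) / g < real T + 1"
  proof -
    have "0 \<le> f (xs 0) / g" using f0 g by simp
    then show "real T \<le> f (xs 0) / g" "f (xs 0) / g < real T + 1" unfolding T_def by linarith+
  qed
  assume "\<not> ?thesis"
  then have big: "grad_tol * norm w < norm (field w (flip t))" if "real t \<le> f (xs 0) / g" for t
    using that by (force simp: g_def mult_ac)
  have "t \<le> Suc T \<Longrightarrow> f (xs t) \<le> f (xs 0) - real t * g" for t
  proof (induction t)
    case (Suc t)
    obtain v where v: "clarke_subgradient V f (flip t) v" "xs (Suc t) = flip t - \<alpha> *\<^sub>R v" by (rule flip_step)
    have "real t \<le> real T" using Suc by simp
    then have bt: "grad_tol * norm w < norm (field w (flip t))" using T(1) by (intro big) linarith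
    have "f (xs (Suc t)) \<le> f (flip t) - g"
      unfolding v(2) g_def by (rule descent_step[OF flip_props(1,2) v(1) alpha(1) alpha_le(1) bt])
    also have "\<dots> \<le> f (xs t) - g" using flip_props(3)[of t] by simp
    finally show ?case using Suc by (simp add: algebra_simps)
  qed simp
  from this[of "Suc T"] have "(real T + 1) * g \<le> f (xs 0)" using f0[of "xs (Suc T)"] by (simp add: algebra_simps)
  then show False using T(2) g by (simp add: field_simps)
qed

text \<open>The budget is split into thirds: descent until the field is small, two extra steps for
  the transition and the rounding up, and contraction. The last two thirds rest on the floor of
  \<open>objective_far\<close>.\<close>

lemma far_start:
  assumes far: "radius * norm w < norm (xs 0 - w)"
  shows "\<exists>N. real N \<le> budget \<and> norm (xs N - w) \<le> target \<and> norm (xs N - w) \<le> radius * norm w"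
proof -
  define R where "R = norm w"
  define q where "q = sqrt e"
  have R: "0 < R" using w by (simp add: R_def)
  have q: "0 < q" "q * q = e" "q * D ^ 40 \<le> 1 / 100000000000000000000" using e_small by (auto simp: q_def)
  define F where "F = f (xs 0) / R\<^sup>2"
  have F: "1 / (10 ^ 15 * D ^ 13) \<le> F"
    using objective_far[OF start far] R D_pow_pos[of 13] unfolding F_def R_def[symmetric]
    by (simp add: field_simps)
  have bud: "budget = F / (D ^ 6 * \<alpha> * e)" by (simp add: budget_def F_def R_def mult_ac)
  obtain t where t: "real t \<le> 4 * f (xs 0) / (\<alpha> * (grad_tol * norm w)\<^sup>2)"
    "norm (field w (flip t)) \<le> grad_tol * norm w" using small_field_reached by blast
  have near: "norm (flip t - w) \<le> radius * norm w"
    using small_field_near[OF flip_props(1,2,4) t(2)] .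
  \<comment> \<open>At index t only the sign-corrected point is known to be near w; the iterate
    itself is near after one more step.\<close>
  define N0 where "N0 = Suc t"
  have near0: "norm (xs N0 - w) \<le> radius * norm w" unfolding N0_def by (rule near_step(2)[OF near])
  define y where "y = 8/7 * radius / (\<alpha> * (D ^ 12 * q))"
  define k where "k = nat \<lceil>y\<rceil>"
  have y0: "0 \<le> y" using tol_bounds alpha D_pow_pos[of 12] q by (simp add: y_def)
  have k: "y \<le> real k" "real k \<le> y + 1" using y0 unfolding k_def by linarith+
  have qk: "q * D ^ j \<le> 1 / 100000000000000000000" if "j \<le> 40" for j
  proof -
    have "q * D ^ j \<le> q * D ^ 40" using that q D_sq(1) by (intro mult_left_mono power_increasing) auto
    then show ?thesis using q(3) by linarith
  qed
  have pos: "0 < D ^ j" for j by (rule D_pow_pos)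
  have c: "0 < D ^ 6 * \<alpha> * e" using pos[of 6] alpha e_bounds by simp
  have a1: "real t \<le> budget / 3"
  proof -
    have "4 * f (xs 0) / (\<alpha> * (grad_tol * norm w)\<^sup>2) = (4 * 10 ^ 16 * D ^ 22) * (F / \<alpha>)"
      using R by (simp add: F_def grad_tol_def R_def[symmetric] power_mult_distrib power_divide mult_ac flip: power_mult)
    also have "\<dots> \<le> (1 / (3 * (D ^ 6 * e))) * (F / \<alpha>)"
    proof (rule mult_right_mono)
      have "(q * D ^ 28) * q \<le> (1 / 100000000000000000000) * (1 / 100000000000000000000)"
        using qk[of 28] qk[of 0] q pos[of 28] by (intro mult_mono) auto
      then have "e * D ^ 28 \<le> 1 / 10 ^ 40" by (simp add: q(2)[symmetric] mult_ac)
      then have "12 * 10 ^ 16 * (e * D ^ 28) \<le> 1" by simp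
      moreover have "D ^ 28 = D ^ 22 * D ^ 6" by (simp flip: power_add)
      ultimately have "(4 * 10 ^ 16 * D ^ 22) * (3 * (D ^ 6 * e)) \<le> 1"
        by (simp only: mult_ac)
      then show "4 * 10 ^ 16 * D ^ 22 \<le> 1 / (3 * (D ^ 6 * e))"
        using pos[of 6] e_bounds by (simp add: pos_le_divide_eq)
      have "0 \<le> F" using order_trans[OF _ F] pos[of 13] by simp
      then show "0 \<le> F / \<alpha>" using alpha by simp
    qed
    also have "\<dots> = budget / 3" by (simp add: bud mult_ac)
    finally show ?thesis using t(1) by linarith
  qed
  have b1: "1 / (10 ^ 15 * D ^ 13) / (D ^ 6 * \<alpha> * e) \<le> budget"
    unfolding bud using c by (intro divide_right_mono[OF F]) simp
  have a2: "2 \<le> budget / 3"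
  proof -
    have "(q * D ^ 19) * q \<le> (1 / 100000000000000000000) * (1 / 100000000000000000000)"
      using qk[of 19] qk[of 0] q pos[of 19] by (intro mult_mono) auto
    then have e19: "e * D ^ 19 \<le> 1 / 10 ^ 40" by (simp add: q(2)[symmetric] mult_ac)
    have "(e * D ^ 19) * \<alpha> \<le> (1 / 10 ^ 40) * 1" using e19 alpha alpha_le by (intro mult_mono) auto
    then have "6 * 10 ^ 15 * ((e * D ^ 19) * \<alpha>) \<le> 1" by simp
    moreover have "D ^ 19 = D ^ 13 * D ^ 6" by (simp flip: power_add)
    ultimately have "6 * ((10 ^ 15 * D ^ 13) * (D ^ 6 * \<alpha> * e)) \<le> 1" by (simp only: mult_ac)
    moreover have Z: "0 < (10 ^ 15 * D ^ 13) * (D ^ 6 * \<alpha> * e)"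
      by (rule mult_pos_pos[OF _ c]) (use pos[of 13] in simp)
    ultimately have "6 \<le> 1 / ((10 ^ 15 * D ^ 13) * (D ^ 6 * \<alpha> * e))"
      by (simp only: pos_le_divide_eq[OF Z])
    then show ?thesis using b1 by (simp add: divide_divide_eq_left)
  qed
  have a3: "y \<le> budget / 3"
  proof -
    have "3 * 10 ^ 15 * D ^ 13 * (D ^ 6 * e) * (8/7 * radius) \<le> D ^ 12 * q"
    proof -
      have "D ^ 13 * D ^ 6 = D ^ 12 * D ^ 5 * D\<^sup>2" by (simp flip: power_add)
      then have "D ^ 13 * (D ^ 6 * e) * radius = (D ^ 12 * q) * (q * D ^ 5) / 10 ^ 6"
        using pos[of 2] by (simp add: radius_def q(2)[symmetric] field_simps)
      also have "\<dots> \<le> (D ^ 12 * q) * (1 / 100000000000000000000) / 10 ^ 6"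
        using qk[of 5] q pos[of 12] by (intro divide_right_mono mult_left_mono) auto
      finally have "D ^ 13 * (D ^ 6 * e) * radius \<le> (D ^ 12 * q) * (1 / 10 ^ 26)" by simp
      moreover have "0 \<le> D ^ 12 * q" using q pos[of 12] by simp
      ultimately show ?thesis by (simp add: mult_ac)
    qed
    then have "8/7 * radius / (D ^ 12 * q) \<le> 1 / (3 * 10 ^ 15 * D ^ 13 * (D ^ 6 * e))"
      using pos[of 12] pos[of 13] pos[of 6] q e_bounds by (simp add: divide_simps mult_ac)
    then have "8/7 * radius / (D ^ 12 * q) / \<alpha> \<le> 1 / (3 * 10 ^ 15 * D ^ 13 * (D ^ 6 * e)) / \<alpha>"
      using alpha by (intro divide_right_mono) auto
    then show ?thesis using b1 by (simp add: y_def mult_ac)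
  qed
  have "real (N0 + k) \<le> budget" using a1 a2 a3 k(2) by (simp add: N0_def)
  moreover have "norm (xs (N0 + k) - w) \<le> target"
  proof (rule target_after[OF near0])
    have "8/7 * norm (xs N0 - w) / (\<alpha> * (D ^ 12 * sqrt e * norm w))
        \<le> 8/7 * (radius * norm w) / (\<alpha> * (D ^ 12 * sqrt e * norm w))"
      using near0 alpha pos[of 12] e_small(2) w by (intro divide_right_mono) auto
    also have "\<dots> = y" using R by (simp add: y_def q_def R_def)
    finally show "8/7 * norm (xs N0 - w) / (\<alpha> * (D ^ 12 * sqrt e * norm w)) \<le> real k" using k(1) by linarith
  qed
  ultimately show ?thesis using tail[OF near0, of k] by blast
qed

theorem convergence:
  "\<exists>N. real N \<le> f (xs 0) / (real d ^ 6 * \<alpha> * e * (norm w)\<^sup>2)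
     \<and> norm (xs N - w) \<le> real d ^ 12 * sqrt e * norm w + 3 * real d ^ 9 * norm \<eta>
     \<and> (\<forall>t\<ge>N. norm (xs (t + 1) - w) \<le> (1 - 7/8 * \<alpha>) ^ (t + 1 - N) * norm (xs N - w) + 16/7 * norm \<eta>
          \<and> norm (G d (xs (t + 1)) - G d w) \<le> 6/5 * norm (xs (t + 1) - w))"
proof -
  obtain N where N: "real N \<le> budget" "norm (xs N - w) \<le> target" "norm (xs N - w) \<le> radius * norm w"
    using near_start far_start by (meson not_le)
  have "norm (xs (t + 1) - w) \<le> (1 - 7/8 * \<alpha>) ^ (t + 1 - N) * norm (xs N - w) + 16/7 * norm \<eta>
     \<and> norm (G d (xs (t + 1)) - G d w) \<le> 6/5 * norm (xs (t + 1) - w)" if "N \<le> t" for t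
  proof -
    have "N + (t + 1 - N) = t + 1" using that by simp
    then show ?thesis using tail[OF N(3), of "t + 1 - N"] near_bounds(1)[of "xs (t + 1)"] iterates[of "t + 1"] by simp
  qed
  then show ?thesis using N(1,2) unfolding budget_def target_def D_def by blast
qed

end

section \<open>Finitely supported sequences\<close>

text \<open>Vectors of all dimensions live in one real inner product space, the finitely supported
  sequences, so that the layers of a network can be treated uniformly.\<close>

typedef fin_seq = "{f :: nat \<Rightarrow> real. finite {i. f i \<noteq> 0}}"
  morphisms coord Abs_fin_seq
  by (rule exI[of _ "\<lambda>_. 0"]) simp

setup_lifting type_definition_fin_seq

lemma finite_support: "finite {i. coord x i \<noteq> 0}"
  using coord[of x] by simp

instantiation fin_seq :: real_vector
begin

lift_definition zero_fin_seq :: fin_seq is "\<lambda>_. 0" by simp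
lift_definition plus_fin_seq :: "fin_seq \<Rightarrow> fin_seq \<Rightarrow> fin_seq" is "\<lambda>f g i. f i + g i"
  subgoal for f g by (rule finite_subset[of _ "{i. f i \<noteq> 0} \<union> {i. g i \<noteq> 0}"]) auto
  done
lift_definition minus_fin_seq :: "fin_seq \<Rightarrow> fin_seq \<Rightarrow> fin_seq" is "\<lambda>f g i. f i - g i"
  subgoal for f g by (rule finite_subset[of _ "{i. f i \<noteq> 0} \<union> {i. g i \<noteq> 0}"]) auto
  done
lift_definition uminus_fin_seq :: "fin_seq \<Rightarrow> fin_seq" is "\<lambda>f i. - f i" by simp
lift_definition scaleR_fin_seq :: "real \<Rightarrow> fin_seq \<Rightarrow> fin_seq" is "\<lambda>c f i. c * f i"
  by (erule finite_subset[rotated]) auto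

instance
  by standard (transfer, simp add: algebra_simps)+

end

instantiation fin_seq :: real_inner
begin

text \<open>The support of the first argument is finite and carries every nonzero product;
  \<open>inner_fin_seq_sum\<close> allows any other finite set that does.\<close>

definition inner_fin_seq :: "fin_seq \<Rightarrow> fin_seq \<Rightarrow> real" where
  "inner_fin_seq x y = (\<Sum>i | coord x i \<noteq> 0. coord x i * coord y i)"
definition norm_fin_seq :: "fin_seq \<Rightarrow> real" where "norm_fin_seq x = sqrt (inner x x)"
definition dist_fin_seq :: "fin_seq \<Rightarrow> fin_seq \<Rightarrow> real" where "dist_fin_seq x y = norm (x - y)"
definition sgn_fin_seq :: "fin_seq \<Rightarrow> fin_seq" where "sgn_fin_seq x = inverse (norm x) *\<^sub>R x"
definition uniformity_fin_seq :: "(fin_seq \<times> fin_seq) filter" where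
  "uniformity_fin_seq = (INF e\<in>{0 <..}. principal {(x, y). dist x y < e})"
definition open_fin_seq :: "fin_seq set \<Rightarrow> bool" where
  "open_fin_seq U \<longleftrightarrow> (\<forall>x\<in>U. eventually (\<lambda>(x', y). x' = x \<longrightarrow> y \<in> U) uniformity)"

lemma inner_fin_seq_sum:
  assumes "finite S" "\<And>i. i \<notin> S \<Longrightarrow> coord x i * coord y i = 0"
  shows "inner x y = (\<Sum>i\<in>S. coord x i * coord y i)"
  unfolding inner_fin_seq_def using assms finite_support[of x] by (intro sum.mono_neutral_cong) auto

instance
proof
  fix x y z :: fin_seq and r :: real
  show "dist x y = norm (x - y)" by (rule dist_fin_seq_def)
  show "sgn x = x /\<^sub>R norm x" by (rule sgn_fin_seq_def)
  show "uniformity = (INF e\<in>{0 <..}. principal {(x, y). dist x (y :: fin_seq) < e})"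
    by (rule uniformity_fin_seq_def)
  show "open U = (\<forall>x\<in>U. eventually (\<lambda>(x', y). x' = x \<longrightarrow> y \<in> U) uniformity)" for U :: "fin_seq set"
    by (rule open_fin_seq_def)
  define S where "S = {i. coord x i \<noteq> 0} \<union> {i. coord y i \<noteq> 0} \<union> {i. coord z i \<noteq> 0}"
  have S: "finite S" by (simp add: S_def finite_support)
  have *: "inner u v = (\<Sum>i\<in>S. coord u i * coord v i)" if "\<And>i. i \<notin> S \<Longrightarrow> coord u i = 0" for u v
    using S that by (intro inner_fin_seq_sum) auto
  show "inner x y = inner y x"
    by (subst (1 2) *) (auto simp: S_def mult.commute)
  have "coord (x + y) i = coord x i + coord y i" for i by transfer simp
  then show "inner (x + y) z = inner x z + inner y z"
    by (subst (1 2 3) *) (auto simp: S_def sum.distrib distrib_right)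
  have "coord (r *\<^sub>R x) i = r * coord x i" for i by transfer simp
  then show "inner (r *\<^sub>R x) y = r * inner x y"
    by (subst (1 2) *) (auto simp: S_def sum_distrib_left mult.assoc)
  show "0 \<le> inner x x" unfolding inner_fin_seq_def by (intro sum_nonneg) auto
  show "norm x = sqrt (inner x x)" by (rule norm_fin_seq_def)
  have "(inner x x = 0) = (\<forall>i. coord x i = 0)"
    unfolding inner_fin_seq_def using finite_support[of x] by (subst sum_nonneg_eq_0_iff) auto
  also have "\<dots> = (x = 0)" by transfer auto
  finally show "(inner x x = 0) = (x = 0)" .
qed

end

section \<open>Padding and truncation\<close>

lift_definition embed :: "real vec \<Rightarrow> fin_seq" is "\<lambda>v i. if i < dim_vec v then v $ i else 0"
  by (rule finite_subset[of _ "{..<dim_vec _}"]) auto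

definition project :: "nat \<Rightarrow> fin_seq \<Rightarrow> real vec" where
  "project n x = vec n (coord x)"

lemma coord_embed: "coord (embed v) i = (if i < dim_vec v then v $ i else 0)"
  by transfer simp

lemma coord_simps [simp]:
  "coord (x + y) i = coord x i + coord y i" "coord (x - y) i = coord x i - coord y i"
  "coord (- x) i = - coord x i" "coord (c *\<^sub>R x) i = c * coord x i" "coord 0 i = 0"
  by (transfer, simp)+

lemma fin_seq_eqI: "(\<And>i. coord x i = coord y i) \<Longrightarrow> x = y"
  by transfer auto

lemma project_carrier [simp]: "project n x \<in> carrier_vec n" "dim_vec (project n x) = n"
  by (simp_all add: project_def)

lemma project_embed [simp]: "v \<in> carrier_vec n \<Longrightarrow> project n (embed v) = v"
  by (intro eq_vecI) (auto simp: project_def coord_embed)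

lemma project_diff: "project n (x - y) = project n x - project n y"
  by (intro eq_vecI) (auto simp: project_def)

lemma embed_simps:
  "u \<in> carrier_vec n \<Longrightarrow> v \<in> carrier_vec n \<Longrightarrow> embed (u + v) = embed u + embed v"
  "u \<in> carrier_vec n \<Longrightarrow> v \<in> carrier_vec n \<Longrightarrow> embed (u - v) = embed u - embed v"
  "embed (- u) = - embed u" "embed (c \<cdot>\<^sub>v u) = c *\<^sub>R embed u" "embed (0\<^sub>v n) = 0"
  by (auto intro!: fin_seq_eqI simp: coord_embed)

lemma embed_eq_iff: "u \<in> carrier_vec n \<Longrightarrow> v \<in> carrier_vec n \<Longrightarrow> embed u = embed v \<longleftrightarrow> u = v"
  by (metis project_embed)

lemma embed_eq_0_iff: "u \<in> carrier_vec n \<Longrightarrow> embed u = 0 \<longleftrightarrow> u = 0\<^sub>v n"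
  using embed_eq_iff[of u n "0\<^sub>v n"] by (simp add: embed_simps)

lemma inner_embed:
  assumes "u \<in> carrier_vec n" "v \<in> carrier_vec n" shows "inner (embed u) (embed v) = u \<bullet> v"
  using assms by (subst inner_fin_seq_sum[of "{..<n}"]) (auto simp: coord_embed scalar_prod_def lessThan_atLeast0)

lemma norm_embed: "norm (embed u) = vnorm u"
  by (simp add: norm_fin_seq_def vnorm_def inner_embed[of u "dim_vec u" u])

lemma vnorm_nonneg [simp]: "0 \<le> vnorm u" by (simp flip: norm_embed)

lemma vec_cauchy_schwarz: "u \<in> carrier_vec n \<Longrightarrow> v \<in> carrier_vec n \<Longrightarrow> \<bar>u \<bullet> v\<bar> \<le> vnorm u * vnorm v"
  using Cauchy_Schwarz_ineq2[of "embed u" "embed v"] by (simp add: inner_embed norm_embed)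

lemma vnorm_eq_0_iff: "u \<in> carrier_vec n \<Longrightarrow> vnorm u = 0 \<longleftrightarrow> u = 0\<^sub>v n"
  using embed_eq_0_iff[of u n] by (simp flip: norm_embed)

lemma vnorm_mono:
  assumes "dim_vec u = dim_vec v" "\<And>i. i < dim_vec u \<Longrightarrow> \<bar>u $ i\<bar> \<le> \<bar>v $ i\<bar>"
  shows "vnorm u \<le> vnorm v"
proof -
  have "u $ i * u $ i \<le> v $ i * v $ i" if "i < dim_vec u" for i
    using assms(2)[OF that] unfolding abs_le_square_iff by (simp add: power2_eq_square)
  then have "(\<Sum>i\<in>{0..<dim_vec u}. u $ i * u $ i) \<le> (\<Sum>i\<in>{0..<dim_vec u}. v $ i * v $ i)"
    by (intro sum_mono) auto
  then show ?thesis using assms(1) by (simp add: vnorm_def scalar_prod_def)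
qed

lemma vnorm_smult: "vnorm (c \<cdot>\<^sub>v u) = \<bar>c\<bar> * vnorm u"
  by (simp add: embed_simps flip: norm_embed)

section \<open>Matrices\<close>

lemma transpose_scalar_prod:
  fixes M :: "real mat"
  assumes "M \<in> carrier_mat p k" "u \<in> carrier_vec p" "v \<in> carrier_vec k"
  shows "(M\<^sup>T *\<^sub>v u) \<bullet> v = u \<bullet> (M *\<^sub>v v)"
  using transpose_vec_mult_scalar[OF assms(1,3,2)] .

text \<open>A supremum of reals is an upper bound only for bounded sets. Boundedness comes from
  Cauchy-Schwarz on the rows, that is, from the Frobenius norm.\<close>

lemma opnorm_bound:
  fixes M :: "real mat"
  assumes M: "M \<in> carrier_mat p k" and u: "u \<in> carrier_vec k"
  shows "vnorm (M *\<^sub>v u) \<le> opnorm M * vnorm u"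
proof (cases "u = 0\<^sub>v k")
  case True
  have "M *\<^sub>v 0\<^sub>v k = 0\<^sub>v p" using M by auto
  then show ?thesis using True by (simp add: vnorm_def)
next
  case False
  then have pos: "0 < vnorm u" using vnorm_eq_0_iff[OF u] vnorm_nonneg[of u] by linarith
  let ?S = "{vnorm (M *\<^sub>v v) | v. v \<in> carrier_vec (dim_col M) \<and> vnorm v \<le> 1}"
  have "bdd_above ?S"
  proof (rule bdd_aboveI)
    fix s assume "s \<in> ?S"
    then obtain v where v: "v \<in> carrier_vec k" "vnorm v \<le> 1" "s = vnorm (M *\<^sub>v v)" using M by auto
    have "(M *\<^sub>v v) \<bullet> (M *\<^sub>v v) \<le> (\<Sum>i<p. (vnorm (row M i))\<^sup>2)"
      unfolding scalar_prod_def[of "M *\<^sub>v v"] using M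
    proof (simp add: lessThan_atLeast0, intro sum_mono)
      fix i assume i: "i \<in> {0..<p}"
      then have "row M i \<in> carrier_vec k" using M by auto
      from vec_cauchy_schwarz[OF this v(1)] have "\<bar>row M i \<bullet> v\<bar> \<le> vnorm (row M i) * 1"
        using mult_left_mono[OF v(2) vnorm_nonneg[of "row M i"]] by linarith
      then have "\<bar>row M i \<bullet> v\<bar>\<^sup>2 \<le> (vnorm (row M i))\<^sup>2" by (intro power_mono) auto
      then show "row M i \<bullet> v * (row M i \<bullet> v) \<le> (vnorm (row M i))\<^sup>2" by (simp add: power2_eq_square)
    qed
    then show "s \<le> sqrt (\<Sum>i<p. (vnorm (row M i))\<^sup>2)" unfolding v(3) vnorm_def[of "M *\<^sub>v v"] by (rule real_sqrt_le_mono)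
  qed
  moreover have "vnorm (M *\<^sub>v ((1 / vnorm u) \<cdot>\<^sub>v u)) \<in> ?S"
    using u M pos by (intro CollectI exI[of _ "(1 / vnorm u) \<cdot>\<^sub>v u"]) (auto simp: vnorm_smult)
  ultimately have "vnorm (M *\<^sub>v ((1 / vnorm u) \<cdot>\<^sub>v u)) \<le> opnorm M" unfolding opnorm_def by (intro cSup_upper)
  moreover have "M *\<^sub>v ((1 / vnorm u) \<cdot>\<^sub>v u) = (1 / vnorm u) \<cdot>\<^sub>v (M *\<^sub>v u)" using mult_mat_vec[OF M u] .
  ultimately show ?thesis using pos by (simp add: vnorm_smult field_simps)
qed

lemma opnorm_bilinear:
  fixes M :: "real mat"
  assumes "M \<in> carrier_mat k k" "u \<in> carrier_vec k" "v \<in> carrier_vec k" "opnorm M \<le> c"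
  shows "\<bar>(M *\<^sub>v u) \<bullet> v\<bar> \<le> c * vnorm u * vnorm v"
proof -
  have "\<bar>(M *\<^sub>v u) \<bullet> v\<bar> \<le> vnorm (M *\<^sub>v u) * vnorm v" using assms by (intro vec_cauchy_schwarz) auto
  also have "\<dots> \<le> (opnorm M * vnorm u) * vnorm v" using opnorm_bound[OF assms(1,2)] by (intro mult_right_mono) auto
  also have "\<dots> \<le> (c * vnorm u) * vnorm v" using assms(4) by (intro mult_right_mono) auto
  finally show ?thesis .
qed

lemma diagm_mult_vec:
  assumes "W \<in> carrier_mat p k" "u \<in> carrier_vec k" "dim_vec s = p"
  shows "(diagm s * W) *\<^sub>v u = vec p (\<lambda>i. s $ i * (W *\<^sub>v u) $ i)"
proof -
  have D: "diagm s \<in> carrier_mat p p" using assms by (auto simp: diagm_def)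
  have "(diagm s * W) *\<^sub>v u = diagm s *\<^sub>v (W *\<^sub>v u)" using D assms by simp
  also have "\<dots> = vec p (\<lambda>i. s $ i * (W *\<^sub>v u) $ i)"
  proof (rule eq_vecI)
    fix i assume "i < dim_vec (vec p (\<lambda>i. s $ i * (W *\<^sub>v u) $ i))"
    then have i: "i < p" by simp
    have "(diagm s *\<^sub>v y) $ i = (\<Sum>j\<in>{0..<p}. (if i = j then s $ i else 0) * y $ j)" if "y \<in> carrier_vec p" for y
      using i assms that by (auto simp: diagm_def scalar_prod_def row_def intro!: sum.cong)
    then have "(diagm s *\<^sub>v (W *\<^sub>v u)) $ i = (\<Sum>j\<in>{0..<p}. (if i = j then s $ i else 0) * (W *\<^sub>v u) $ j)"
      using assms by (simp del: index_mult_mat_vec)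
    also have "\<dots> = s $ i * (W *\<^sub>v u) $ i"
      using i by (simp add: if_distrib[where f = "\<lambda>x. x * _"] sum.delta' cong: if_cong del: index_mult_mat_vec)
    finally show "(diagm s *\<^sub>v (W *\<^sub>v u)) $ i = vec p (\<lambda>i. s $ i * (W *\<^sub>v u) $ i) $ i"
      using i by (simp del: index_mult_mat_vec)
  qed (use assms in \<open>simp add: diagm_def\<close>)
  finally show ?thesis .
qed

section \<open>The swap matrix\<close>

text \<open>The projection onto p + q minus the projection onto p - q. As division by zero gives 0,
  the cases p = q and p = -q are included, with the projection onto p and its negative.\<close>

definition swap_map :: "'a::real_inner \<Rightarrow> 'a \<Rightarrow> 'a \<Rightarrow> 'a" where
  "swap_map p q v = (inner (p + q) v / inner (p + q) (p + q)) *\<^sub>R (p + q)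
     - (inner (p - q) v / inner (p - q) (p - q)) *\<^sub>R (p - q)"

lemma swap_map_unit:
  fixes p q :: "'a::real_inner"
  assumes "norm p = 1" "norm q = 1"
  shows "swap_map p q p = q" "swap_map p q q = p"
proof -
  have pq: "inner p p = 1" "inner q q = 1" using assms by (auto simp: power2_norm_eq_inner[symmetric])
  \<comment> \<open>For unit vectors the square of p + q is twice its inner product with p; the case
    s = 0 takes care of p = q and p = -q.\<close>
  have half: "(a / b) *\<^sub>R s = (1/2) *\<^sub>R s" if "b = 2 * a" "b = inner s s" for a b and s :: 'a
    using that by (cases "s = 0") auto
  have 1: "(inner (p + q) p / inner (p + q) (p + q)) *\<^sub>R (p + q) = (1/2) *\<^sub>R (p + q)"
    "(inner (p - q) p / inner (p - q) (p - q)) *\<^sub>R (p - q) = (1/2) *\<^sub>R (p - q)"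
    "(inner (p + q) q / inner (p + q) (p + q)) *\<^sub>R (p + q) = (1/2) *\<^sub>R (p + q)"
    using pq by (intro half; simp add: inner_add_left inner_add_right inner_diff_left inner_diff_right inner_commute[of q p])+
  have "(inner (p - q) q / inner (p - q) (p - q)) *\<^sub>R (p - q)
      = - ((inner (p - q) p / inner (p - q) (p - q)) *\<^sub>R (p - q))"
  proof -
    have "inner (p - q) q = - inner (p - q) p" using pq by (simp add: inner_diff_left inner_commute[of q p])
    then show ?thesis by simp
  qed
  then have 2: "(inner (p - q) q / inner (p - q) (p - q)) *\<^sub>R (p - q) = - ((1/2) *\<^sub>R (p - q))" unfolding 1(2) .
  show "swap_map p q p = q" unfolding swap_map_def 1
    by (simp add: scaleR_diff_right[symmetric] scaleR_2[symmetric])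
  have "(1/2) *\<^sub>R (p + q) - - ((1/2) *\<^sub>R (p - q)) = (1/2) *\<^sub>R ((p + q) + (p - q))"
    by (simp only: scaleR_add_right diff_minus_eq_add)
  also have "\<dots> = p" by (simp add: scaleR_2[symmetric])
  finally show "swap_map p q q = p" unfolding swap_map_def 1 2 .
qed

lemma swap_map_scaleR: "swap_map p q (c *\<^sub>R v) = c *\<^sub>R swap_map p q v"
  by (simp add: swap_map_def scaleR_diff_right)

lemma swap_map_orthogonal: "inner p z = 0 \<Longrightarrow> inner q z = 0 \<Longrightarrow> swap_map p q z = 0"
  by (simp add: swap_map_def inner_add_left inner_diff_left)

lemma swap_map_bound: "\<bar>inner (swap_map p q v) v\<bar> \<le> (norm v)\<^sup>2"
proof -
  have *: "0 \<le> (inner s v)\<^sup>2 / inner s s" "(inner s v)\<^sup>2 / inner s s \<le> (norm v)\<^sup>2" for s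
    using Cauchy_Schwarz_ineq[of s v]
    by (auto simp: divide_le_eq power2_norm_eq_inner mult.commute intro!: divide_nonneg_nonneg)
  have "inner (swap_map p q v) v = (inner (p + q) v)\<^sup>2 / inner (p + q) (p + q) - (inner (p - q) v)\<^sup>2 / inner (p - q) (p - q)"
    by (simp add: swap_map_def inner_diff_left power2_eq_square)
  then show ?thesis
    using *[of "p + q"] *[of "p - q"] unfolding abs_le_iff by linarith
qed

definition swap_mat :: "real vec \<Rightarrow> real vec \<Rightarrow> real mat" where
  "swap_mat x y = (let s = unitv x + unitv y; t = unitv x - unitv y in
     mat (dim_vec x) (dim_vec x) (\<lambda>(i, j). s $ i * s $ j / (s \<bullet> s) - t $ i * t $ j / (t \<bullet> t)))"

lemma swap_mat_mult:
  assumes "x \<in> carrier_vec k" "y \<in> carrier_vec k" "v \<in> carrier_vec k"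
  shows "embed (swap_mat x y *\<^sub>v v) = swap_map (embed (unitv x)) (embed (unitv y)) (embed v)"
proof -
  define s where "s = unitv x + unitv y"
  define t where "t = unitv x - unitv y"
  have u: "unitv x \<in> carrier_vec k" "unitv y \<in> carrier_vec k" using assms by (auto simp: unitv_def)
  then have st: "s \<in> carrier_vec k" "t \<in> carrier_vec k" by (auto simp: s_def t_def)
  have "swap_mat x y *\<^sub>v v = ((s \<bullet> v) / (s \<bullet> s)) \<cdot>\<^sub>v s - ((t \<bullet> v) / (t \<bullet> t)) \<cdot>\<^sub>v t"
  proof (rule eq_vecI)
    fix i assume "i < dim_vec (((s \<bullet> v) / (s \<bullet> s)) \<cdot>\<^sub>v s - ((t \<bullet> v) / (t \<bullet> t)) \<cdot>\<^sub>v t)"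
    then have i: "i < k" using st by simp
    have "(swap_mat x y *\<^sub>v v) $ i
        = (\<Sum>j\<in>{0..<k}. (s $ i * s $ j / (s \<bullet> s) - t $ i * t $ j / (t \<bullet> t)) * v $ j)"
      using i assms(1-3) by (simp add: swap_mat_def Let_def s_def[symmetric] t_def[symmetric] scalar_prod_def[of _ v] row_def)
    also have "\<dots> = (\<Sum>j\<in>{0..<k}. (s $ i / (s \<bullet> s)) * (s $ j * v $ j)) - (\<Sum>j\<in>{0..<k}. (t $ i / (t \<bullet> t)) * (t $ j * v $ j))"
      by (simp add: sum_subtractf[symmetric] algebra_simps)
    also have "\<dots> = (s $ i / (s \<bullet> s)) * (s \<bullet> v) - (t $ i / (t \<bullet> t)) * (t \<bullet> v)"
      using assms(3) by (simp add: sum_distrib_left scalar_prod_def[of _ v])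
    finally show "(swap_mat x y *\<^sub>v v) $ i = (((s \<bullet> v) / (s \<bullet> s)) \<cdot>\<^sub>v s - ((t \<bullet> v) / (t \<bullet> t)) \<cdot>\<^sub>v t) $ i"
      using i st by (simp add: mult.commute)
  qed (use assms st in \<open>simp add: swap_mat_def Let_def\<close>)
  moreover have "embed s = embed (unitv x) + embed (unitv y)" "embed t = embed (unitv x) - embed (unitv y)"
    using u by (simp_all add: s_def t_def embed_simps)
  moreover have "embed (((s \<bullet> v) / (s \<bullet> s)) \<cdot>\<^sub>v s - ((t \<bullet> v) / (t \<bullet> t)) \<cdot>\<^sub>v t)
     = (inner (embed s) (embed v) / inner (embed s) (embed s)) *\<^sub>R embed s
       - (inner (embed t) (embed v) / inner (embed t) (embed t)) *\<^sub>R embed t"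
    using st assms(3) by (subst embed_simps(2)[of _ k]) (auto simp: embed_simps inner_embed)
  ultimately show ?thesis by (simp add: swap_map_def)
qed

lemma norm_unitv: "x \<in> carrier_vec k \<Longrightarrow> x \<noteq> 0\<^sub>v k \<Longrightarrow> norm (embed (unitv x)) = 1"
  using vnorm_eq_0_iff[of x k] by (simp add: unitv_def embed_simps norm_embed)

lemma mat_unit_vec:
  fixes M :: "real mat"
  shows "M \<in> carrier_mat p k \<Longrightarrow> i < p \<Longrightarrow> j < k \<Longrightarrow> (M *\<^sub>v unit_vec k j) $ i = M $$ (i, j)"
  by (simp add: scalar_prod_right_unit)

text \<open>For uniqueness, symmetry makes the difference z of the two images of a vector orthogonal
  to x and y. Both matrices then annihilate z, and symmetry again yields
  \<open>z \<bullet> z = 0\<close>.\<close>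

lemma swapm_eq:
  assumes x: "x \<in> carrier_vec k" "x \<noteq> 0\<^sub>v k" and y: "y \<in> carrier_vec k" "y \<noteq> 0\<^sub>v k"
  shows "swapm x y = swap_mat x y"
  unfolding swapm_def
proof (rule the_equality)
  have u: "unitv x \<in> carrier_vec k" "unitv y \<in> carrier_vec k" using x y by (auto simp: unitv_def)
  have S: "swap_mat x y \<in> carrier_mat k k" using x by (auto simp: swap_mat_def Let_def)
  have nx: "vnorm x \<noteq> 0" "vnorm y \<noteq> 0" using x y by (auto simp: vnorm_eq_0_iff)
  have Sc: "swap_mat x y *\<^sub>v v \<in> carrier_vec k" if "v \<in> carrier_vec k" for v using S that by simp
  show P: "swap_mat x y \<in> carrier_mat (dim_vec x) (dim_vec x) \<and> (swap_mat x y)\<^sup>T = swap_mat x y \<and>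
      swap_mat x y *\<^sub>v unitv x = unitv y \<and> swap_mat x y *\<^sub>v unitv y = unitv x \<and>
      (\<forall>z \<in> carrier_vec (dim_vec x). z \<bullet> x = 0 \<and> z \<bullet> y = 0 \<longrightarrow> swap_mat x y *\<^sub>v z = 0\<^sub>v (dim_vec x))"
  proof (intro conjI ballI impI)
    show "swap_mat x y \<in> carrier_mat (dim_vec x) (dim_vec x)" using S x by simp
    show "(swap_mat x y)\<^sup>T = swap_mat x y" by (intro eq_matI) (auto simp: swap_mat_def Let_def mult.commute)
    show "swap_mat x y *\<^sub>v unitv x = unitv y" "swap_mat x y *\<^sub>v unitv y = unitv x"
      using u Sc swap_map_unit[of "embed (unitv x)" "embed (unitv y)"] norm_unitv[OF x] norm_unitv[OF y]
      by (auto simp: swap_mat_mult[OF x(1) y(1)] simp flip: embed_eq_iff[of _ k])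
    fix z assume z: "z \<in> carrier_vec (dim_vec x)" "z \<bullet> x = 0 \<and> z \<bullet> y = 0"
    then have zk: "z \<in> carrier_vec k" using x by simp
    have "inner (embed (unitv x)) (embed z) = 0" "inner (embed (unitv y)) (embed z) = 0"
      using z zk x y comm_scalar_prod[of z k x] comm_scalar_prod[of z k y] by (auto simp: unitv_def embed_simps inner_embed)
    then have "embed (swap_mat x y *\<^sub>v z) = 0" using swap_mat_mult[OF x(1) y(1) zk] swap_map_orthogonal by simp
    then show "swap_mat x y *\<^sub>v z = 0\<^sub>v (dim_vec x)" using Sc[OF zk] x by (simp add: embed_eq_0_iff)
  qed
  fix M assume "M \<in> carrier_mat (dim_vec x) (dim_vec x) \<and> M\<^sup>T = M \<and>
      M *\<^sub>v unitv x = unitv y \<and> M *\<^sub>v unitv y = unitv x \<and>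
      (\<forall>z \<in> carrier_vec (dim_vec x). z \<bullet> x = 0 \<and> z \<bullet> y = 0 \<longrightarrow> M *\<^sub>v z = 0\<^sub>v (dim_vec x))"
  then have M: "M \<in> carrier_mat k k" "M\<^sup>T = M" "M *\<^sub>v unitv x = unitv y" "M *\<^sub>v unitv y = unitv x"
      "\<And>z. z \<in> carrier_vec k \<Longrightarrow> z \<bullet> x = 0 \<Longrightarrow> z \<bullet> y = 0 \<Longrightarrow> M *\<^sub>v z = 0\<^sub>v k" using x by auto
  let ?S = "swap_mat x y"
  have S': "?S\<^sup>T = ?S" "?S *\<^sub>v unitv x = unitv y" "?S *\<^sub>v unitv y = unitv x"
      "\<And>z. z \<in> carrier_vec k \<Longrightarrow> z \<bullet> x = 0 \<Longrightarrow> z \<bullet> y = 0 \<Longrightarrow> ?S *\<^sub>v z = 0\<^sub>v k" using P x by auto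
  have "M *\<^sub>v v = ?S *\<^sub>v v" if v: "v \<in> carrier_vec k" for v
  proof -
    define z where "z = M *\<^sub>v v - ?S *\<^sub>v v"
    have Mv: "M *\<^sub>v v \<in> carrier_vec k" "?S *\<^sub>v v \<in> carrier_vec k" "z \<in> carrier_vec k" using M S v by (auto simp: z_def)
    have sM: "(M *\<^sub>v v) \<bullet> u = v \<bullet> (M *\<^sub>v u)" "(?S *\<^sub>v v) \<bullet> u = v \<bullet> (?S *\<^sub>v u)" if "u \<in> carrier_vec k" for u
      using transpose_scalar_prod[OF M(1) v that] transpose_scalar_prod[OF S v that] M(2) S'(1) by simp_all
    have zu: "z \<bullet> u = v \<bullet> (M *\<^sub>v u) - v \<bullet> (?S *\<^sub>v u)" if "u \<in> carrier_vec k" for u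
      using Mv that sM[OF that] by (simp add: z_def minus_scalar_prod_distrib)
    have "z \<bullet> unitv x = 0" "z \<bullet> unitv y = 0" using zu u M S' by simp_all
    then have zx: "z \<bullet> x = 0" "z \<bullet> y = 0" using nx Mv x y by (auto simp: unitv_def)
    have "z \<bullet> z = 0" using zu[OF Mv(3)] M(5)[OF Mv(3) zx] S'(4)[OF Mv(3) zx] v by simp
    then have "z = 0\<^sub>v k" using Mv(3) vnorm_eq_0_iff[of z k] by (simp add: vnorm_def)
    then have "embed (M *\<^sub>v v) - embed (?S *\<^sub>v v) = 0" using Mv by (simp add: z_def embed_simps flip: embed_simps(2))
    then show ?thesis using Mv by (simp add: embed_eq_iff[of _ k])
  qed
  then have "(M *\<^sub>v unit_vec k j) $ i = (?S *\<^sub>v unit_vec k j) $ i" for i j by simp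
  then show "M = ?S" using M(1) S mat_unit_vec[OF M(1)] mat_unit_vec[OF S]
    by (intro eq_matI) (auto simp del: index_mult_mat_vec)
qed

section \<open>From the concentration conditions to a normalised network\<close>

text \<open>The core is a^2 (1 - r) / 2 \<le> |x - y|^2: for r \<ge> 0 it follows from the square of
  b - a r, for r < 0 from the sign. Then \<open>arccos_hoelder\<close> at 1 applies.\<close>

lemma arccos_cosine_le:
  fixes x y :: "'a::real_inner"
  assumes "x \<noteq> 0"
  shows "arccos (cosine x y) \<le> pi * norm (x - y) / norm x"
proof -
  define r a b where r: "r = cosine x y" "a = norm x" "b = norm y"
  have c: "\<bar>r\<bar> \<le> 1" by (simp add: r cosine_bound)
  have a: "0 < a" "0 \<le> b" using assms by (auto simp: r)
  have "0 \<le> b\<^sup>2 - 2 * (a * b * r) + a\<^sup>2 * ((1 + r) / 2)"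
  proof (cases "r < 0")
    case True
    then have "a * b * r \<le> 0" using a by (simp add: mult_nonneg_nonpos)
    moreover have "0 \<le> a\<^sup>2 * ((1 + r) / 2)" using c by simp
    ultimately show ?thesis using zero_le_power2[of b] by linarith
  next
    case False
    have "0 \<le> (1 - r) * (1 + 2 * r)" using c False by (intro mult_nonneg_nonneg) auto
    then have "r\<^sup>2 \<le> (1 + r) / 2" by (simp add: power2_eq_square algebra_simps)
    then have "a\<^sup>2 * r\<^sup>2 \<le> a\<^sup>2 * ((1 + r) / 2)" by (intro mult_left_mono) auto
    moreover have "0 \<le> (b - a * r)\<^sup>2" by simp
    moreover have "(b - a * r)\<^sup>2 = b\<^sup>2 - 2 * (a * b * r) + a\<^sup>2 * r\<^sup>2"
      by (simp add: power2_diff power_mult_distrib)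
    ultimately show ?thesis by linarith
  qed
  moreover have "(norm (x - y))\<^sup>2 = a\<^sup>2 + b\<^sup>2 - 2 * (a * b * r)"
    using inner_eq_cosine[of x y]
    by (simp add: power2_norm_eq_inner inner_diff_left inner_diff_right inner_commute[of y x] r)
  ultimately have "a\<^sup>2 * ((1 - r) / 2) \<le> (norm (x - y))\<^sup>2" by (simp add: algebra_simps add_divide_distrib diff_divide_distrib)
  then have "(1 - r) / 2 \<le> (norm (x - y) / a)\<^sup>2" using a by (simp add: power_divide field_simps)
  then have "sqrt ((1 - r) / 2) \<le> norm (x - y) / a" using a by (intro real_le_lsqrt) auto
  moreover have "\<bar>r - 1\<bar> = 1 - r" using c by (simp add: abs_le_iff)
  ultimately have "pi * sqrt (\<bar>r - 1\<bar> / 2) \<le> pi * (norm (x - y) / a)"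
    by (intro mult_left_mono) auto
  moreover have "arccos r \<le> pi * sqrt (\<bar>r - 1\<bar> / 2)" using arccos_hoelder[OF c, of 1] by simp
  ultimately show ?thesis by (simp add: r)
qed

text \<open>Both squares are about |h|^2, and the mixed product is governed by slope and residual,
  which differ from 1 and 0 by a multiple of the angle. The worst total, 8 times the angle over pi,
  comes from the last layer.\<close>

lemma frame_stable:
  fixes x y h :: "'a::real_inner"
  assumes x: "x \<noteq> 0" and S: "\<bar>inner (S h) h\<bar> \<le> (norm h)\<^sup>2"
    and iso: "\<bar>inner Mx Mx - inner h h\<bar> \<le> e * norm h * norm h" "\<bar>inner My My - inner h h\<bar> \<le> e * norm h * norm h"
    and frame: "\<bar>inner My Mx - (layer_slope d i (cosine x y) * inner h h
        + (layer_kernel d i (cosine x y) - cosine x y * layer_slope d i (cosine x y)) * inner (S h) h)\<bar> \<le> e * norm h * norm h"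
  shows "(norm (Mx - My))\<^sup>2 \<le> (8 * norm (x - y) / norm x + 4 * e) * (norm h)\<^sup>2"
proof -
  define c1 c2 t where c: "c1 = layer_slope d i (cosine x y)"
    "c2 = layer_kernel d i (cosine x y) - cosine x y * layer_slope d i (cosine x y)"
    "t = arccos (cosine x y)"
  have cb: "\<bar>cosine x y\<bar> \<le> 1" by (rule cosine_bound)
  have t: "0 \<le> t" using cb by (simp add: c arccos_lbound abs_le_iff)
  have "sqrt (1 - (cosine x y)\<^sup>2) = sin t" using sin_arccos_abs[OF cb] by (simp add: c)
  then have s: "sqrt (1 - (cosine x y)\<^sup>2) \<le> t" using sin_x_le_x[OF t] by simp
  have s0: "0 \<le> sqrt (1 - (cosine x y)\<^sup>2)" using cb by (simp add: abs_square_le_1)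
  from s have sp: "sqrt (1 - (cosine x y)\<^sup>2) / pi \<le> t / pi" by (simp add: divide_right_mono)
  have tp: "0 \<le> t / pi" using t by simp
  have c2: "0 \<le> c2" "2 - 2 * c1 + 2 * c2 \<le> 8 * (t / pi)"
    using sp s0 tp unfolding c layer_residual by (auto simp: layer_slope_def arc_slope_def)
  have H: "inner h h = (norm h)\<^sup>2" by (simp add: power2_norm_eq_inner)
  define n where "n = (norm h)\<^sup>2"
  have n: "0 \<le> n" "e * norm h * norm h = e * n" by (auto simp: n_def power2_eq_square)
  have "c2 * (- n) \<le> c2 * inner (S h) h" using c2 S by (intro mult_left_mono) (auto simp: n_def)
  then have "c1 * n - c2 * n - e * n \<le> inner My Mx"
  proof -
    have "\<bar>inner My Mx - (c1 * n + c2 * inner (S h) h)\<bar> \<le> e * n"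
      using frame unfolding n(2) unfolding n_def H c .
    then show ?thesis using \<open>c2 * (- n) \<le> c2 * inner (S h) h\<close> by (simp add: abs_le_iff)
  qed
  moreover have "inner Mx Mx \<le> n + e * n" "inner My My \<le> n + e * n"
    using iso unfolding H n_def[symmetric] n(2) by (auto simp: abs_le_iff)
  moreover have "(norm (Mx - My))\<^sup>2 = inner Mx Mx + inner My My - 2 * inner My Mx"
    by (simp add: power2_norm_eq_inner inner_diff_left inner_diff_right inner_commute[of Mx My])
  ultimately have "(norm (Mx - My))\<^sup>2 \<le> (2 - 2 * c1 + 2 * c2 + 4 * e) * n" by (simp add: algebra_simps)
  also have "\<dots> \<le> (8 * (norm (x - y) / norm x) + 4 * e) * n"
  proof -
    have "t / pi \<le> norm (x - y) / norm x" using arccos_cosine_le[OF x, of y] by (simp add: c field_simps)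
    then show ?thesis using c2 n by (intro mult_right_mono) auto
  qed
  finally show ?thesis by (simp add: n_def)
qed

lemma vangle_cosine:
  assumes "x \<in> carrier_vec k" "y \<in> carrier_vec k"
  shows "vangle x y = arccos (cosine (embed x) (embed y))"
    "sin (vangle x y) = sqrt (1 - (cosine (embed x) (embed y))\<^sup>2)"
proof -
  show 1: "vangle x y = arccos (cosine (embed x) (embed y))"
    using assms by (simp add: vangle_def cosine_def inner_embed norm_embed)
  show "sin (vangle x y) = sqrt (1 - (cosine (embed x) (embed y))\<^sup>2)"
    unfolding 1 by (rule sin_arccos_abs[OF cosine_bound])
qed

lemma smult_mat_vec:
  fixes M :: "real mat"
  shows "M \<in> carrier_mat p k \<Longrightarrow> v \<in> carrier_vec k \<Longrightarrow> (c \<cdot>\<^sub>m M) *\<^sub>v v = c \<cdot>\<^sub>v (M *\<^sub>v v)"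
  by (intro eq_vecI) auto

text \<open>The shape a I + b M covers \<open>Qmat\<close> and \<open>Phi\<close>, so both
  concentration conditions become statements about inner products of layer images.\<close>

lemma frame_matrix:
  assumes M: "M \<in> carrier_mat p k" and N: "N \<in> carrier_mat p k"
    and x: "x \<in> carrier_vec k" "x \<noteq> 0\<^sub>v k" and y: "y \<in> carrier_vec k" "y \<noteq> 0\<^sub>v k"
    and g: "g \<in> carrier_vec k" and h: "h \<in> carrier_vec k"
    and T: "T = a \<cdot>\<^sub>m 1\<^sub>m (dim_vec x) + b \<cdot>\<^sub>m swapm x y"
  shows "((M\<^sup>T * N - T) *\<^sub>v g) \<bullet> h = inner (embed (N *\<^sub>v g)) (embed (M *\<^sub>v h))
    - (a * inner (embed g) (embed h) + b * inner (swap_map (embed (unitv x)) (embed (unitv y)) (embed g)) (embed h))"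
    "T \<in> carrier_mat k k" "M\<^sup>T * N - T \<in> carrier_mat k k"
proof -
  have S: "swap_mat x y \<in> carrier_mat k k" using x by (auto simp: swap_mat_def Let_def)
  have T': "T = a \<cdot>\<^sub>m 1\<^sub>m k + b \<cdot>\<^sub>m swap_mat x y" using T x by (simp add: swapm_eq[OF x y])
  then show Tc: "T \<in> carrier_mat k k" using S by auto
  then show "M\<^sup>T * N - T \<in> carrier_mat k k" by (rule minus_carrier_mat)
  have "T *\<^sub>v g = a \<cdot>\<^sub>v g + b \<cdot>\<^sub>v (swap_mat x y *\<^sub>v g)"
    unfolding T' using S g
    by (subst add_mult_distrib_mat_vec[of _ k k]) (auto simp: smult_mat_vec)
  then have Tg: "(T *\<^sub>v g) \<bullet> h = a * (g \<bullet> h) + b * ((swap_mat x y *\<^sub>v g) \<bullet> h)"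
    using S g h by (simp add: add_scalar_prod_distrib[of _ k])
  have "(M\<^sup>T * N - T) *\<^sub>v g = (M\<^sup>T * N) *\<^sub>v g - T *\<^sub>v g"
    using M N Tc g by (intro minus_mult_distrib_mat_vec[of _ k k]) auto
  moreover have "(M\<^sup>T * N) *\<^sub>v g = M\<^sup>T *\<^sub>v (N *\<^sub>v g)" using M N g by (intro assoc_mult_mat_vec[of _ k p _ k]) auto
  ultimately have "((M\<^sup>T * N - T) *\<^sub>v g) \<bullet> h = (M\<^sup>T *\<^sub>v (N *\<^sub>v g)) \<bullet> h - (T *\<^sub>v g) \<bullet> h"
    using M N Tc g h by (simp add: minus_scalar_prod_distrib[of _ k])
  also have "(M\<^sup>T *\<^sub>v (N *\<^sub>v g)) \<bullet> h = (N *\<^sub>v g) \<bullet> (M *\<^sub>v h)"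
    using M N g h by (intro transpose_scalar_prod) auto
  finally show "((M\<^sup>T * N - T) *\<^sub>v g) \<bullet> h = inner (embed (N *\<^sub>v g)) (embed (M *\<^sub>v h))
    - (a * inner (embed g) (embed h) + b * inner (swap_map (embed (unitv x)) (embed (unitv y)) (embed g)) (embed h))"
    unfolding Tg using M N S g h swap_mat_mult[OF x(1) y(1) g, symmetric]
    by (simp add: inner_embed[of _ k] inner_embed[of _ p])
qed

text \<open>The source of the ratio of norms in the \<open>cross\<close> condition.\<close>

lemma swap_map_unitv:
  assumes x: "x \<in> carrier_vec k" "x \<noteq> 0\<^sub>v k" and y: "y \<in> carrier_vec k" "y \<noteq> 0\<^sub>v k"
  shows "swap_map (embed (unitv x)) (embed (unitv y)) (embed y) = (norm (embed y) / norm (embed x)) *\<^sub>R embed x"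
proof -
  have "vnorm y \<noteq> 0" using y by (simp add: vnorm_eq_0_iff)
  then have "embed y = vnorm y *\<^sub>R embed (unitv y)" by (simp add: unitv_def embed_simps)
  then have "swap_map (embed (unitv x)) (embed (unitv y)) (embed y) = vnorm y *\<^sub>R embed (unitv x)"
    using swap_map_unit(2)[OF norm_unitv[OF x] norm_unitv[OF y]] by (metis swap_map_scaleR)
  then show ?thesis by (simp add: unitv_def embed_simps norm_embed)
qed

lemma relu_nth: "i < dim_vec v \<Longrightarrow> relu v $ i = max (v $ i) 0" "dim_vec (relu v) = dim_vec v"
  by (auto simp: relu_def)

lemma relu_smult: "0 \<le> c \<Longrightarrow> relu (c \<cdot>\<^sub>v v) = c \<cdot>\<^sub>v relu v"
  by (intro eq_vecI) (auto simp: relu_nth max_mult_distrib_left)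

lemma vabs_nth: "i < dim_vec v \<Longrightarrow> vabs v $ i = \<bar>v $ i\<bar>" "dim_vec (vabs v) = dim_vec v"
  by (auto simp: vabs_def)

section \<open>The network as a family of scaled layers\<close>

locale network =
  fixes d :: nat and ns :: "nat list" and Ws :: "real mat list" and A :: "real mat" and m :: nat and \<epsilon>\<^sub>0 :: real
  assumes d: "2 \<le> d" and Ws: "length Ws = d" "\<And>i. i < d \<Longrightarrow> Ws ! i \<in> carrier_mat (ns ! (i + 1)) (ns ! i)"
    and A: "A \<in> carrier_mat m (ns ! d)" and eps0: "0 < \<epsilon>\<^sub>0" "100 * (real d + 1) * (33 * \<epsilon>\<^sub>0) \<le> 1"
    and wdc: "\<And>i. i < d \<Longrightarrow> WDC (Ws ! i) \<epsilon>\<^sub>0" and rrcp: "RRCP A Ws (ns ! 0) \<epsilon>\<^sub>0"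
begin

definition activation :: "nat \<Rightarrow> real \<Rightarrow> real" where
  "activation i t = (if i < d then (if t > 0 then 1 else 0) else sgn t)"

definition weight :: "nat \<Rightarrow> real mat" where
  "weight i = (if i < d then Ws ! i else A)"

definition out_dim :: "nat \<Rightarrow> nat" where
  "out_dim i = (if i < d then ns ! (i + 1) else m)"

definition gated :: "nat \<Rightarrow> real vec \<Rightarrow> real mat" where
  "gated i z = (if i < d then Wplus (Ws ! i) z else Asgn A z)"

text \<open>Each of the first \<open>d\<close> layers halves squared norms, hence the factor \<open>sqrt 2\<close> per layer.\<close>

definition gain :: "nat \<Rightarrow> real" where
  "gain i = (if i < d then sqrt 2 else if i = d then 1 else 0)"

definition partial :: "nat \<Rightarrow> real vec \<Rightarrow> real vec" where
  "partial i x = Gnet (take i Ws) x"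

definition layer :: "nat \<Rightarrow> fin_seq \<Rightarrow> fin_seq \<Rightarrow> fin_seq" where
  "layer i z u = gain i *\<^sub>R embed (gated i (project (ns ! i) z) *\<^sub>v project (ns ! i) u)"

text \<open>The factor is applied to the input, so every scaled vector is an output of the network
  and the condition on \<open>A\<close> applies to it directly; positive homogeneity moves the
  factor to the output.\<close>

definition scaled :: "nat \<Rightarrow> fin_seq \<Rightarrow> real vec" where
  "scaled i x = partial i (sqrt 2 ^ i \<cdot>\<^sub>v project (ns ! 0) x)"

definition out :: "nat \<Rightarrow> fin_seq \<Rightarrow> fin_seq" where
  "out i x = (if i \<le> d then embed (scaled i x) else embed (vabs (A *\<^sub>v scaled d x)))"

definition inputs :: "fin_seq set" where
  "inputs = embed ` carrier_vec (ns ! 0)"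

lemma weight_carrier: "i \<le> d \<Longrightarrow> weight i \<in> carrier_mat (out_dim i) (ns ! i)"
  using Ws A by (auto simp: weight_def out_dim_def)

lemma gated_mult:
  assumes "i \<le> d" "u \<in> carrier_vec (ns ! i)"
  shows "gated i z *\<^sub>v u = vec (out_dim i) (\<lambda>j. activation i ((weight i *\<^sub>v z) $ j) * (weight i *\<^sub>v u) $ j)"
proof -
  have W: "weight i \<in> carrier_mat (out_dim i) (ns ! i)" using weight_carrier[OF assms(1)] .
  have "gated i z = diagm (map_vec (activation i) (weight i *\<^sub>v z)) * weight i"
    using assms by (cases "i < d") (auto simp: gated_def weight_def Wplus_def Asgn_def activation_def[abs_def])
  moreover have "(diagm (map_vec (activation i) (weight i *\<^sub>v z)) * weight i) *\<^sub>v u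
     = vec (out_dim i) (\<lambda>j. map_vec (activation i) (weight i *\<^sub>v z) $ j * (weight i *\<^sub>v u) $ j)"
    using W by (intro diagm_mult_vec[OF W assms(2)]) simp
  moreover have "map_vec (activation i) (weight i *\<^sub>v z) $ j = activation i ((weight i *\<^sub>v z) $ j)" if "j < out_dim i" for j
    using W that by simp
  ultimately show ?thesis by (auto intro!: eq_vecI)
qed

lemma gated_carrier: "i \<le> d \<Longrightarrow> gated i z \<in> carrier_mat (out_dim i) (ns ! i)"
  using carrier_matD[OF Ws(2)[of i]] carrier_matD[OF A]
  by (cases "i < d") (auto simp: gated_def out_dim_def Wplus_def Asgn_def diagm_def intro!: carrier_matI)

lemma gated_vec [simp]: "i \<le> d \<Longrightarrow> u \<in> carrier_vec (ns ! i) \<Longrightarrow> gated i z *\<^sub>v u \<in> carrier_vec (out_dim i)"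
  using gated_carrier[of i z] by simp

lemma partial_Suc: "i < d \<Longrightarrow> partial (Suc i) x = relu (Ws ! i *\<^sub>v partial i x)"
  using Ws by (simp add: partial_def Gnet_def take_Suc_conv_app_nth)

lemma partial_0: "partial 0 x = x" by (simp add: partial_def Gnet_def)

lemma partial_carrier: "i \<le> d \<Longrightarrow> x \<in> carrier_vec (ns ! 0) \<Longrightarrow> partial i x \<in> carrier_vec (ns ! i)"
proof (induction i)
  case (Suc i)
  then show ?case using Ws(2)[of i] by (auto simp: partial_Suc relu_def)
qed (simp add: partial_0)

lemma partial_smult:
  assumes "i \<le> d" "x \<in> carrier_vec (ns ! 0)" "0 \<le> c"
  shows "partial i (c \<cdot>\<^sub>v x) = c \<cdot>\<^sub>v partial i x"
  using assms(1)
proof (induction i)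
  case (Suc i)
  have "Ws ! i *\<^sub>v (c \<cdot>\<^sub>v partial i x) = c \<cdot>\<^sub>v (Ws ! i *\<^sub>v partial i x)"
    using Suc Ws(2)[of i] partial_carrier[of i x] assms by (intro mult_mat_vec) auto
  then show ?case using Suc assms(3) by (simp add: partial_Suc relu_smult)
qed (simp add: partial_0)

lemma partial_d: "partial d x = Gnet Ws x" using Ws by (simp add: partial_def)

lemma scaled_carrier: "i \<le> d \<Longrightarrow> scaled i x \<in> carrier_vec (ns ! i)"
  unfolding scaled_def by (intro partial_carrier) auto

lemma scaled_eq: "i \<le> d \<Longrightarrow> scaled i x = sqrt 2 ^ i \<cdot>\<^sub>v partial i (project (ns ! 0) x)"
  unfolding scaled_def by (intro partial_smult) auto

lemma project_out: "i \<le> d \<Longrightarrow> project (ns ! i) (out i x) = scaled i x"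
  by (simp add: out_def scaled_carrier)

lemma out_diff: "i \<le> d \<Longrightarrow> out i a - out i b = embed (scaled i a - scaled i b)"
  by (simp add: out_def embed_simps(2)[OF scaled_carrier scaled_carrier])

lemma gated_self:
  assumes "i \<le> d" "z \<in> carrier_vec (ns ! i)"
  shows "gated i z *\<^sub>v z = (if i < d then relu (weight i *\<^sub>v z) else vabs (weight i *\<^sub>v z))"
  unfolding gated_mult[OF assms] using weight_carrier[OF assms(1)] assms
  by (auto intro!: eq_vecI simp: relu_nth vabs_nth activation_def abs_sgn[symmetric] mult.commute simp del: index_mult_mat_vec)

lemma out_Suc:
  assumes "i \<le> d" shows "out (Suc i) x = layer i (out i x) (out i x)"
proof (cases "i < d")
  case True
  have "scaled (Suc i) x = sqrt 2 ^ Suc i \<cdot>\<^sub>v relu (Ws ! i *\<^sub>v partial i (project (ns ! 0) x))"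
    using True by (simp add: scaled_eq partial_Suc)
  moreover have "relu (Ws ! i *\<^sub>v scaled i x) = sqrt 2 ^ i \<cdot>\<^sub>v relu (Ws ! i *\<^sub>v partial i (project (ns ! 0) x))"
  proof -
    have "Ws ! i *\<^sub>v (sqrt 2 ^ i \<cdot>\<^sub>v partial i (project (ns ! 0) x)) = sqrt 2 ^ i \<cdot>\<^sub>v (Ws ! i *\<^sub>v partial i (project (ns ! 0) x))"
      using True Ws(2)[of i] partial_carrier[of i] by (intro mult_mat_vec) auto
    then show ?thesis using True by (simp add: scaled_eq relu_smult)
  qed
  ultimately show ?thesis
    using True by (simp add: layer_def project_out gated_self scaled_carrier weight_def gain_def out_def embed_simps)
next
  case False
  then show ?thesis using assms by (simp add: layer_def project_out gated_self scaled_carrier weight_def gain_def out_def)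
qed

text \<open>Beyond index d no dimensions are known; there \<open>gain\<close> is 0, which makes the
  identity hold for every i.\<close>

lemma layer_diff: "layer i z (u - w) = layer i z u - layer i z w"
  using gated_carrier[of i "project (ns ! i) z"]
  by (cases "i \<le> d") (simp_all add: layer_def project_diff mult_minus_distrib_mat_vec[of _ "out_dim i" "ns ! i"]
      embed_simps(2)[of _ "out_dim i"] scaleR_diff_right gain_def)

lemma out_zero: "i \<le> Suc d \<Longrightarrow> out i 0 = 0"
proof -
  have p: "project (ns ! 0) 0 = 0\<^sub>v (ns ! 0)" by (intro eq_vecI) (auto simp: project_def)
  have "partial i (0\<^sub>v (ns ! 0)) = 0\<^sub>v (ns ! i)" if i: "i \<le> d" for i
  proof -
    have "0 \<cdot>\<^sub>v 0\<^sub>v (ns ! 0) = (0\<^sub>v (ns ! 0) :: real vec)" by (intro eq_vecI) auto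
    then have "partial i (0\<^sub>v (ns ! 0)) = 0 \<cdot>\<^sub>v partial i (0\<^sub>v (ns ! 0))"
      using partial_smult[OF i, of "0\<^sub>v (ns ! 0)" 0] by simp
    also have "\<dots> = 0\<^sub>v (ns ! i)"
      using partial_carrier[OF i, of "0\<^sub>v (ns ! 0)"] by (intro eq_vecI) auto
    finally show ?thesis .
  qed
  moreover have "c \<cdot>\<^sub>v 0\<^sub>v n = (0\<^sub>v n :: real vec)" for c n by (intro eq_vecI) auto
  ultimately have s: "scaled i 0 = 0\<^sub>v (ns ! i)" if "i \<le> d" for i using that by (simp add: scaled_eq p)
  have "vabs (A *\<^sub>v 0\<^sub>v (ns ! d)) = 0\<^sub>v m" using A by (intro eq_vecI) (auto simp: vabs_nth)
  then show "i \<le> Suc d \<Longrightarrow> out i 0 = 0" using s by (simp add: out_def embed_simps)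
qed

text \<open>Where the activations at s and t differ, the two numbers are not strictly on the same
  side of 0, so |t| \<le> |s - t|. This holds for step and sign function alike.\<close>

lemma layer_mismatch:
  assumes i: "i \<le> d"
  shows "norm (layer i (out i x) (out i y) - layer i (out i y) (out i y))
      \<le> norm (layer i (out i x) (out i x - out i y) - layer i (out i y) (out i x - out i y))"
proof -
  let ?X = "scaled i x" and ?Y = "scaled i y" and ?W = "weight i"
  have c: "?X \<in> carrier_vec (ns ! i)" "?Y \<in> carrier_vec (ns ! i)" using i by (auto intro: scaled_carrier)
  have W: "?W \<in> carrier_mat (out_dim i) (ns ! i)" using weight_carrier[OF i] .
  have dl: "layer i (out i x) (embed u) - layer i (out i y) (embed u)
      = gain i *\<^sub>R embed (gated i ?X *\<^sub>v u - gated i ?Y *\<^sub>v u)" if "u \<in> carrier_vec (ns ! i)" for u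
    using i that gated_carrier[OF i] by (simp add: layer_def project_out embed_simps(2)[of _ "out_dim i"] scaleR_diff_right)
  have act: "\<bar>(activation i s - activation i t) * t\<bar> \<le> \<bar>(activation i s - activation i t) * (s - t)\<bar>" for s t :: real
    by (auto simp: activation_def sgn_if)
  have "vnorm (gated i ?X *\<^sub>v ?Y - gated i ?Y *\<^sub>v ?Y) \<le> vnorm (gated i ?X *\<^sub>v (?X - ?Y) - gated i ?Y *\<^sub>v (?X - ?Y))"
  proof (rule vnorm_mono)
    fix j assume "j < dim_vec (gated i ?X *\<^sub>v ?Y - gated i ?Y *\<^sub>v ?Y)"
    then have j: "j < out_dim i" using carrier_matD[OF gated_carrier[OF i, of ?Y]] by simp
    have "?W *\<^sub>v (?X - ?Y) = ?W *\<^sub>v ?X - ?W *\<^sub>v ?Y" using W c by (intro mult_minus_distrib_mat_vec) auto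
    then have "(?W *\<^sub>v (?X - ?Y)) $ j = (?W *\<^sub>v ?X) $ j - (?W *\<^sub>v ?Y) $ j" using W j by (simp del: index_mult_mat_vec)
    then show "\<bar>(gated i ?X *\<^sub>v ?Y - gated i ?Y *\<^sub>v ?Y) $ j\<bar> \<le> \<bar>(gated i ?X *\<^sub>v (?X - ?Y) - gated i ?Y *\<^sub>v (?X - ?Y)) $ j\<bar>"
      using act[of "(?W *\<^sub>v ?X) $ j" "(?W *\<^sub>v ?Y) $ j"] c j i
      by (simp add: gated_mult left_diff_distrib del: index_mult_mat_vec)
  qed (use gated_carrier[OF i] in simp)
  moreover have oy: "embed ?Y = out i y" using i by (simp add: out_def)
  moreover have "?X - ?Y \<in> carrier_vec (ns ! i)" using c by simp
  ultimately show ?thesis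
    using dl[OF c(2), unfolded oy] dl[of "?X - ?Y", folded out_diff[OF i]]
    by (simp add: norm_embed mult_left_mono)
qed

text \<open>Both concentration conditions in one form, with S the swap at the two outputs. The two
  factors sqrt 2 double the coefficients of \<open>Qmat\<close> into slope and residual, and the
  error with them; \<open>Phi\<close> has those of the last layer already, and its factor 33 covers
  the doubled error.\<close>

lemma frame_exists:
  assumes i: "i \<le> d" and x: "x \<in> inputs" "out i x \<noteq> 0" and y: "y \<in> inputs" "out i y \<noteq> 0"
  obtains S where "\<And>u. \<bar>inner (S u) u\<bar> \<le> (norm u)\<^sup>2" "S (out i y) = (norm (out i y) / norm (out i x)) *\<^sub>R out i x"
    "\<And>a b a' b'. \<bar>inner (layer i (out i y) (out i a - out i b)) (layer i (out i x) (out i a' - out i b'))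
      - (layer_slope d i (cosine (out i x) (out i y)) * inner (out i a - out i b) (out i a' - out i b')
        + (layer_kernel d i (cosine (out i x) (out i y)) - cosine (out i x) (out i y) * layer_slope d i (cosine (out i x) (out i y)))
          * inner (S (out i a - out i b)) (out i a' - out i b'))\<bar>
      \<le> 33 * \<epsilon>\<^sub>0 * norm (out i a - out i b) * norm (out i a' - out i b')"
proof -
  let ?X = "scaled i x" and ?Y = "scaled i y" and ?r = "cosine (out i x) (out i y)"
  define S where "S = swap_map (embed (unitv ?X)) (embed (unitv ?Y))"
  have oe: "out i x = embed ?X" "out i y = embed ?Y" using i by (auto simp: out_def)
  have c: "?X \<in> carrier_vec (ns ! i)" "?Y \<in> carrier_vec (ns ! i)" using i by (auto intro: scaled_carrier)
  have nz: "?X \<noteq> 0\<^sub>v (ns ! i)" "?Y \<noteq> 0\<^sub>v (ns ! i)" using x y c by (auto simp: oe embed_eq_0_iff)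
  have ang: "vangle ?X ?Y = arccos ?r" "sin (vangle ?X ?Y) = sqrt (1 - ?r\<^sup>2)"
    using vangle_cosine[OF c] by (auto simp: oe)
  have lay: "layer i (out i z) (embed u) = gain i *\<^sub>R embed (gated i (scaled i z) *\<^sub>v u)" if "u \<in> carrier_vec (ns ! i)" for z u
    using i that by (simp add: layer_def project_out)
  have bound: "\<bar>inner (layer i (out i y) (out i a - out i b)) (layer i (out i x) (out i a' - out i b'))
      - (layer_slope d i ?r * inner (out i a - out i b) (out i a' - out i b')
        + (layer_kernel d i ?r - ?r * layer_slope d i ?r) * inner (S (out i a - out i b)) (out i a' - out i b'))\<bar>
      \<le> 33 * \<epsilon>\<^sub>0 * norm (out i a - out i b) * norm (out i a' - out i b')" for a b a' b'
  proof -
    define g where "g = scaled i a - scaled i b"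
    define h where "h = scaled i a' - scaled i b'"
    have gh: "g \<in> carrier_vec (ns ! i)" "h \<in> carrier_vec (ns ! i)" using i by (simp_all add: g_def h_def scaled_carrier)
    have eg: "out i a - out i b = embed g" "out i a' - out i b' = embed h" using i by (auto simp: g_def h_def out_diff)
    note fm = frame_matrix[OF gated_carrier[OF i, of ?X] gated_carrier[OF i, of ?Y] c(1) nz(1) c(2) nz(2) gh refl]
    show ?thesis
    proof (cases "i < d")
      case True
      let ?c1 = "(pi - vangle ?X ?Y) / (2 * pi)" and ?c2 = "sin (vangle ?X ?Y) / (2 * pi)"
      have dc: "dim_col (Ws ! i) = ns ! i" using Ws(2)[OF True] by auto
      have "opnorm ((gated i ?X)\<^sup>T * gated i ?Y - Qmat ?X ?Y) \<le> \<epsilon>\<^sub>0"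
        using wdc[OF True] c nz True unfolding WDC_def dc by (simp add: gated_def)
      then have "\<bar>(((gated i ?X)\<^sup>T * gated i ?Y - Qmat ?X ?Y) *\<^sub>v g) \<bullet> h\<bar> \<le> \<epsilon>\<^sub>0 * vnorm g * vnorm h"
        using gh fm(3)[of ?c1 ?c2] unfolding Qmat_def by (intro opnorm_bilinear) auto
      then have "\<bar>inner (embed (gated i ?Y *\<^sub>v g)) (embed (gated i ?X *\<^sub>v h))
         - (?c1 * inner (embed g) (embed h) + ?c2 * inner (S (embed g)) (embed h))\<bar> \<le> \<epsilon>\<^sub>0 * norm (embed g) * norm (embed h)"
        unfolding Qmat_def fm(1) S_def norm_embed .
      then have "\<bar>2 * (inner (embed (gated i ?Y *\<^sub>v g)) (embed (gated i ?X *\<^sub>v h))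
         - (?c1 * inner (embed g) (embed h) + ?c2 * inner (S (embed g)) (embed h)))\<bar> \<le> 2 * (\<epsilon>\<^sub>0 * norm (embed g) * norm (embed h))"
        by (simp add: abs_mult)
      also have "2 * (inner (embed (gated i ?Y *\<^sub>v g)) (embed (gated i ?X *\<^sub>v h))
         - (?c1 * inner (embed g) (embed h) + ?c2 * inner (S (embed g)) (embed h)))
        = inner (layer i (out i y) (embed g)) (layer i (out i x) (embed h))
         - (2 * ?c1 * inner (embed g) (embed h) + 2 * ?c2 * inner (S (embed g)) (embed h))"
        using gh True by (simp add: lay gain_def algebra_simps)
      also have "2 * ?c1 = layer_slope d i ?r" using True by (simp add: layer_slope_def arc_slope_def ang diff_divide_distrib)
      also have "2 * ?c2 = layer_kernel d i ?r - ?r * layer_slope d i ?r" unfolding layer_residual ang(2) using True by simp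
      also have "2 * (\<epsilon>\<^sub>0 * norm (embed g) * norm (embed h)) \<le> 33 * \<epsilon>\<^sub>0 * norm (embed g) * norm (embed h)"
        using eps0(1) mult_nonneg_nonneg[OF mult_nonneg_nonneg[OF less_imp_le[OF eps0(1)] norm_ge_zero[of "embed g"]] norm_ge_zero[of "embed h"]]
        by simp
      finally show ?thesis unfolding eg .
    next
      case False
      then have id: "i = d" using i by simp
      let ?c1 = "(pi - 2 * vangle ?X ?Y) / pi" and ?c2 = "2 * sin (vangle ?X ?Y) / pi"
      \<comment> \<open>Inputs whose network outputs are the scaled vectors, since
        \<open>RRCP\<close> quantifies over inputs.\<close>
      define p where "p z = sqrt 2 ^ d \<cdot>\<^sub>v project (ns ! 0) z" for z
      have p: "p z \<in> carrier_vec (ns ! 0)" "Gnet Ws (p z) = scaled i z" for z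
        by (simp_all add: p_def id scaled_def partial_d)
      have "\<bar>(((Asgn A (Gnet Ws (p x)))\<^sup>T * Asgn A (Gnet Ws (p y)) - Phi (Gnet Ws (p x)) (Gnet Ws (p y)))
          *\<^sub>v (Gnet Ws (p a) - Gnet Ws (p b))) \<bullet> (Gnet Ws (p a') - Gnet Ws (p b'))\<bar>
         \<le> 33 * \<epsilon>\<^sub>0 * vnorm (Gnet Ws (p a) - Gnet Ws (p b)) * vnorm (Gnet Ws (p a') - Gnet Ws (p b'))"
        using rrcp p(1) unfolding RRCP_def by blast
      then have "\<bar>(((gated i ?X)\<^sup>T * gated i ?Y - Phi ?X ?Y) *\<^sub>v g) \<bullet> h\<bar> \<le> 33 * \<epsilon>\<^sub>0 * vnorm g * vnorm h"
        unfolding p(2) g_def h_def using False by (simp add: gated_def)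
      moreover have "Phi ?X ?Y = ?c1 \<cdot>\<^sub>m 1\<^sub>m (dim_vec ?X) + ?c2 \<cdot>\<^sub>m swapm ?X ?Y"
        using nz c by (simp add: Phi_def)
      ultimately have "\<bar>inner (embed (gated i ?Y *\<^sub>v g)) (embed (gated i ?X *\<^sub>v h))
         - (?c1 * inner (embed g) (embed h) + ?c2 * inner (S (embed g)) (embed h))\<bar> \<le> 33 * \<epsilon>\<^sub>0 * norm (embed g) * norm (embed h)"
        by (simp only: fm(1) S_def norm_embed)
      also have "inner (embed (gated i ?Y *\<^sub>v g)) (embed (gated i ?X *\<^sub>v h))
        = inner (layer i (out i y) (embed g)) (layer i (out i x) (embed h))"
        using gh lay[of g y] lay[of h x] id by (simp add: gain_def)
      also have "?c1 = layer_slope d i ?r" using False by (simp add: layer_slope_def arc_slope_def ang diff_divide_distrib)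
      also have "?c2 = layer_kernel d i ?r - ?r * layer_slope d i ?r" unfolding layer_residual ang(2) using False by simp
      finally show ?thesis unfolding eg .
    qed
  qed
  have "S (out i y) = (norm (out i y) / norm (out i x)) *\<^sub>R out i x"
    unfolding S_def oe by (rule swap_map_unitv[OF c(1) nz(1) c(2) nz(2)])
  moreover have "\<bar>inner (S u) u\<bar> \<le> (norm u)\<^sup>2" for u unfolding S_def by (rule swap_map_bound)
  ultimately show ?thesis using that[of S] bound by blast
qed

lemma cosine_self: "x \<noteq> 0 \<Longrightarrow> cosine x x = 1" for x :: fin_seq
  by (simp add: cosine_def power2_norm_eq_inner[symmetric] power2_eq_square)

lemma layer_isometry:
  assumes "i \<le> d" "x \<in> inputs" "out i x \<noteq> 0"
  shows "\<bar>inner (layer i (out i x) (out i a - out i b)) (layer i (out i x) (out i a' - out i b'))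
     - inner (out i a - out i b) (out i a' - out i b')\<bar>
      \<le> 33 * \<epsilon>\<^sub>0 * norm (out i a - out i b) * norm (out i a' - out i b')"
proof -
  have s: "layer_slope d i 1 = 1" "layer_kernel d i 1 = 1" by (simp_all add: layer_slope_def layer_kernel_def)
  from frame_exists[OF assms assms(2,3)] obtain S where
    "\<bar>inner (layer i (out i x) (out i a - out i b)) (layer i (out i x) (out i a' - out i b'))
      - (layer_slope d i (cosine (out i x) (out i x)) * inner (out i a - out i b) (out i a' - out i b')
        + (layer_kernel d i (cosine (out i x) (out i x)) - cosine (out i x) (out i x) * layer_slope d i (cosine (out i x) (out i x)))
          * inner (S (out i a - out i b)) (out i a' - out i b'))\<bar>
      \<le> 33 * \<epsilon>\<^sub>0 * norm (out i a - out i b) * norm (out i a' - out i b')" by metis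
  then show ?thesis by (simp add: cosine_self[OF assms(3)] s)
qed

lemma out_0: "x \<in> inputs \<Longrightarrow> out 0 x = x"
proof -
  assume "x \<in> inputs"
  then obtain v where v: "v \<in> carrier_vec (ns ! 0)" "x = embed v" by (auto simp: inputs_def)
  moreover have "1 \<cdot>\<^sub>v v = v" by (intro eq_vecI) auto
  ultimately show ?thesis by (simp add: out_def scaled_def partial_0)
qed

lemma eps_lt: "33 * \<epsilon>\<^sub>0 \<le> 1 / 300"
proof -
  have "3 * (33 * \<epsilon>\<^sub>0) \<le> (real d + 1) * (33 * \<epsilon>\<^sub>0)" using d eps0(1) by (intro mult_right_mono) auto
  then show ?thesis using eps0(2) by linarith
qed

text \<open>The abstract interface assumes a nonzero input, the concentration conditions a nonzero
  argument of each layer; near isometry carries one to the other.\<close>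

lemma out_nonzero: "x \<in> inputs \<Longrightarrow> x \<noteq> 0 \<Longrightarrow> i \<le> d \<Longrightarrow> out i x \<noteq> 0"
proof (induction i)
  case (Suc i)
  then have i: "i \<le> d" "out i x \<noteq> 0" by auto
  have "\<bar>inner (out (Suc i) x) (out (Suc i) x) - inner (out i x) (out i x)\<bar> \<le> 33 * \<epsilon>\<^sub>0 * norm (out i x) * norm (out i x)"
    using layer_isometry[OF i(1) Suc.prems(1) i(2), of x 0 x 0] out_zero[of i] i(1) by (simp add: out_Suc)
  moreover have "33 * \<epsilon>\<^sub>0 * norm (out i x) * norm (out i x) < inner (out i x) (out i x)"
  proof -
    have "33 * \<epsilon>\<^sub>0 * (norm (out i x))\<^sup>2 < 1 * (norm (out i x))\<^sup>2" using eps_lt i(2) by (intro mult_strict_right_mono) auto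
    then show ?thesis by (simp add: power2_norm_eq_inner[symmetric] power2_eq_square mult.assoc)
  qed
  ultimately show ?case by auto
qed (simp add: out_0)

sublocale layered_net inputs d layer out "33 * \<epsilon>\<^sub>0"
proof
  show "2 \<le> d" by (rule d)
  show "0 < 33 * \<epsilon>\<^sub>0" using eps0 by simp
  show "100 * (real d + 1) * (33 * \<epsilon>\<^sub>0) \<le> 1" by (rule eps0(2))
  show "subspace inputs"
  proof (rule subspaceI)
    show "0 \<in> inputs" using embed_simps(5)[of "ns ! 0"] unfolding inputs_def by (metis image_eqI zero_carrier_vec)
    show "x + y \<in> inputs" if "x \<in> inputs" "y \<in> inputs" for x y
      using that unfolding inputs_def by (auto simp: embed_simps(1)[symmetric])
    show "c *\<^sub>R x \<in> inputs" if "x \<in> inputs" for c x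
      using that unfolding inputs_def by (auto simp: embed_simps(4)[symmetric])
  qed
  fix x y u w a b a' b' :: fin_seq and i :: nat
  show "x \<in> inputs \<Longrightarrow> out 0 x = x" by (rule out_0)
  show "i \<le> d \<Longrightarrow> out (Suc i) x = layer i (out i x) (out i x)" by (rule out_Suc)
  show "layer i x (u - w) = layer i x u - layer i x w" by (rule layer_diff)
  show "i \<le> Suc d \<Longrightarrow> out i 0 = 0" by (rule out_zero)
  show "i \<le> d \<Longrightarrow> norm (layer i (out i x) (out i y) - layer i (out i y) (out i y))
      \<le> norm (layer i (out i x) (out i x - out i y) - layer i (out i y) (out i x - out i y))"
    by (rule layer_mismatch)
  show "\<bar>inner (layer i (out i x) (out i a - out i b)) (layer i (out i x) (out i a' - out i b'))
        - inner (out i a - out i b) (out i a' - out i b')\<bar>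
      \<le> 33 * \<epsilon>\<^sub>0 * norm (out i a - out i b) * norm (out i a' - out i b')" if "x \<in> inputs" "x \<noteq> 0" "i \<le> d"
    by (rule layer_isometry[OF that(3,1) out_nonzero[OF that]])
  assume x: "x \<in> inputs" "out i x \<noteq> 0" and y: "y \<in> inputs" "out i y \<noteq> 0" and i: "i \<le> d"
  obtain S where S: "\<And>u. \<bar>inner (S u) u\<bar> \<le> (norm u)\<^sup>2" "S (out i y) = (norm (out i y) / norm (out i x)) *\<^sub>R out i x"
    "\<And>a b a' b'. \<bar>inner (layer i (out i y) (out i a - out i b)) (layer i (out i x) (out i a' - out i b'))
      - (layer_slope d i (cosine (out i x) (out i y)) * inner (out i a - out i b) (out i a' - out i b')
        + (layer_kernel d i (cosine (out i x) (out i y)) - cosine (out i x) (out i y) * layer_slope d i (cosine (out i x) (out i y)))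
          * inner (S (out i a - out i b)) (out i a' - out i b'))\<bar>
      \<le> 33 * \<epsilon>\<^sub>0 * norm (out i a - out i b) * norm (out i a' - out i b')"
    using frame_exists[OF i x y] by metis
  let ?r = "cosine (out i x) (out i y)"
  show "(norm (layer i (out i x) (out i a - out i b) - layer i (out i y) (out i a - out i b)))\<^sup>2
      \<le> (8 * norm (out i x - out i y) / norm (out i x) + 4 * (33 * \<epsilon>\<^sub>0)) * (norm (out i a - out i b))\<^sup>2"
    by (rule frame_stable[where S = S], rule x(2), rule S(1), rule layer_isometry[OF i x],
        rule layer_isometry[OF i y], rule S(3))
  have "\<bar>inner (layer i (out i y) (out i y - out i 0)) (layer i (out i x) (out i a - out i b))
      - (layer_slope d i ?r * inner (out i y - out i 0) (out i a - out i b)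
        + (layer_kernel d i ?r - ?r * layer_slope d i ?r) * inner (S (out i y - out i 0)) (out i a - out i b))\<bar>
      \<le> 33 * \<epsilon>\<^sub>0 * norm (out i y - out i 0) * norm (out i a - out i b)" by (rule S(3))
  then show "\<bar>inner (layer i (out i x) (out i a - out i b)) (out (Suc i) y)
        - (layer_slope d i ?r * inner (out i a - out i b) (out i y)
          + (layer_kernel d i ?r - ?r * layer_slope d i ?r) * norm (out i y) / norm (out i x)
            * inner (out i a - out i b) (out i x))\<bar>
      \<le> 33 * \<epsilon>\<^sub>0 * norm (out i a - out i b) * norm (out i y)"
    using i out_zero[of i] by (simp add: out_Suc S(2) inner_commute mult_ac)
qed

section \<open>Convergence\<close>

lemma norm_sqrt2_power: "(sqrt 2 ^ d)\<^sup>2 = 2 ^ d" "0 < sqrt 2 ^ d" "2 powr (real d / 2) = sqrt 2 ^ d"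
proof -
  show "(sqrt 2 ^ d)\<^sup>2 = 2 ^ d" by (simp add: power_mult[symmetric] mult.commute[of d] power_mult)
  show "0 < sqrt 2 ^ d" by simp
  have "2 powr (real d / 2) = (2 powr (1/2)) powr real d" by (simp add: powr_powr)
  then show "2 powr (real d / 2) = sqrt 2 ^ d" by (simp add: powr_half_sqrt powr_realpow)
qed

lemma out_d_embed: "x \<in> carrier_vec (ns ! 0) \<Longrightarrow> out d (embed x) = sqrt 2 ^ d *\<^sub>R embed (Gnet Ws x)"
  by (simp add: out_def scaled_eq partial_d embed_simps)

lemma Gnet_carrier: "x \<in> carrier_vec (ns ! 0) \<Longrightarrow> Gnet Ws x \<in> carrier_vec (ns ! d)"
  using partial_carrier[of d x] by (simp add: partial_d)

lemma out_last_embed: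
  assumes "x \<in> carrier_vec (ns ! 0)"
  shows "out (Suc d) (embed x) = sqrt 2 ^ d *\<^sub>R embed (vabs (A *\<^sub>v Gnet Ws x))"
proof -
  have "A *\<^sub>v (sqrt 2 ^ d \<cdot>\<^sub>v Gnet Ws x) = sqrt 2 ^ d \<cdot>\<^sub>v (A *\<^sub>v Gnet Ws x)"
    using A Gnet_carrier[OF assms] by (intro mult_mat_vec) auto
  moreover have "vabs (sqrt 2 ^ d \<cdot>\<^sub>v v) = sqrt 2 ^ d \<cdot>\<^sub>v vabs v" for v
    by (intro eq_vecI) (auto simp: vabs_nth abs_mult)
  ultimately show ?thesis using assms by (simp add: out_def scaled_eq partial_d embed_simps)
qed

text \<open>Outputs and noise scale by sqrt 2 ^ d, hence objective and subgradients by 2 ^ d; this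
  is why the step size gets divided by 2 ^ d.\<close>

lemma objective_embed:
  assumes "x \<in> carrier_vec (ns ! 0)" "z \<in> carrier_vec (ns ! 0)" "\<eta> \<in> carrier_vec m"
  shows "obj (sqrt 2 ^ d *\<^sub>R embed \<eta>) (embed z) (embed x) = 2 ^ d * fobj A Ws (vabs (A *\<^sub>v Gnet Ws z) + \<eta>) x"
proof -
  have c: "vabs (A *\<^sub>v Gnet Ws y) \<in> carrier_vec m" for y using carrier_matD(1)[OF A] by (intro carrier_vecI) (simp add: vabs_def)
  have "out (Suc d) (embed x) - out (Suc d) (embed z) - sqrt 2 ^ d *\<^sub>R embed \<eta>
      = sqrt 2 ^ d *\<^sub>R embed (vabs (A *\<^sub>v Gnet Ws x) - (vabs (A *\<^sub>v Gnet Ws z) + \<eta>))"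
    using c assms by (simp add: out_last_embed embed_simps(1,2)[of _ m] algebra_simps)
  then show ?thesis
    by (simp add: obj_def fobj_def norm_embed power_mult_distrib norm_sqrt2_power)
qed

text \<open>A bound on all quotients for one \<delta> bounds the supremum for that \<delta>, and the
  infimum over \<delta> lies below it; the value of \<open>clarke_dd\<close> itself is not
  computed.\<close>

lemma clarke_embed:
  assumes x: "x \<in> carrier_vec (ns ! 0)" and z: "z \<in> carrier_vec (ns ! 0)" and \<eta>: "\<eta> \<in> carrier_vec m"
    and v: "v \<in> clarke_subdiff (ns ! 0) (fobj A Ws (vabs (A *\<^sub>v Gnet Ws z) + \<eta>)) x"
  shows "clarke_subgradient inputs (obj (sqrt 2 ^ d *\<^sub>R embed \<eta>) (embed z)) (embed x) (2 ^ d *\<^sub>R embed v)"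
  unfolding clarke_subgradient_def
proof (intro conjI ballI allI impI)
  let ?f = "fobj A Ws (vabs (A *\<^sub>v Gnet Ws z) + \<eta>)" and ?g = "obj (sqrt 2 ^ d *\<^sub>R embed \<eta>) (embed z)"
  let ?k = "ns ! 0"
  have vc: "v \<in> carrier_vec ?k" using v by (simp add: clarke_subdiff_def)
  then have "embed v \<in> inputs" by (simp add: inputs_def)
  then show "2 ^ d *\<^sub>R embed v \<in> inputs" using subspace_V by (simp add: subspace_scale)
  fix u c assume "u \<in> inputs"
  then obtain u0 where u0: "u0 \<in> carrier_vec ?k" "u = embed u0" by (auto simp: inputs_def)
  assume "\<exists>\<delta>>0. \<forall>y\<in>inputs. \<forall>t. norm (y - embed x) < \<delta> \<and> 0 < t \<and> t < \<delta> \<longrightarrow> ?g (y + t *\<^sub>R u) - ?g y \<le> c * t"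
  then obtain \<delta> where \<delta>: "0 < \<delta>" "\<And>y t. y \<in> inputs \<Longrightarrow> norm (y - embed x) < \<delta> \<Longrightarrow> 0 < t \<Longrightarrow> t < \<delta> \<Longrightarrow>
      ?g (y + t *\<^sub>R u) - ?g y \<le> c * t" by blast
  have "ereal (v \<bullet> u0) \<le> clarke_dd ?k ?f x u0" using v u0 by (simp add: clarke_subdiff_def)
  also have "\<dots> \<le> (SUP p \<in> {(y, t). y \<in> carrier_vec ?k \<and> vnorm (y - x) < \<delta> \<and> 0 < t \<and> t < \<delta>}.
      ereal ((?f (fst p + snd p \<cdot>\<^sub>v u0) - ?f (fst p)) / snd p))"
    unfolding clarke_dd_def using \<delta>(1) by (intro INF_lower) simp
  also have "\<dots> \<le> ereal (c / 2 ^ d)"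
  proof (rule SUP_least)
    fix p assume "p \<in> {(y, t). y \<in> carrier_vec ?k \<and> vnorm (y - x) < \<delta> \<and> 0 < t \<and> t < \<delta>}"
    then obtain y t where p: "p = (y, t)" "y \<in> carrier_vec ?k" "vnorm (y - x) < \<delta>" "0 < t" "t < \<delta>" by auto
    have "norm (embed y - embed x) < \<delta>" using p x by (simp add: embed_simps(2)[symmetric] norm_embed)
    moreover have "embed y \<in> inputs" using p by (simp add: inputs_def)
    ultimately have "?g (embed y + t *\<^sub>R u) - ?g (embed y) \<le> c * t" using \<delta>(2) p by blast
    moreover have "embed y + t *\<^sub>R u = embed (y + t \<cdot>\<^sub>v u0)"
      using p u0 by (simp add: embed_simps(1)[of _ ?k] embed_simps(4))
    ultimately have "2 ^ d * (?f (y + t \<cdot>\<^sub>v u0) - ?f y) \<le> c * t"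
      using p u0 z \<eta> by (simp add: objective_embed right_diff_distrib)
    then have "(?f (y + t \<cdot>\<^sub>v u0) - ?f y) / t \<le> c / 2 ^ d" using p by (simp add: field_simps)
    then show "ereal ((?f (fst p + snd p \<cdot>\<^sub>v u0) - ?f (fst p)) / snd p) \<le> ereal (c / 2 ^ d)" using p by simp
  qed
  finally have "v \<bullet> u0 \<le> c / 2 ^ d" by simp
  then show "inner (2 ^ d *\<^sub>R embed v) u \<le> c" using vc u0 by (simp add: inner_embed field_simps)
qed

lemma DPR_convergence:
  assumes z: "z \<in> carrier_vec (ns ! 0)" "z \<noteq> 0\<^sub>v (ns ! 0)" and \<eta>: "\<eta> \<in> carrier_vec m"
    and eps_le: "\<epsilon>\<^sub>0 < 1 / 10 ^ 60 / real d ^ 102"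
    and noise: "vnorm \<eta> \<le> 1 / 10 ^ 21 * vnorm z / (2 powr (real d / 2) * real d ^ 48)"
    and alpha: "0 < \<alpha>" "\<alpha> \<le> 2 ^ d / real d ^ 2"
    and run: "DPR_run (ns ! 0) (fobj A Ws (vabs (A *\<^sub>v Gnet Ws z) + \<eta>)) \<alpha> xs"
  shows "\<exists>N. real N \<le> fobj A Ws (vabs (A *\<^sub>v Gnet Ws z) + \<eta>) (xs 0) * 2 ^ (2 * d) / (real d ^ 6 * \<alpha> * \<epsilon>\<^sub>0 * (vnorm z)\<^sup>2)
      \<and> vnorm (xs N - z) \<le> real d ^ 12 * sqrt \<epsilon>\<^sub>0 * vnorm z + 3 * real d ^ 9 * 2 powr (real d / 2) * vnorm \<eta>
      \<and> (\<forall>t\<ge>N. vnorm (xs (t + 1) - z) \<le> (1 - 7/8 * \<alpha> / 2 ^ d) ^ (t + 1 - N) * vnorm (xs N - z)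
             + 16/7 * 2 powr (real d / 2) * vnorm \<eta>
           \<and> 2 powr (real d / 2) * vnorm (Gnet Ws (xs (t + 1)) - Gnet Ws z) \<le> 6/5 * vnorm (xs (t + 1) - z))"
proof -
  let ?f = "fobj A Ws (vabs (A *\<^sub>v Gnet Ws z) + \<eta>)" and ?k = "ns ! 0"
  define q where "q = sqrt 2 ^ d"
  define D where "D = real d"
  note q2 = norm_sqrt2_power[folded q_def]
  \<comment> \<open>The largest value that \<open>E_le\<close> allows; half of it is spent on the
    concentration error and half on the noise.\<close>
  define E where "E = 1 / (10 ^ 20 * D ^ 40)"
  have D: "2 \<le> D" using d by (simp add: D_def)
  have zin: "embed z \<in> inputs" "embed z \<noteq> 0" using z by (auto simp: inputs_def embed_eq_0_iff)
  have nz: "0 < vnorm z" using vnorm_eq_0_iff[OF z(1)] z(2) vnorm_nonneg[of z] by linarith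
  have e1: "200 * D\<^sup>2 * sqrt (33 * \<epsilon>\<^sub>0) \<le> E / 2"
  proof -
    define X where "X = 1 / 10 ^ 60 / D ^ 102"
    have "0 \<le> X" using D by (simp add: X_def)
    \<comment> \<open>33 is rounded up to the square 36, which makes the root rational in the
      depth.\<close>
    then have "33 * \<epsilon>\<^sub>0 \<le> 36 * X" using eps_le[folded D_def, folded X_def] eps0(1) by linarith
    also have "36 * X = (6 / 10 ^ 30 / D ^ 51)\<^sup>2" by (simp add: X_def power_divide flip: power_mult)
    finally have "33 * \<epsilon>\<^sub>0 \<le> (6 / 10 ^ 30 / D ^ 51)\<^sup>2" .
    then have "sqrt (33 * \<epsilon>\<^sub>0) \<le> 6 / 10 ^ 30 / D ^ 51" using D by (intro real_le_lsqrt) auto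
    then have "200 * D\<^sup>2 * sqrt (33 * \<epsilon>\<^sub>0) \<le> 200 * D\<^sup>2 * (6 / 10 ^ 30 / D ^ 51)" by (intro mult_left_mono) auto
    also have "D ^ 51 = D\<^sup>2 * (D ^ 9 * D ^ 40)" by (simp flip: power_add)
    also have "200 * D\<^sup>2 * (6 / 10 ^ 30 / (D\<^sup>2 * (D ^ 9 * D ^ 40))) = 1200 / (10 ^ 30 * D ^ 9 * D ^ 40)"
      using D by (simp add: field_simps)
    also have "\<dots> \<le> 1200 / (10 ^ 30 * 1 * D ^ 40)"
      using D one_le_power[of D 9] by (intro divide_left_mono mult_right_mono mult_left_mono) auto
    also have "\<dots> \<le> E / 2" using D by (simp add: E_def field_simps)
    finally show ?thesis .
  qed
  have nn: "norm (q *\<^sub>R embed \<eta>) = q * vnorm \<eta>" using q2 by (simp add: norm_embed)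
  have e2: "6/5 * norm (q *\<^sub>R embed \<eta>) / norm (embed z) \<le> E / 2"
  proof -
    have "vnorm \<eta> * (q * D ^ 48) \<le> 1 / 10 ^ 21 * vnorm z"
      using noise D q2 by (simp add: D_def pos_le_divide_eq)
    then have "q * vnorm \<eta> / vnorm z \<le> 1 / 10 ^ 21 / D ^ 48" using nz D by (simp add: field_simps)
    also have "\<dots> \<le> 1 / 10 ^ 21 / D ^ 40" using D by (intro divide_left_mono power_increasing) auto
    finally show ?thesis unfolding nn norm_embed using D by (simp add: E_def field_simps)
  qed
  interpret descent inputs d layer out "33 * \<epsilon>\<^sub>0" "embed z" "q *\<^sub>R embed \<eta>" E
  proof
    show "200 * (real d)\<^sup>2 * sqrt (33 * \<epsilon>\<^sub>0) + 6/5 * norm (q *\<^sub>R embed \<eta>) / norm (embed z) \<le> E"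
      using e1 e2 by (simp add: D_def)
    show "10 ^ 20 * real d ^ 40 * E \<le> 1" using D by (simp add: E_def D_def)
  qed (use zin in auto)
  have fe: "obj (q *\<^sub>R embed \<eta>) (embed z) (embed x) = 2 ^ d * ?f x" if "x \<in> carrier_vec ?k" for x
    unfolding q_def using that z \<eta> by (intro objective_embed) auto
  define xb where "xb t = (if ?f (- xs t) < ?f (xs t) then - xs t else xs t)" for t
  have start: "xs 0 \<in> carrier_vec ?k" "xs 0 \<noteq> 0\<^sub>v ?k"
    and step: "\<exists>v \<in> clarke_subdiff ?k ?f (xb t). xs (Suc t) = xb t - \<alpha> \<cdot>\<^sub>v v" for t
    using run by (auto simp: DPR_run_def Let_def xb_def)
  have xc: "xs t \<in> carrier_vec ?k" for t
  proof (induction t)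
    case (Suc t)
    obtain v where "v \<in> clarke_subdiff ?k ?f (xb t)" "xs (Suc t) = xb t - \<alpha> \<cdot>\<^sub>v v" using step by blast
    moreover have "xb t \<in> carrier_vec ?k" using Suc by (auto simp: xb_def)
    ultimately show ?case by (auto simp: clarke_subdiff_def)
  qed (rule start)
  have xbc: "xb t \<in> carrier_vec ?k" for t using xc[of t] by (auto simp: xb_def)
  interpret descent_run inputs d layer out "33 * \<epsilon>\<^sub>0" "embed z" "q *\<^sub>R embed \<eta>" E "\<alpha> / 2 ^ d" "\<lambda>t. embed (xs t)" \<epsilon>\<^sub>0
  proof
    show "embed (xs 0) \<in> inputs" "embed (xs 0) \<noteq> 0" using start by (auto simp: inputs_def embed_eq_0_iff)
    show "0 < \<alpha> / 2 ^ d" "\<alpha> / 2 ^ d \<le> 1 / (real d)\<^sup>2" using alpha by (auto simp: field_simps)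
    show "0 < \<epsilon>\<^sub>0" "\<epsilon>\<^sub>0 \<le> 33 * \<epsilon>\<^sub>0" using eps0 by auto
    fix t
    let ?b = "if f (- embed (xs t)) < f (embed (xs t)) then - embed (xs t) else embed (xs t)"
    have "- embed (xs t) = embed (- xs t)" by (simp add: embed_simps)
    then have b: "?b = embed (xb t)" using xc[of t] by (simp add: fe xb_def)
    obtain v where v: "v \<in> clarke_subdiff ?k ?f (xb t)" "xs (Suc t) = xb t - \<alpha> \<cdot>\<^sub>v v" using step by blast
    have vc: "v \<in> carrier_vec ?k" using v by (simp add: clarke_subdiff_def)
    have "clarke_subgradient inputs f (embed (xb t)) (2 ^ d *\<^sub>R embed v)"
      unfolding q_def by (rule clarke_embed[OF xbc z(1) \<eta> v(1)])
    moreover have "embed (xs (Suc t)) = embed (xb t) - (\<alpha> / 2 ^ d) *\<^sub>R 2 ^ d *\<^sub>R embed v"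
      using v(2) vc xbc[of t] by (simp add: embed_simps(2)[of _ ?k] embed_simps(4))
    ultimately show "\<exists>v. clarke_subgradient inputs f ?b v \<and> embed (xs (Suc t)) = ?b - (\<alpha> / 2 ^ d) *\<^sub>R v"
      unfolding b by blast
  qed
  have nd: "norm (embed (xs t) - embed z) = vnorm (xs t - z)" for t
    using xc[of t] z(1) by (simp add: embed_simps(2)[of _ ?k, symmetric] norm_embed)
  have od: "norm (out d (embed (xs t)) - out d (embed z)) = q * vnorm (Gnet Ws (xs t) - Gnet Ws z)" for t
  proof -
    have "out d (embed (xs t)) - out d (embed z) = q *\<^sub>R embed (Gnet Ws (xs t) - Gnet Ws z)"
      using xc[of t] z(1) Gnet_carrier
      by (simp add: out_d_embed q_def embed_simps(2)[of _ "ns ! d"] scaleR_diff_right)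
    then show ?thesis using q2 by (simp add: norm_embed)
  qed
  have bud: "f (embed (xs 0)) / (real d ^ 6 * (\<alpha> / 2 ^ d) * \<epsilon>\<^sub>0 * (norm (embed z))\<^sup>2)
      = ?f (xs 0) * 2 ^ (2 * d) / (real d ^ 6 * \<alpha> * \<epsilon>\<^sub>0 * (vnorm z)\<^sup>2)"
    unfolding mult_2 power_add using xc[of 0] by (simp add: fe norm_embed)
  show ?thesis
    using convergence unfolding bud nd od nn unfolding norm_embed q2(3) by (simp add: mult_ac)
qed

end

theorem theorem1:
  "\<exists>c1 c2 c3 C4 C5 C6 :: real. c1 > 0 \<and> c2 > 0 \<and> c3 > 0 \<and> C4 > 0 \<and> C5 > 0 \<and> C6 > 0 \<and>
   (\<forall>(d::nat) (ns::nat list) (Ws::real mat list) (A::real mat) (m::nat) (\<epsilon>::real)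
      (xstar::real vec) (\<eta>::real vec) (\<alpha>::real) (xs::nat \<Rightarrow> real vec).
     d \<ge> 2 \<longrightarrow>
     length ns = d + 1 \<longrightarrow> sorted_wrt (<) ns \<longrightarrow>
     length Ws = d \<longrightarrow> (\<forall>i < d. Ws ! i \<in> carrier_mat (ns ! (i+1)) (ns ! i)) \<longrightarrow>
     A \<in> carrier_mat m (ns ! d) \<longrightarrow>
     0 < \<epsilon> \<longrightarrow> \<epsilon> < c1 / real d ^ 102 \<longrightarrow>
     xstar \<in> carrier_vec (ns ! 0) \<longrightarrow> xstar \<noteq> 0\<^sub>v (ns ! 0) \<longrightarrow>
     \<eta> \<in> carrier_vec m \<longrightarrow>
     vnorm \<eta> \<le> c2 * vnorm xstar / (2 powr (real d / 2) * real d ^ 48) \<longrightarrow>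
     (\<forall>i < d. WDC (Ws ! i) \<epsilon>) \<longrightarrow>
     RRCP A Ws (ns ! 0) \<epsilon> \<longrightarrow>
     0 < \<alpha> \<longrightarrow> \<alpha> \<le> c3 * 2 ^ d / real d ^ 2 \<longrightarrow>
     DPR_run (ns ! 0) (fobj A Ws (vabs (A *\<^sub>v Gnet Ws xstar) + \<eta>)) \<alpha> xs \<longrightarrow>
     (let f = fobj A Ws (vabs (A *\<^sub>v Gnet Ws xstar) + \<eta>);
          \<tau> = 1 - 7/8 * \<alpha> / 2 ^ d;
          \<theta> = 2 * c3 / (1 - \<tau>) in
      0 < \<tau> \<and> \<tau> < 1 \<and>
      (\<exists>N::nat.
         real N \<le> C4 * f (xs 0) * 2 ^ (2 * d) / (real d ^ 6 * \<alpha> * \<epsilon> * (vnorm xstar)\<^sup>2) \<and>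
         vnorm (xs N - xstar) \<le> C5 * real d ^ 12 * sqrt \<epsilon> * vnorm xstar
                                + C6 * real d ^ 9 * 2 powr (real d / 2) * vnorm \<eta> \<and>
         (\<forall>t \<ge> N.
            vnorm (xs (t+1) - xstar) \<le> \<tau> ^ (t + 1 - N) * vnorm (xs N - xstar)
                                      + \<theta> * 2 powr (real d / 2) / real d ^ 2 * vnorm \<eta> \<and>
            vnorm (Gnet Ws (xs (t+1)) - Gnet Ws xstar) \<le>
               1.2 / 2 powr (real d / 2) * \<tau> ^ (t + 1 - N) * vnorm (xs N - xstar)
               + 1.2 / real d ^ 2 * \<theta> * vnorm \<eta>))))"
proof (rule exI[of _ "1 / 10 ^ 60"], rule exI[of _ "1 / 10 ^ 21"], rule exI[of _ 1], rule exI[of _ 1],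
    rule exI[of _ 1], rule exI[of _ 3], intro conjI allI impI)
  fix d :: nat and ns :: "nat list" and Ws :: "real mat list" and A :: "real mat" and m :: nat and \<epsilon> :: real
    and z :: "real vec" and \<eta> :: "real vec" and \<alpha> :: real and xs :: "nat \<Rightarrow> real vec"
  assume as: "2 \<le> d" "length ns = d + 1" "sorted_wrt (<) ns" "length Ws = d"
    "\<forall>i<d. Ws ! i \<in> carrier_mat (ns ! (i + 1)) (ns ! i)" "A \<in> carrier_mat m (ns ! d)" "0 < \<epsilon>"
    "\<epsilon> < 1 / 10 ^ 60 / real d ^ 102" "z \<in> carrier_vec (ns ! 0)" "z \<noteq> 0\<^sub>v (ns ! 0)" "\<eta> \<in> carrier_vec m"
    "vnorm \<eta> \<le> 1 / 10 ^ 21 * vnorm z / (2 powr (real d / 2) * real d ^ 48)"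
    "\<forall>i<d. WDC (Ws ! i) \<epsilon>" "RRCP A Ws (ns ! 0) \<epsilon>" "0 < \<alpha>" "\<alpha> \<le> 1 * 2 ^ d / real d ^ 2"
    "DPR_run (ns ! 0) (fobj A Ws (vabs (A *\<^sub>v Gnet Ws z) + \<eta>)) \<alpha> xs"
  define D where "D = real d"
  define a where "a = \<alpha> / 2 ^ d"
  define q where "q = 2 powr (real d / 2)"
  define \<tau> where "\<tau> = 1 - 7/8 * \<alpha> / 2 ^ d"
  have D: "2 \<le> D" using as(1) by (simp add: D_def)
  have D4: "4 \<le> D\<^sup>2" using power_mono[of 2 D 2] D by simp
  interpret network d ns Ws A m \<epsilon>
  proof
    have "D ^ 1 \<le> D ^ 102" using D by (intro power_increasing) auto
    then have "\<epsilon> * D \<le> \<epsilon> * D ^ 102" using as(7) by simp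
    also have "\<dots> \<le> 1 / 10 ^ 60" using as(8) D by (simp add: D_def field_simps)
    finally have "\<epsilon> * D \<le> 1 / 10 ^ 60" .
    moreover have "\<epsilon> * 1 \<le> \<epsilon> * D" using D as(7) by (intro mult_left_mono) auto
    ultimately show "100 * (real d + 1) * (33 * \<epsilon>) \<le> 1" by (simp add: D_def algebra_simps)
  qed (use as in auto)
  have a: "0 < a" "a * D\<^sup>2 \<le> 1" "a \<le> 1/4" and ta: "\<tau> = 1 - 7/8 * a"
  proof -
    show "0 < a" "\<tau> = 1 - 7/8 * a" using as(15) by (simp_all add: a_def \<tau>_def)
    show 1: "a * D\<^sup>2 \<le> 1" using as(16) D by (simp add: a_def D_def field_simps)
    have "a * 4 \<le> a * D\<^sup>2" using D4 \<open>0 < a\<close> by simp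
    then show "a \<le> 1/4" using 1 by linarith
  qed
  have q: "0 < q" by (simp add: q_def)
  \<comment> \<open>As 1 - \<tau> = 7/8 a and a D^2 \<le> 1, the quotient \<theta> / D^2 is at least
    16/7, the noise constant of the contraction phase.\<close>
  define \<theta> where "\<theta> = 2 * 1 / (1 - \<tau>)"
  have th: "16/7 \<le> \<theta> / D\<^sup>2"
  proof -
    have "\<theta> / D\<^sup>2 = 16 / (7 * (a * D\<^sup>2))" using a by (simp add: \<theta>_def ta field_simps)
    moreover have "16 / 7 \<le> 16 / (7 * (a * D\<^sup>2))" using a D by (intro divide_left_mono mult_pos_pos zero_less_power) auto
    ultimately show ?thesis by simp
  qed
  obtain N where N: "real N \<le> fobj A Ws (vabs (A *\<^sub>v Gnet Ws z) + \<eta>) (xs 0) * 2 ^ (2 * d) / (D ^ 6 * \<alpha> * \<epsilon> * (vnorm z)\<^sup>2)"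
    "vnorm (xs N - z) \<le> D ^ 12 * sqrt \<epsilon> * vnorm z + 3 * D ^ 9 * q * vnorm \<eta>"
    "\<And>t. N \<le> t \<Longrightarrow> vnorm (xs (t + 1) - z) \<le> \<tau> ^ (t + 1 - N) * vnorm (xs N - z) + 16/7 * q * vnorm \<eta>"
    "\<And>t. N \<le> t \<Longrightarrow> q * vnorm (Gnet Ws (xs (t + 1)) - Gnet Ws z) \<le> 6/5 * vnorm (xs (t + 1) - z)"
    using DPR_convergence[OF as(9-11) as(8) as(12) as(15) _ as(17)] as(16)
    unfolding q_def[symmetric] \<tau>_def[symmetric] unfolding D_def[symmetric] by auto
  have tail: "vnorm (xs (t + 1) - z) \<le> \<tau> ^ (t + 1 - N) * vnorm (xs N - z) + \<theta> * q / D\<^sup>2 * vnorm \<eta>" if "N \<le> t" for t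
  proof -
    have "16/7 * (q * vnorm \<eta>) \<le> \<theta> / D\<^sup>2 * (q * vnorm \<eta>)" using th q by (intro mult_right_mono) auto
    moreover have "\<theta> / D\<^sup>2 * (q * vnorm \<eta>) = \<theta> * q / D\<^sup>2 * vnorm \<eta>" by simp
    ultimately show ?thesis using N(3)[OF that] by linarith
  qed
  have tailG: "vnorm (Gnet Ws (xs (t + 1)) - Gnet Ws z) \<le> 1.2 / q * \<tau> ^ (t + 1 - N) * vnorm (xs N - z) + 1.2 / D\<^sup>2 * \<theta> * vnorm \<eta>"
    if "N \<le> t" for t
  proof -
    have "q * vnorm (Gnet Ws (xs (t + 1)) - Gnet Ws z)
        \<le> 6/5 * (\<tau> ^ (t + 1 - N) * vnorm (xs N - z) + \<theta> * q / D\<^sup>2 * vnorm \<eta>)"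
      using N(4)[OF that] mult_left_mono[OF tail[OF that], of "6/5"] by simp
    also have "\<dots> = q * (1.2 / q * \<tau> ^ (t + 1 - N) * vnorm (xs N - z) + 1.2 / D\<^sup>2 * \<theta> * vnorm \<eta>)"
      using q by (simp add: algebra_simps)
    finally show ?thesis using q by simp
  qed
  have t01: "0 < \<tau>" "\<tau> < 1" using a ta by auto
  show "let f = fobj A Ws (vabs (A *\<^sub>v Gnet Ws z) + \<eta>); \<tau> = 1 - 7/8 * \<alpha> / 2 ^ d; \<theta> = 2 * 1 / (1 - \<tau>) in
      0 < \<tau> \<and> \<tau> < 1 \<and>
      (\<exists>N::nat. real N \<le> 1 * f (xs 0) * 2 ^ (2 * d) / (real d ^ 6 * \<alpha> * \<epsilon> * (vnorm z)\<^sup>2) \<and>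
         vnorm (xs N - z) \<le> 1 * real d ^ 12 * sqrt \<epsilon> * vnorm z + 3 * real d ^ 9 * 2 powr (real d / 2) * vnorm \<eta> \<and>
         (\<forall>t \<ge> N.
            vnorm (xs (t+1) - z) \<le> \<tau> ^ (t + 1 - N) * vnorm (xs N - z) + \<theta> * 2 powr (real d / 2) / real d ^ 2 * vnorm \<eta> \<and>
            vnorm (Gnet Ws (xs (t+1)) - Gnet Ws z) \<le>
               1.2 / 2 powr (real d / 2) * \<tau> ^ (t + 1 - N) * vnorm (xs N - z) + 1.2 / real d ^ 2 * \<theta> * vnorm \<eta>))"
    unfolding Let_def \<tau>_def[symmetric] \<theta>_def[symmetric] q_def[symmetric] mult_1_left
    unfolding D_def[symmetric]
    by (intro conjI exI[of _ N] allI impI t01 N(1,2) tail tailG)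
qed auto

end
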